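(* For all integers $a,b\ge 0$, the $q$-Fierz coefficient $F(a,b)$ of a spinor theory is given by $$F(a,b)=\sum_{m=0}^{\min(a,b)} C(m)\,(-1)^{ab-m^2}\,z^{-2m}\,q^{ab-2(a-m)(b-m)}\,X(a-m,b-m,m)\prod_{k=0}^{a+b-m-1}[2n-k],$$ where $$C(m)=\Bigl(\prod_{k=a+b-2m+1}^{a+b-m}\frac{1}{\{k\}}\Bigr)\frac{[a]!}{[m]!\,[a-m]!}\,\frac{[b]!}{[m]!\,[b-m]!}\,[m]!$$ and, for $r,s,t\ge0$, $$X(r,s,t)=\frac{\bigl(\prod_{k=0}^{r-1}\{k\}\bigr)\bigl(\prod_{k=0}^{s-1}\{k\}\bigr)\bigl(\prod_{k=0}^{t-1}\{k\}\bigr)}{\bigl(\prod_{k=0}^{r+s-1}\{k\}\bigr)\bigl(\prod_{k=0}^{r+t-1}\{k\}\bigr)\bigl(\prod_{k=0}^{s+t-1}\{k\}\bigr)}.$$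
   Context: Scalars: $\mathbb F=\mathbb Q(q,z)$ with $q,z$ indeterminates, $\delta=(z-z^{-1})/(q-q^{-1})$. For integers $a,b$ put $[bn+a]=(z^bq^a-z^{-b}q^{-a})/(q-q^{-1})$ ($n$ is a formal symbol, with $z$ playing the role of $q^n$), $[k]!=[1]\cdots[k]$, $\{k\}=zq^{-k}+z^{-1}q^k$. Empty products are $1$. Category $\mathsf B$: the $\mathbb F$-linear strict ribbon category with objects $V^{\otimes p}$, $p\ge0$, and morphisms the $\mathbb F$-linear combinations of unoriented framed tangles modulo the relations below. Here $\mathrm{ev}\colon V\otimes V\to 1$ is the cap, $\mathrm{coev}\colon 1\to V\otimes V$ the cup, $\sigma=c_{V,V}$ the braiding (crossing), $u=\mathrm{coev}\circ\mathrm{ev}$; $\sigma_i,u_i$ act on strands $i,i+1$. Relations: $\mathrm{ev}\circ\mathrm{coev}=(zq^{-1}+z^{-1}q)\delta$, $\sigma u=z^{-2}q\,u$, $\sigma^{-1}u=z^2q^{-1}u$, $\sigma-\sigma^{-1}=(q-q^{-1})(1-u)$. $c_{a,b}\colon V^{\otimes a}\otimes V^{\otimes b}\to V^{\otimes b}\otimes V^{\otimes a}$ is the braiding (all crossings are $\sigma$). $N_a\colon V^{\otimes 2a}\to1$ is the nested cap ($N_0=1$, $N_a=\mathrm{ev}\circ(\mathrm{id}_V\otimes N_{a-1}\otimes\mathrm{id}_V)$) and $N_a^*\colon 1\to V^{\otimes 2a}$ the nested cup. Idempotents: $S_i(x)$ is defined by $(xz^{-1}+x^{-1}z)(xq-x^{-1}q^{-1})S_i(x)=(x^{-1}-x)(x^{-1}z\sigma_i+xz^{-1}\sigma_i^{-1})+(z+z^{-1})(q-q^{-1})$.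 $E(0)=1$, $E(1)=\mathrm{id}_V$, $E(p+1)=(E(p)\otimes\mathrm{id}_V)\,S_p(q^p)\,(E(p)\otimes\mathrm{id}_V)\in\mathrm{End}(V^{\otimes p+1})$. It is the idempotent characterised by $u_iE(p)=0=E(p)u_i$, $\sigma_iE(p)=-q^{-1}E(p)=E(p)\sigma_i$ for $1\le i\le p-1$. Spinor theory: a field $L\supseteq\mathbb F$, an element $\Delta\in L^\times$, an $L$-linear strict ribbon category $\mathcal C$ with $\mathrm{End}(1)=L$, an $\mathbb F$-linear ribbon functor $\mathsf B\to\mathcal C$ (objects and morphisms of $\mathsf B$ are identified with their images), an object $S$ of $\mathcal C$ and a morphism $\gamma\colon V\otimes S\to S$. Put $\gamma_0=\mathrm{id}_S$, $\gamma_p=\gamma\circ(\mathrm{id}_V\otimes\gamma_{p-1})\colon V^{\otimes p}\otimes S\to S$, $\Gamma_p=\gamma_p\circ(E(p)\otimes\mathrm{id}_S)$, and let $\tau_p\colon V^{\otimes p}\to1$ be obtained from $\gamma_p$ by closing the $S$-strand (partial categorical trace over $S$). The axioms are $\tau_0=\Delta$, $\tau_1=0$, $\tau_2=\frac{\Delta}{\{1\}}\mathrm{ev}$, $\gamma_2\circ(\mathrm{coev}\otimes\mathrm{id}_S)=\delta\,\mathrm{id}_S$, and the Clifford relations $\gamma_2\circ((q^{-1}+\sigma)\otimes\mathrm{id}_S)=z^{-1}\,\mathrm{ev}\otimes\mathrm{id}_S$ and $\gamma_2\circ((q+\sigma^{-1})\otimes\mathrm{id}_S)=z\,\mathrm{ev}\otimes\mathrm{id}_S$.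 $q$-Fierz coefficients: $F(a,b)\in L$ is defined by $$\Delta F(a,b)=\tau_{2a+2b}\circ(E(a)\otimes E(b)\otimes E(a)\otimes E(b))\circ(\mathrm{id}_{V^{\otimes a}}\otimes c_{a,b}\otimes\mathrm{id}_{V^{\otimes b}})\circ(N_a^*\otimes N_b^* ),$$ i.e. a spin loop with two crossing chords labelled $a$ and $b$. *)

theory Defs
  imports "HOL-Computational_Algebra.Polynomial" "HOL-Computational_Algebra.Fraction_Field"
begin

section \<open>Scalars\<close>

text \<open>The field of rational functions in two indeterminates over the rationals; the inner
  polynomial variable is \<open>\<q>\<close>, the outer one is \<open>\<z>\<close>.\<close>

type_synonym scalar = "rat poly poly fract"

definition qvar :: scalar ("\<q>") where
  "\<q> = Fract [:[:0, 1:]:] 1"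

definition zvar :: scalar ("\<z>") where
  "\<z> = Fract [:0, 1:] 1"

definition loop :: scalar ("\<delta>") where
  "\<delta> = (\<z> - inverse \<z>) / (\<q> - inverse \<q>)"

text \<open>\<open>qint b a\<close> is $[bn+a]$ and \<open>qbrace k\<close> is $\{k\}$.\<close>

definition qint :: "int \<Rightarrow> int \<Rightarrow> scalar" where
  "qint b a = (\<z> powi b * \<q> powi a - \<z> powi (- b) * \<q> powi (- a)) / (\<q> - inverse \<q>)"

definition qfact :: "nat \<Rightarrow> scalar" where
  "qfact k = (\<Prod>j = 1..k. qint 0 (int j))"

definition qbrace :: "int \<Rightarrow> scalar" where
  "qbrace k = \<z> * \<q> powi (- k) + inverse \<z> * \<q> powi k"


section \<open>Linear strict ribbon categories\<close>

text \<open>\<open>Comp C g f\<close>, written \<open>g \<cdot>\<^bsub>C\<^esub> f\<close>, is \<open>g\<close> after \<open>f\<close>. Outside the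
  relevant hom-sets the operations are unspecified.\<close>

record ('o, 'm, 'k) ribbon_data =
  Obj :: "'o set"
  Hom :: "'o \<Rightarrow> 'o \<Rightarrow> 'm set"
  Id :: "'o \<Rightarrow> 'm"
  Comp :: "'m \<Rightarrow> 'm \<Rightarrow> 'm" (infixr "\<cdot>\<index>" 60)
  Zero :: "'o \<Rightarrow> 'o \<Rightarrow> 'm"
  Add :: "'m \<Rightarrow> 'm \<Rightarrow> 'm" (infixl "\<oplus>\<index>" 55)
  Scale :: "'k \<Rightarrow> 'm \<Rightarrow> 'm" (infixr "\<star>\<index>" 65)
  Unit :: "'o" ("\<one>\<index>")
  OTens :: "'o \<Rightarrow> 'o \<Rightarrow> 'o" (infixr "\<odot>\<index>" 75)
  Tens :: "'m \<Rightarrow> 'm \<Rightarrow> 'm" (infixr "\<otimes>\<index>" 70)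
  Braid :: "'o \<Rightarrow> 'o \<Rightarrow> 'm"
  Twist :: "'o \<Rightarrow> 'm"
  Dual :: "'o \<Rightarrow> 'o"
  Ev :: "'o \<Rightarrow> 'm"
  Coev :: "'o \<Rightarrow> 'm"

definition is_iso :: "('o, 'm, 'k) ribbon_data \<Rightarrow> 'o \<Rightarrow> 'o \<Rightarrow> 'm \<Rightarrow> bool" where
  "is_iso C X Y f \<longleftrightarrow> f \<in> Hom C X Y \<and>
     (\<exists>g \<in> Hom C Y X. g \<cdot>\<^bsub>C\<^esub> f = Id C X \<and> f \<cdot>\<^bsub>C\<^esub> g = Id C Y)"

locale linear_category =
  fixes C :: "('o, 'm, 'k :: field) ribbon_data" (structure)
  assumes Id_in_Hom: "X \<in> Obj C \<Longrightarrow> Id C X \<in> Hom C X X"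
    and Comp_in_Hom: "\<lbrakk>X \<in> Obj C; Y \<in> Obj C; Z \<in> Obj C; f \<in> Hom C X Y; g \<in> Hom C Y Z\<rbrakk>
      \<Longrightarrow> g \<cdot> f \<in> Hom C X Z"
    and Comp_Id: "\<lbrakk>X \<in> Obj C; Y \<in> Obj C; f \<in> Hom C X Y\<rbrakk> \<Longrightarrow> f \<cdot> Id C X = f"
    and Id_Comp: "\<lbrakk>X \<in> Obj C; Y \<in> Obj C; f \<in> Hom C X Y\<rbrakk> \<Longrightarrow> Id C Y \<cdot> f = f"
    and Comp_assoc: "\<lbrakk>W \<in> Obj C; X \<in> Obj C; Y \<in> Obj C; Z \<in> Obj C;
        f \<in> Hom C W X; g \<in> Hom C X Y; h \<in> Hom C Y Z\<rbrakk> \<Longrightarrow> (h \<cdot> g) \<cdot> f = h \<cdot> (g \<cdot> f)"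
    and Zero_in_Hom: "\<lbrakk>X \<in> Obj C; Y \<in> Obj C\<rbrakk> \<Longrightarrow> Zero C X Y \<in> Hom C X Y"
    and Add_in_Hom: "\<lbrakk>X \<in> Obj C; Y \<in> Obj C; f \<in> Hom C X Y; g \<in> Hom C X Y\<rbrakk>
      \<Longrightarrow> f \<oplus> g \<in> Hom C X Y"
    and Scale_in_Hom: "\<lbrakk>X \<in> Obj C; Y \<in> Obj C; f \<in> Hom C X Y\<rbrakk> \<Longrightarrow> a \<star> f \<in> Hom C X Y"
    and Add_assoc: "\<lbrakk>X \<in> Obj C; Y \<in> Obj C; f \<in> Hom C X Y; g \<in> Hom C X Y; h \<in> Hom C X Y\<rbrakk>
      \<Longrightarrow> (f \<oplus> g) \<oplus> h = f \<oplus> (g \<oplus> h)"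
    and Add_commute: "\<lbrakk>X \<in> Obj C; Y \<in> Obj C; f \<in> Hom C X Y; g \<in> Hom C X Y\<rbrakk>
      \<Longrightarrow> f \<oplus> g = g \<oplus> f"
    and Add_Zero: "\<lbrakk>X \<in> Obj C; Y \<in> Obj C; f \<in> Hom C X Y\<rbrakk> \<Longrightarrow> f \<oplus> Zero C X Y = f"
    and Add_inverse: "\<lbrakk>X \<in> Obj C; Y \<in> Obj C; f \<in> Hom C X Y\<rbrakk>
      \<Longrightarrow> \<exists>g \<in> Hom C X Y. f \<oplus> g = Zero C X Y"
    and Scale_Add: "\<lbrakk>X \<in> Obj C; Y \<in> Obj C; f \<in> Hom C X Y; g \<in> Hom C X Y\<rbrakk>
      \<Longrightarrow> a \<star> (f \<oplus> g) = a \<star> f \<oplus> a \<star> g"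
    and add_Scale: "\<lbrakk>X \<in> Obj C; Y \<in> Obj C; f \<in> Hom C X Y\<rbrakk>
      \<Longrightarrow> (a + b) \<star> f = a \<star> f \<oplus> b \<star> f"
    and Scale_Scale: "\<lbrakk>X \<in> Obj C; Y \<in> Obj C; f \<in> Hom C X Y\<rbrakk> \<Longrightarrow> a \<star> b \<star> f = (a * b) \<star> f"
    and one_Scale: "\<lbrakk>X \<in> Obj C; Y \<in> Obj C; f \<in> Hom C X Y\<rbrakk> \<Longrightarrow> 1 \<star> f = f"
    and Comp_Add_left: "\<lbrakk>X \<in> Obj C; Y \<in> Obj C; Z \<in> Obj C;
        f \<in> Hom C X Y; g \<in> Hom C Y Z; h \<in> Hom C Y Z\<rbrakk> \<Longrightarrow> (g \<oplus> h) \<cdot> f = (g \<cdot> f) \<oplus> (h \<cdot> f)"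
    and Comp_Add_right: "\<lbrakk>X \<in> Obj C; Y \<in> Obj C; Z \<in> Obj C;
        f \<in> Hom C X Y; g \<in> Hom C X Y; h \<in> Hom C Y Z\<rbrakk> \<Longrightarrow> h \<cdot> (f \<oplus> g) = (h \<cdot> f) \<oplus> (h \<cdot> g)"
    and Comp_Scale_left: "\<lbrakk>X \<in> Obj C; Y \<in> Obj C; Z \<in> Obj C; f \<in> Hom C X Y; g \<in> Hom C Y Z\<rbrakk>
      \<Longrightarrow> (a \<star> g) \<cdot> f = a \<star> (g \<cdot> f)"
    and Comp_Scale_right: "\<lbrakk>X \<in> Obj C; Y \<in> Obj C; Z \<in> Obj C; f \<in> Hom C X Y; g \<in> Hom C Y Z\<rbrakk>
      \<Longrightarrow> g \<cdot> (a \<star> f) = a \<star> (g \<cdot> f)"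

locale linear_strict_monoidal_category = linear_category +
  assumes Unit_in_Obj: "\<one> \<in> Obj C"
    and OTens_in_Obj: "\<lbrakk>X \<in> Obj C; Y \<in> Obj C\<rbrakk> \<Longrightarrow> X \<odot> Y \<in> Obj C"
    and OTens_assoc: "\<lbrakk>X \<in> Obj C; Y \<in> Obj C; Z \<in> Obj C\<rbrakk> \<Longrightarrow> (X \<odot> Y) \<odot> Z = X \<odot> (Y \<odot> Z)"
    and Unit_OTens: "X \<in> Obj C \<Longrightarrow> \<one> \<odot> X = X"
    and OTens_Unit: "X \<in> Obj C \<Longrightarrow> X \<odot> \<one> = X"
    and Tens_in_Hom: "\<lbrakk>X \<in> Obj C; Y \<in> Obj C; X' \<in> Obj C; Y' \<in> Obj C; f \<in> Hom C X Y; g \<in> Hom C X' Y'\<rbrakk>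
      \<Longrightarrow> f \<otimes> g \<in> Hom C (X \<odot> X') (Y \<odot> Y')"
    and Tens_Id: "\<lbrakk>X \<in> Obj C; Y \<in> Obj C\<rbrakk> \<Longrightarrow> Id C X \<otimes> Id C Y = Id C (X \<odot> Y)"
    and interchange: "\<lbrakk>X \<in> Obj C; Y \<in> Obj C; Z \<in> Obj C; X' \<in> Obj C; Y' \<in> Obj C; Z' \<in> Obj C;
        f \<in> Hom C X Y; g \<in> Hom C Y Z; f' \<in> Hom C X' Y'; g' \<in> Hom C Y' Z'\<rbrakk>
      \<Longrightarrow> (g \<cdot> f) \<otimes> (g' \<cdot> f') = (g \<otimes> g') \<cdot> (f \<otimes> f')"
    and Tens_assoc: "\<lbrakk>X \<in> Obj C; Y \<in> Obj C; X' \<in> Obj C; Y' \<in> Obj C; X'' \<in> Obj C; Y'' \<in> Obj C;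
        f \<in> Hom C X Y; g \<in> Hom C X' Y'; h \<in> Hom C X'' Y''\<rbrakk>
      \<Longrightarrow> (f \<otimes> g) \<otimes> h = f \<otimes> (g \<otimes> h)"
    and Unit_Tens: "\<lbrakk>X \<in> Obj C; Y \<in> Obj C; f \<in> Hom C X Y\<rbrakk> \<Longrightarrow> Id C \<one> \<otimes> f = f"
    and Tens_Unit: "\<lbrakk>X \<in> Obj C; Y \<in> Obj C; f \<in> Hom C X Y\<rbrakk> \<Longrightarrow> f \<otimes> Id C \<one> = f"
    and Tens_Add_left: "\<lbrakk>X \<in> Obj C; Y \<in> Obj C; X' \<in> Obj C; Y' \<in> Obj C;
        f \<in> Hom C X Y; g \<in> Hom C X Y; h \<in> Hom C X' Y'\<rbrakk> \<Longrightarrow> (f \<oplus> g) \<otimes> h = (f \<otimes> h) \<oplus> (g \<otimes> h)"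
    and Tens_Add_right: "\<lbrakk>X \<in> Obj C; Y \<in> Obj C; X' \<in> Obj C; Y' \<in> Obj C;
        f \<in> Hom C X Y; g \<in> Hom C X' Y'; h \<in> Hom C X' Y'\<rbrakk> \<Longrightarrow> f \<otimes> (g \<oplus> h) = (f \<otimes> g) \<oplus> (f \<otimes> h)"
    and Tens_Scale_left: "\<lbrakk>X \<in> Obj C; Y \<in> Obj C; X' \<in> Obj C; Y' \<in> Obj C;
        f \<in> Hom C X Y; g \<in> Hom C X' Y'\<rbrakk> \<Longrightarrow> (a \<star> f) \<otimes> g = a \<star> (f \<otimes> g)"
    and Tens_Scale_right: "\<lbrakk>X \<in> Obj C; Y \<in> Obj C; X' \<in> Obj C; Y' \<in> Obj C;
        f \<in> Hom C X Y; g \<in> Hom C X' Y'\<rbrakk> \<Longrightarrow> f \<otimes> (a \<star> g) = a \<star> (f \<otimes> g)"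

locale linear_strict_ribbon_category = linear_strict_monoidal_category +
  assumes Braid_iso: "\<lbrakk>X \<in> Obj C; Y \<in> Obj C\<rbrakk> \<Longrightarrow> is_iso C (X \<odot> Y) (Y \<odot> X) (Braid C X Y)"
    and Braid_natural: "\<lbrakk>X \<in> Obj C; Y \<in> Obj C; X' \<in> Obj C; Y' \<in> Obj C;
        f \<in> Hom C X X'; g \<in> Hom C Y Y'\<rbrakk>
      \<Longrightarrow> Braid C X' Y' \<cdot> (f \<otimes> g) = (g \<otimes> f) \<cdot> Braid C X Y"
    and hexagon_left: "\<lbrakk>X \<in> Obj C; Y \<in> Obj C; Z \<in> Obj C\<rbrakk>
      \<Longrightarrow> Braid C (X \<odot> Y) Z = (Braid C X Z \<otimes> Id C Y) \<cdot> (Id C X \<otimes> Braid C Y Z)"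
    and hexagon_right: "\<lbrakk>X \<in> Obj C; Y \<in> Obj C; Z \<in> Obj C\<rbrakk>
      \<Longrightarrow> Braid C X (Y \<odot> Z) = (Id C Y \<otimes> Braid C X Z) \<cdot> (Braid C X Y \<otimes> Id C Z)"
    and Dual_in_Obj: "X \<in> Obj C \<Longrightarrow> Dual C X \<in> Obj C"
    and Ev_in_Hom: "X \<in> Obj C \<Longrightarrow> Ev C X \<in> Hom C (Dual C X \<odot> X) \<one>"
    and Coev_in_Hom: "X \<in> Obj C \<Longrightarrow> Coev C X \<in> Hom C \<one> (X \<odot> Dual C X)"
    and zigzag: "X \<in> Obj C \<Longrightarrow> (Id C X \<otimes> Ev C X) \<cdot> (Coev C X \<otimes> Id C X) = Id C X"
    and zigzag_Dual: "X \<in> Obj C \<Longrightarrow>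
      (Ev C X \<otimes> Id C (Dual C X)) \<cdot> (Id C (Dual C X) \<otimes> Coev C X) = Id C (Dual C X)"
    and Twist_iso: "X \<in> Obj C \<Longrightarrow> is_iso C X X (Twist C X)"
    and Twist_natural: "\<lbrakk>X \<in> Obj C; Y \<in> Obj C; f \<in> Hom C X Y\<rbrakk>
      \<Longrightarrow> Twist C Y \<cdot> f = f \<cdot> Twist C X"
    and balancing: "\<lbrakk>X \<in> Obj C; Y \<in> Obj C\<rbrakk>
      \<Longrightarrow> Twist C (X \<odot> Y) = Braid C Y X \<cdot> Braid C X Y \<cdot> (Twist C X \<otimes> Twist C Y)"
    and Twist_Dual: "X \<in> Obj C \<Longrightarrow>
      (Twist C X \<otimes> Id C (Dual C X)) \<cdot> Coev C X = (Id C X \<otimes> Twist C (Dual C X)) \<cdot> Coev C X"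

text \<open>The evaluation on the other side, \<open>X \<odot> X\<^sup>* \<rightarrow> \<one>\<close>, and the partial trace over the right-hand
  tensor factor \<open>S\<close> of a morphism \<open>X \<odot> S \<rightarrow> Y \<odot> S\<close>.\<close>

definition Ev' :: "('o, 'm, 'k) ribbon_data \<Rightarrow> 'o \<Rightarrow> 'm" where
  "Ev' C X = Ev C X \<cdot>\<^bsub>C\<^esub> Braid C X (Dual C X) \<cdot>\<^bsub>C\<^esub> (Twist C X \<otimes>\<^bsub>C\<^esub> Id C (Dual C X))"

definition partial_trace :: "('o, 'm, 'k) ribbon_data \<Rightarrow> 'o \<Rightarrow> 'o \<Rightarrow> 'o \<Rightarrow> 'm \<Rightarrow> 'm" where
  "partial_trace C X Y S f =
     (Id C Y \<otimes>\<^bsub>C\<^esub> Ev' C S) \<cdot>\<^bsub>C\<^esub> (f \<otimes>\<^bsub>C\<^esub> Id C (Dual C S)) \<cdot>\<^bsub>C\<^esub> (Id C X \<otimes>\<^bsub>C\<^esub> Coev C S)"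

text \<open>A strict ribbon functor, linear along the field embedding \<open>\<iota>\<close>. It preserves duals
  automatically (up to the canonical isomorphisms), so equality of the chosen dual objects is
  not imposed.\<close>

locale field_embedding =
  fixes \<iota> :: "'k :: field \<Rightarrow> 'l :: field"
  assumes embed_one: "\<iota> 1 = 1"
    and embed_add: "\<iota> (x + y) = \<iota> x + \<iota> y"
    and embed_mult: "\<iota> (x * y) = \<iota> x * \<iota> y"

locale linear_ribbon_functor = field_embedding \<iota>
  for \<iota> :: "'k :: field \<Rightarrow> 'l :: field" +
  fixes D :: "('p, 'n, 'k) ribbon_data"
    and C :: "('o, 'm, 'l) ribbon_data"
    and Fo :: "'p \<Rightarrow> 'o"
    and Fm :: "'n \<Rightarrow> 'm"
  assumes Fo_in_Obj: "X \<in> Obj D \<Longrightarrow> Fo X \<in> Obj C"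
    and Fm_in_Hom: "\<lbrakk>X \<in> Obj D; Y \<in> Obj D; f \<in> Hom D X Y\<rbrakk> \<Longrightarrow> Fm f \<in> Hom C (Fo X) (Fo Y)"
    and Fm_Id: "X \<in> Obj D \<Longrightarrow> Fm (Id D X) = Id C (Fo X)"
    and Fm_Comp: "\<lbrakk>X \<in> Obj D; Y \<in> Obj D; Z \<in> Obj D; f \<in> Hom D X Y; g \<in> Hom D Y Z\<rbrakk>
      \<Longrightarrow> Fm (g \<cdot>\<^bsub>D\<^esub> f) = Fm g \<cdot>\<^bsub>C\<^esub> Fm f"
    and Fm_Add: "\<lbrakk>X \<in> Obj D; Y \<in> Obj D; f \<in> Hom D X Y; g \<in> Hom D X Y\<rbrakk>
      \<Longrightarrow> Fm (f \<oplus>\<^bsub>D\<^esub> g) = Fm f \<oplus>\<^bsub>C\<^esub> Fm g"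
    and Fm_Scale: "\<lbrakk>X \<in> Obj D; Y \<in> Obj D; f \<in> Hom D X Y\<rbrakk>
      \<Longrightarrow> Fm (a \<star>\<^bsub>D\<^esub> f) = \<iota> a \<star>\<^bsub>C\<^esub> Fm f"
    and Fo_Unit: "Fo \<one>\<^bsub>D\<^esub> = \<one>\<^bsub>C\<^esub>"
    and Fo_OTens: "\<lbrakk>X \<in> Obj D; Y \<in> Obj D\<rbrakk> \<Longrightarrow> Fo (X \<odot>\<^bsub>D\<^esub> Y) = Fo X \<odot>\<^bsub>C\<^esub> Fo Y"
    and Fm_Tens: "\<lbrakk>X \<in> Obj D; Y \<in> Obj D; X' \<in> Obj D; Y' \<in> Obj D; f \<in> Hom D X Y; g \<in> Hom D X' Y'\<rbrakk>
      \<Longrightarrow> Fm (f \<otimes>\<^bsub>D\<^esub> g) = Fm f \<otimes>\<^bsub>C\<^esub> Fm g"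
    and Fm_Braid: "\<lbrakk>X \<in> Obj D; Y \<in> Obj D\<rbrakk> \<Longrightarrow> Fm (Braid D X Y) = Braid C (Fo X) (Fo Y)"
    and Fm_Twist: "X \<in> Obj D \<Longrightarrow> Fm (Twist D X) = Twist C (Fo X)"


section \<open>The category of unoriented framed tangles modulo skein relations\<close>

text \<open>Formal linear combinations of tangle diagrams with blackboard framing. Composition is
  \<open>TComp g f\<close> (\<open>g\<close> after \<open>f\<close>), and \<open>tangle p q\<close> are the expressions with \<open>p\<close> inputs and \<open>q\<close>
  outputs.\<close>

datatype tangle_expr =
    TId nat
  | TCap
  | TCup
  | TCross
  | TCrossInv
  | TComp tangle_expr tangle_expr
  | TTens tangle_expr tangle_expr
  | TZero nat nat
  | TAdd tangle_expr tangle_expr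
  | TScale scalar tangle_expr

inductive tangle :: "nat \<Rightarrow> nat \<Rightarrow> tangle_expr \<Rightarrow> bool" where
  "tangle p p (TId p)"
| "tangle 2 0 TCap"
| "tangle 0 2 TCup"
| "tangle 2 2 TCross"
| "tangle 2 2 TCrossInv"
| "\<lbrakk>tangle q r g; tangle p q f\<rbrakk> \<Longrightarrow> tangle p r (TComp g f)"
| "\<lbrakk>tangle p q f; tangle p' q' g\<rbrakk> \<Longrightarrow> tangle (p + p') (q + q') (TTens f g)"
| "tangle p q (TZero p q)"
| "\<lbrakk>tangle p q f; tangle p q g\<rbrakk> \<Longrightarrow> tangle p q (TAdd f g)"
| "tangle p q f \<Longrightarrow> tangle p q (TScale a f)"

text \<open>Typing hypotheses are only imposed on rules that could otherwise relate a well-typed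
  expression to an ill-typed one or to one of a different type.

  The isotopy rules are the usual presentation of unoriented framed tangles: planar isotopy
  (the interchange law and the zigzag rules), the second and third Reidemeister moves, sliding a
  strand past a cap or cup, and the framed first Reidemeister move, by which the two kinks with the
  same writhe and opposite rotation number agree.\<close>

inductive tangle_eq :: "tangle_expr \<Rightarrow> tangle_expr \<Rightarrow> bool" (infix "\<approx>" 50) where
  \<comment> \<open>congruence\<close>
  refl: "f \<approx> f"
| sym: "f \<approx> g \<Longrightarrow> g \<approx> f"
| trans: "f \<approx> g \<Longrightarrow> g \<approx> h \<Longrightarrow> f \<approx> h"
| cong_comp: "f \<approx> f' \<Longrightarrow> g \<approx> g' \<Longrightarrow> TComp g f \<approx> TComp g' f'"
| cong_tens: "f \<approx> f' \<Longrightarrow> g \<approx> g' \<Longrightarrow> TTens f g \<approx> TTens f' g'"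
| cong_add: "f \<approx> f' \<Longrightarrow> g \<approx> g' \<Longrightarrow> TAdd f g \<approx> TAdd f' g'"
| cong_scale: "f \<approx> f' \<Longrightarrow> TScale a f \<approx> TScale a f'"
  \<comment> \<open>vector space structure on the hom-sets\<close>
| add_assoc: "TAdd (TAdd f g) h \<approx> TAdd f (TAdd g h)"
| add_commute: "TAdd f g \<approx> TAdd g f"
| add_zero: "tangle p q f \<Longrightarrow> TAdd f (TZero p q) \<approx> f"
| add_inverse: "tangle p q f \<Longrightarrow> TAdd f (TScale (-1) f) \<approx> TZero p q"
| scale_add: "TScale a (TAdd f g) \<approx> TAdd (TScale a f) (TScale a g)"
| add_scale: "TScale (a + b) f \<approx> TAdd (TScale a f) (TScale b f)"
| scale_scale: "TScale a (TScale b f) \<approx> TScale (a * b) f"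
| one_scale: "TScale 1 f \<approx> f"
  \<comment> \<open>strict monoidal category with bilinear composition and tensor product\<close>
| comp_id: "tangle p q f \<Longrightarrow> TComp f (TId p) \<approx> f"
| id_comp: "tangle p q f \<Longrightarrow> TComp (TId q) f \<approx> f"
| comp_assoc: "TComp (TComp h g) f \<approx> TComp h (TComp g f)"
| comp_add_left: "TComp (TAdd g h) f \<approx> TAdd (TComp g f) (TComp h f)"
| comp_add_right: "TComp h (TAdd f g) \<approx> TAdd (TComp h f) (TComp h g)"
| comp_scale_left: "TComp (TScale a g) f \<approx> TScale a (TComp g f)"
| comp_scale_right: "TComp g (TScale a f) \<approx> TScale a (TComp g f)"
| tens_id: "TTens (TId p) (TId q) \<approx> TId (p + q)"
| tens_assoc: "TTens (TTens f g) h \<approx> TTens f (TTens g h)"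
| tens_unit: "TTens f (TId 0) \<approx> f"
| unit_tens: "TTens (TId 0) f \<approx> f"
| interchange: "\<lbrakk>tangle p q f; tangle q r g; tangle p' q' f'; tangle q' r' g'\<rbrakk>
    \<Longrightarrow> TTens (TComp g f) (TComp g' f') \<approx> TComp (TTens g g') (TTens f f')"
| tens_add_left: "TTens (TAdd f g) h \<approx> TAdd (TTens f h) (TTens g h)"
| tens_add_right: "TTens h (TAdd f g) \<approx> TAdd (TTens h f) (TTens h g)"
| tens_scale_left: "TTens (TScale a f) g \<approx> TScale a (TTens f g)"
| tens_scale_right: "TTens f (TScale a g) \<approx> TScale a (TTens f g)"
  \<comment> \<open>isotopy of framed tangles\<close>
| zigzag_left: "TComp (TTens TCap (TId 1)) (TTens (TId 1) TCup) \<approx> TId 1"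
| zigzag_right: "TComp (TTens (TId 1) TCap) (TTens TCup (TId 1)) \<approx> TId 1"
| reidemeister_1: "TComp (TTens (TId 1) TCap) (TComp (TTens TCross (TId 1)) (TTens (TId 1) TCup))
    \<approx> TComp (TTens TCap (TId 1)) (TComp (TTens (TId 1) TCross) (TTens TCup (TId 1)))"
| reidemeister_2: "TComp TCross TCrossInv \<approx> TId 2"
| reidemeister_2': "TComp TCrossInv TCross \<approx> TId 2"
| reidemeister_3:
    "TComp (TTens TCross (TId 1)) (TComp (TTens (TId 1) TCross) (TTens TCross (TId 1)))
    \<approx> TComp (TTens (TId 1) TCross) (TComp (TTens TCross (TId 1)) (TTens (TId 1) TCross))"
| cap_slide: "TComp (TTens TCap (TId 1)) (TTens (TId 1) TCross)
    \<approx> TComp (TTens (TId 1) TCap) (TTens TCrossInv (TId 1))"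
| cap_slide': "TComp (TTens TCap (TId 1)) (TTens (TId 1) TCrossInv)
    \<approx> TComp (TTens (TId 1) TCap) (TTens TCross (TId 1))"
| cup_slide: "TComp (TTens (TId 1) TCross) (TTens TCup (TId 1))
    \<approx> TComp (TTens TCrossInv (TId 1)) (TTens (TId 1) TCup)"
| cup_slide': "TComp (TTens (TId 1) TCrossInv) (TTens TCup (TId 1))
    \<approx> TComp (TTens TCross (TId 1)) (TTens (TId 1) TCup)"
  \<comment> \<open>skein relations\<close>
| skein_loop: "TComp TCap TCup \<approx> TScale ((\<z> * inverse \<q> + inverse \<z> * \<q>) * \<delta>) (TId 0)"
| skein_kink: "TComp TCross (TComp TCup TCap) \<approx> TScale (\<z> powi (-2) * \<q>) (TComp TCup TCap)"
| skein_kink': "TComp TCrossInv (TComp TCup TCap) \<approx> TScale (\<z>\<^sup>2 * inverse \<q>) (TComp TCup TCap)"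
| skein_cross: "TAdd TCross (TScale (-1) TCrossInv)
    \<approx> TScale (\<q> - inverse \<q>) (TAdd (TId 2) (TScale (-1) (TComp TCup TCap)))"

quotient_type mor = tangle_expr / tangle_eq
  by (intro equivpI reflpI sympI transpI)
    (blast intro: tangle_eq.refl tangle_eq.sym tangle_eq.trans)+

lift_definition m_id :: "nat \<Rightarrow> mor" is TId .
lift_definition m_cap :: mor is TCap .
lift_definition m_cup :: mor is TCup .
lift_definition m_cross :: mor is TCross .
lift_definition m_cross_inv :: mor is TCrossInv .
lift_definition m_zero :: "nat \<Rightarrow> nat \<Rightarrow> mor" is TZero .
lift_definition m_comp :: "mor \<Rightarrow> mor \<Rightarrow> mor" (infixr "\<circ>\<^sub>B" 60) is TComp by (rule cong_comp)
lift_definition m_tens :: "mor \<Rightarrow> mor \<Rightarrow> mor" (infixr "\<otimes>\<^sub>B" 70) is TTens by (rule cong_tens)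
lift_definition m_add :: "mor \<Rightarrow> mor \<Rightarrow> mor" (infixl "+\<^sub>B" 55) is TAdd by (rule cong_add)
lift_definition m_scale :: "scalar \<Rightarrow> mor \<Rightarrow> mor" (infixr "*\<^sub>B" 65) is TScale by (rule cong_scale)

definition m_hom :: "nat \<Rightarrow> nat \<Rightarrow> mor set" where
  "m_hom p q = abs_mor ` {f. tangle p q f}"

primrec nested_cap :: "nat \<Rightarrow> mor" where
  "nested_cap 0 = m_id 0"
| "nested_cap (Suc a) = m_cap \<circ>\<^sub>B (m_id 1 \<otimes>\<^sub>B nested_cap a \<otimes>\<^sub>B m_id 1)"

primrec nested_cup :: "nat \<Rightarrow> mor" where
  "nested_cup 0 = m_id 0"
| "nested_cup (Suc a) = (m_id 1 \<otimes>\<^sub>B nested_cup a \<otimes>\<^sub>B m_id 1) \<circ>\<^sub>B m_cup"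

primrec braid_one :: "nat \<Rightarrow> mor" where
  "braid_one 0 = m_id 1"
| "braid_one (Suc b) = (m_id b \<otimes>\<^sub>B m_cross) \<circ>\<^sub>B (braid_one b \<otimes>\<^sub>B m_id 1)"

primrec braid :: "nat \<Rightarrow> nat \<Rightarrow> mor" where
  "braid 0 b = m_id b"
| "braid (Suc a) b = (braid_one b \<otimes>\<^sub>B m_id a) \<circ>\<^sub>B (m_id 1 \<otimes>\<^sub>B braid a b)"

text \<open>The object \<open>p\<close> stands for $V^{\otimes p}$; tangles being unoriented, it is its own dual. The twist
  is a full positive twist of the ribbon of \<open>p\<close> strands, obtained as the trace of the self-braiding.\<close>

definition B :: "(nat, mor, scalar) ribbon_data" where
  "B = \<lparr>Obj = UNIV, Hom = m_hom, Id = m_id, Comp = m_comp, Zero = m_zero, Add = m_add,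
        Scale = m_scale, Unit = 0, OTens = (+), Tens = m_tens, Braid = braid,
        Twist = (\<lambda>p. (m_id p \<otimes>\<^sub>B nested_cap p) \<circ>\<^sub>B (braid p p \<otimes>\<^sub>B m_id p) \<circ>\<^sub>B (m_id p \<otimes>\<^sub>B nested_cup p)),
        Dual = (\<lambda>p. p), Ev = nested_cap, Coev = nested_cup\<rparr>"

text \<open>\<open>strand_op m i f\<close> is the endomorphism \<open>f\<close> of two strands acting on strands \<open>i\<close>, \<open>i + 1\<close> out of
  \<open>m\<close> (counted from 1); \<open>S_op m i x\<close> is $S_i(x)$ on \<open>m\<close> strands.\<close>

definition strand_op :: "nat \<Rightarrow> nat \<Rightarrow> mor \<Rightarrow> mor" where
  "strand_op m i f = m_id (i - 1) \<otimes>\<^sub>B f \<otimes>\<^sub>B m_id (m - i - 1)"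

definition S_op :: "nat \<Rightarrow> nat \<Rightarrow> scalar \<Rightarrow> mor" where
  "S_op m i x =
     inverse ((x * inverse \<z> + inverse x * \<z>) * (x * \<q> - inverse x * inverse \<q>)) *\<^sub>B
       ((inverse x - x) *\<^sub>B
          ((inverse x * \<z>) *\<^sub>B strand_op m i m_cross +\<^sub>B (x * inverse \<z>) *\<^sub>B strand_op m i m_cross_inv)
        +\<^sub>B ((\<z> + inverse \<z>) * (\<q> - inverse \<q>)) *\<^sub>B m_id m)"

fun E :: "nat \<Rightarrow> mor" where
  "E 0 = m_id 0"
| "E (Suc 0) = m_id 1"
| "E (Suc (Suc k)) = (let p = Suc k in
     (E p \<otimes>\<^sub>B m_id 1) \<circ>\<^sub>B S_op (p + 1) p (\<q> ^ p) \<circ>\<^sub>B (E p \<otimes>\<^sub>B m_id 1))"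


section \<open>Spinor theories and q-Fierz coefficients\<close>

text \<open>\<open>spin_gamma C V S \<gamma> p\<close> is $\gamma_p$ and \<open>spin_tau C V S \<gamma> p\<close> is $\tau_p$.\<close>

primrec opower :: "('o, 'm, 'k) ribbon_data \<Rightarrow> 'o \<Rightarrow> nat \<Rightarrow> 'o" where
  "opower C V 0 = \<one>\<^bsub>C\<^esub>"
| "opower C V (Suc p) = V \<odot>\<^bsub>C\<^esub> opower C V p"

primrec spin_gamma :: "('o, 'm, 'k) ribbon_data \<Rightarrow> 'o \<Rightarrow> 'o \<Rightarrow> 'm \<Rightarrow> nat \<Rightarrow> 'm" where
  "spin_gamma C V S \<gamma> 0 = Id C S"
| "spin_gamma C V S \<gamma> (Suc p) = \<gamma> \<cdot>\<^bsub>C\<^esub> (Id C V \<otimes>\<^bsub>C\<^esub> spin_gamma C V S \<gamma> p)"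

definition spin_tau :: "('o, 'm, 'k) ribbon_data \<Rightarrow> 'o \<Rightarrow> 'o \<Rightarrow> 'm \<Rightarrow> nat \<Rightarrow> 'm" where
  "spin_tau C V S \<gamma> p = partial_trace C (opower C V p) \<one>\<^bsub>C\<^esub> S (spin_gamma C V S \<gamma> p)"

locale spinor_theory =
  linear_strict_ribbon_category C + linear_ribbon_functor \<iota> B C Fo Fm
  for C :: "('o, 'm, 'l :: field) ribbon_data" (structure)
    and \<iota> :: "scalar \<Rightarrow> 'l"
    and Fo :: "nat \<Rightarrow> 'o"
    and Fm :: "mor \<Rightarrow> 'm" +
  fixes \<Delta> :: 'l and S :: 'o and \<gamma> :: 'm
  assumes End_Unit: "bij_betw (\<lambda>x. x \<star> Id C \<one>) UNIV (Hom C \<one> \<one>)"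
    and \<Delta>_nonzero: "\<Delta> \<noteq> 0"
    and S_in_Obj: "S \<in> Obj C"
    and \<gamma>_in_Hom: "\<gamma> \<in> Hom C (Fo 1 \<odot> S) S"
    and tau_0: "spin_tau C (Fo 1) S \<gamma> 0 = \<Delta> \<star> Id C \<one>"
    and tau_1: "spin_tau C (Fo 1) S \<gamma> 1 = Zero C (Fo 1) \<one>"
    and tau_2: "spin_tau C (Fo 1) S \<gamma> 2 = (\<Delta> / \<iota> (qbrace 1)) \<star> Fm m_cap"
    and gamma_coev: "spin_gamma C (Fo 1) S \<gamma> 2 \<cdot> (Fm m_cup \<otimes> Id C S) = \<iota> \<delta> \<star> Id C S"
    and clifford: "spin_gamma C (Fo 1) S \<gamma> 2 \<cdot> (Fm (inverse \<q> *\<^sub>B m_id 2 +\<^sub>B m_cross) \<otimes> Id C S)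
      = \<iota> (inverse \<z>) \<star> (Fm m_cap \<otimes> Id C S)"
    and clifford': "spin_gamma C (Fo 1) S \<gamma> 2 \<cdot> (Fm (\<q> *\<^sub>B m_id 2 +\<^sub>B m_cross_inv) \<otimes> Id C S)
      = \<iota> \<z> \<star> (Fm m_cap \<otimes> Id C S)"

text \<open>The coefficient is the unique \<open>x\<close> with \<open>\<Delta> x\<close> equal to the displayed element of $End(1) = L$.\<close>

definition fierz :: "('o, 'm, 'l :: field) ribbon_data \<Rightarrow> (nat \<Rightarrow> 'o) \<Rightarrow> (mor \<Rightarrow> 'm) \<Rightarrow> 'l \<Rightarrow> 'o \<Rightarrow> 'm
    \<Rightarrow> nat \<Rightarrow> nat \<Rightarrow> 'l" where
  "fierz C Fo Fm \<Delta> S \<gamma> a b = (THE x. (\<Delta> * x) \<star>\<^bsub>C\<^esub> Id C \<one>\<^bsub>C\<^esub> =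
     spin_tau C (Fo 1) S \<gamma> (2 * a + 2 * b) \<cdot>\<^bsub>C\<^esub>
       Fm ((E a \<otimes>\<^sub>B E b \<otimes>\<^sub>B E a \<otimes>\<^sub>B E b) \<circ>\<^sub>B (m_id a \<otimes>\<^sub>B braid a b \<otimes>\<^sub>B m_id b)
           \<circ>\<^sub>B (nested_cup a \<otimes>\<^sub>B nested_cup b)))"


section \<open>The coefficients in the closed formula\<close>

definition fierz_C :: "nat \<Rightarrow> nat \<Rightarrow> nat \<Rightarrow> scalar" where
  "fierz_C a b m =
     (\<Prod>k = a + b - 2 * m + 1 .. a + b - m. 1 / qbrace (int k))
     * (qfact a / (qfact m * qfact (a - m))) * (qfact b / (qfact m * qfact (b - m))) * qfact m"

definition fierz_X :: "nat \<Rightarrow> nat \<Rightarrow> nat \<Rightarrow> scalar" where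
  "fierz_X r s t =
     ((\<Prod>k<r. qbrace (int k)) * (\<Prod>k<s. qbrace (int k)) * (\<Prod>k<t. qbrace (int k)))
     / ((\<Prod>k<r + s. qbrace (int k)) * (\<Prod>k<r + t. qbrace (int k)) * (\<Prod>k<s + t. qbrace (int k)))"

end

theory Submission
  imports Defs
begin

text \<open>The Clifford relations move a crossing at the spin line into a scalar plus a cap, so the value
  of a spin loop with chords can be computed by removing chords one at a time. One chord around
  strands antisymmetrised by \<open>E(b)\<close> acts by the scalar $(-1)^b[n-b]$. Among \<open>a + 1\<close> parallel chords
  labelled by \<open>E(a + 1)\<close>, the definition of \<open>E(a + 1)\<close> through $S_a(q^a)$ splits off the innermost
  chord up to a term in which two neighbouring chords are capped off. Turning \<open>E(a)\<close> around to the other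
  end of the chords evaluates that term, and
  \[ F(a+1,b) = (-1)^b [n-b]\, F(a,b) - \frac{[a]\,[2n-a+1]}{\{a\}\{a-1\}}\, F(a-1,b), \qquad
     F(0,b) = \prod_{k<b} \frac{[2n-k]}{\{k\}}. \]
  The closed formula satisfies the same recursion by creative telescoping in \<open>m\<close>.\<close>

section \<open>Tangle calculus\<close>

text \<open>The splitting of a chord rests on \<open>E(p)\<close> being alternating, which its
  definition does not show: only the crossing of the last two strands is difficult, and there a
  three-strand computation takes the place of the Yang-Baxter equation. Once this is known,
  \<open>E(p)\<close> fixes every alternating morphism, and idempotence, left-right symmetry and the
  passage of \<open>E(a)\<close> around chords follow by absorption.

  That passage is needed because \<open>E(a)\<close> separates the cap from the chords it should
  join. With \<open>E(a)\<close> on the right legs, the cap merges the two innermost chords into a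
  cup, which meets \<open>E(a)\<close> at its first strand; hence the mirror images. The contraction
  of \<open>E(a)\<close> with a cup is not computed head-on. A crossing has eigenvalue z^-2 q on a
  cup and -q^-1 on \<open>E(a+1)\<close>, so \<open>E(a+1)\<close> applied to a cup has value zero,
  and the splitting formula reduces the contraction to the partial trace of \<open>E(a)\<close>. The
  splitting contributes -[a]/{a} and the contraction [2n-a+1]/{a-1}; their product is the last
  coefficient of the recursion.\<close>

lemma m_homE:
  assumes "f \<in> m_hom p q"
  obtains F where "f = abs_mor F" "tangle p q F"
  using assms by (auto simp: m_hom_def)

lemma m_homI: "tangle p q F \<Longrightarrow> abs_mor F \<in> m_hom p q"
  by (auto simp: m_hom_def)

lemma m_add_assoc: "(f +\<^sub>B g) +\<^sub>B h = f +\<^sub>B (g +\<^sub>B h)"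
  by transfer (rule tangle_eq.add_assoc)
lemma m_add_commute: "f +\<^sub>B g = g +\<^sub>B f"
  by transfer (rule tangle_eq.add_commute)
lemma m_add_left_commute: "f +\<^sub>B (g +\<^sub>B h) = g +\<^sub>B (f +\<^sub>B h)"
  by (metis m_add_assoc m_add_commute)
lemmas m_add_ac = m_add_assoc m_add_commute m_add_left_commute
lemma m_scale_add: "a *\<^sub>B (f +\<^sub>B g) = a *\<^sub>B f +\<^sub>B a *\<^sub>B g"
  by transfer (rule tangle_eq.scale_add)
lemma m_add_scale: "(a + b) *\<^sub>B f = a *\<^sub>B f +\<^sub>B b *\<^sub>B f"
  by transfer (rule tangle_eq.add_scale)
lemma m_scale_scale [simp]: "a *\<^sub>B b *\<^sub>B f = (a * b) *\<^sub>B f"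
  by transfer (rule tangle_eq.scale_scale)
lemma m_one_scale [simp]: "1 *\<^sub>B f = f"
  by transfer (rule tangle_eq.one_scale)
lemma m_comp_assoc: "(h \<circ>\<^sub>B g) \<circ>\<^sub>B f = h \<circ>\<^sub>B g \<circ>\<^sub>B f"
  by transfer (rule tangle_eq.comp_assoc)
lemma m_comp_add_left: "(g +\<^sub>B h) \<circ>\<^sub>B f = (g \<circ>\<^sub>B f) +\<^sub>B (h \<circ>\<^sub>B f)"
  by transfer (rule tangle_eq.comp_add_left)
lemma m_comp_add_right: "h \<circ>\<^sub>B (f +\<^sub>B g) = (h \<circ>\<^sub>B f) +\<^sub>B (h \<circ>\<^sub>B g)"
  by transfer (rule tangle_eq.comp_add_right)
lemma m_comp_scale_left: "(a *\<^sub>B g) \<circ>\<^sub>B f = a *\<^sub>B (g \<circ>\<^sub>B f)"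
  by transfer (rule tangle_eq.comp_scale_left)
lemma m_comp_scale_right: "g \<circ>\<^sub>B (a *\<^sub>B f) = a *\<^sub>B (g \<circ>\<^sub>B f)"
  by transfer (rule tangle_eq.comp_scale_right)
lemma m_tens_id: "m_id p \<otimes>\<^sub>B m_id q = m_id (p + q)"
  by transfer (rule tangle_eq.tens_id)
lemma m_tens_assoc: "(f \<otimes>\<^sub>B g) \<otimes>\<^sub>B h = f \<otimes>\<^sub>B g \<otimes>\<^sub>B h"
  by transfer (rule tangle_eq.tens_assoc)
lemma m_tens_unit [simp]: "f \<otimes>\<^sub>B m_id 0 = f"
  by transfer (rule tangle_eq.tens_unit)
lemma m_unit_tens [simp]: "m_id 0 \<otimes>\<^sub>B f = f"
  by transfer (rule tangle_eq.unit_tens)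
lemma m_tens_add_left: "(f +\<^sub>B g) \<otimes>\<^sub>B h = (f \<otimes>\<^sub>B h) +\<^sub>B (g \<otimes>\<^sub>B h)"
  by transfer (rule tangle_eq.tens_add_left)
lemma m_tens_add_right: "h \<otimes>\<^sub>B (f +\<^sub>B g) = (h \<otimes>\<^sub>B f) +\<^sub>B (h \<otimes>\<^sub>B g)"
  by transfer (rule tangle_eq.tens_add_right)
lemma m_tens_scale_left: "(a *\<^sub>B f) \<otimes>\<^sub>B g = a *\<^sub>B (f \<otimes>\<^sub>B g)"
  by transfer (rule tangle_eq.tens_scale_left)
lemma m_tens_scale_right: "f \<otimes>\<^sub>B (a *\<^sub>B g) = a *\<^sub>B (f \<otimes>\<^sub>B g)"
  by transfer (rule tangle_eq.tens_scale_right)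

lemma m_comp_id: "f \<in> m_hom p q \<Longrightarrow> f \<circ>\<^sub>B m_id p = f"
  by (elim m_homE) (simp add: m_id.abs_eq m_comp.abs_eq mor.abs_eq_iff tangle_eq.comp_id)
lemma m_id_comp: "f \<in> m_hom p q \<Longrightarrow> m_id q \<circ>\<^sub>B f = f"
  by (elim m_homE) (simp add: m_id.abs_eq m_comp.abs_eq mor.abs_eq_iff tangle_eq.id_comp)
lemma m_interchange:
  "\<lbrakk>f \<in> m_hom p q; g \<in> m_hom q r; f' \<in> m_hom p' q'; g' \<in> m_hom q' r'\<rbrakk>
    \<Longrightarrow> (g \<circ>\<^sub>B f) \<otimes>\<^sub>B (g' \<circ>\<^sub>B f') = (g \<otimes>\<^sub>B g') \<circ>\<^sub>B (f \<otimes>\<^sub>B f')"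
  by (elim m_homE)
    (simp add: m_tens.abs_eq m_comp.abs_eq mor.abs_eq_iff tangle_eq.interchange)
lemma m_add_zero: "f \<in> m_hom p q \<Longrightarrow> f +\<^sub>B m_zero p q = f"
  by (elim m_homE) (simp add: m_zero.abs_eq m_add.abs_eq mor.abs_eq_iff tangle_eq.add_zero)
lemma m_add_inverse: "f \<in> m_hom p q \<Longrightarrow> f +\<^sub>B (-1) *\<^sub>B f = m_zero p q"
  by (elim m_homE)
    (simp add: m_zero.abs_eq m_add.abs_eq m_scale.abs_eq mor.abs_eq_iff tangle_eq.add_inverse)

lemma m_zero_scale:
  assumes "f \<in> m_hom p q" shows "0 *\<^sub>B f = m_zero p q"
  using m_add_inverse[OF assms] m_add_scale[of 1 "-1" f] by simp

lemma hom_id: "p = q \<Longrightarrow> m_id p \<in> m_hom p q"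
  by (simp add: m_id.abs_eq m_homI tangle.intros)
lemma hom_cap: "m_cap \<in> m_hom 2 0"
  by (simp add: m_cap_def m_homI tangle.intros)
lemma hom_cup: "m_cup \<in> m_hom 0 2"
  by (simp add: m_cup_def m_homI tangle.intros)
lemma hom_cross: "m_cross \<in> m_hom 2 2"
  by (simp add: m_cross_def m_homI tangle.intros)
lemma hom_cross_inv: "m_cross_inv \<in> m_hom 2 2"
  by (simp add: m_cross_inv_def m_homI tangle.intros)
lemma hom_zero: "m_zero p q \<in> m_hom p q"
  by (simp add: m_zero.abs_eq m_homI tangle.intros)
lemma hom_comp: "\<lbrakk>g \<in> m_hom q r; f \<in> m_hom p q\<rbrakk> \<Longrightarrow> g \<circ>\<^sub>B f \<in> m_hom p r"
  by (elim m_homE) (simp add: m_comp.abs_eq m_homI tangle.intros)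
lemma hom_tens: "\<lbrakk>f \<in> m_hom p q; g \<in> m_hom p' q'; P = p + p'; Q = q + q'\<rbrakk>
    \<Longrightarrow> f \<otimes>\<^sub>B g \<in> m_hom P Q"
  by (elim m_homE) (simp add: m_tens.abs_eq m_homI tangle.intros)
lemma hom_add: "\<lbrakk>f \<in> m_hom p q; g \<in> m_hom p q\<rbrakk> \<Longrightarrow> f +\<^sub>B g \<in> m_hom p q"
  by (elim m_homE) (simp add: m_add.abs_eq m_homI tangle.intros)
lemma hom_scale: "f \<in> m_hom p q \<Longrightarrow> a *\<^sub>B f \<in> m_hom p q"
  by (elim m_homE) (simp add: m_scale.abs_eq m_homI tangle.intros)

text \<open>Recording the number of idle strands on either side makes nested placements add up
  (\<open>st_st\<close>), so that the interchange law becomes a commutation rule whose side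
  conditions are pure arithmetic.\<close>

definition st :: "nat \<Rightarrow> mor \<Rightarrow> nat \<Rightarrow> mor" where
  "st i f j = m_id i \<otimes>\<^sub>B f \<otimes>\<^sub>B m_id j"

lemma hom_st: "\<lbrakk>f \<in> m_hom p q; P = i + p + j; Q = i + q + j\<rbrakk> \<Longrightarrow> st i f j \<in> m_hom P Q"
  unfolding st_def by (rule hom_tens hom_id HOL.refl | assumption | simp)+

lemmas homs = hom_comp hom_st hom_cap hom_cup hom_cross hom_cross_inv hom_id hom_add hom_scale

lemma st_st [simp]: "st i (st i' f j') j = st (i + i') f (j' + j)"
  by (simp add: st_def m_tens_assoc m_tens_id flip: m_tens_assoc[of "m_id i"])
lemma st_0 [simp]: "st 0 f 0 = f"
  by (simp add: st_def)
lemma st_id [simp]: "st i (m_id p) j = m_id (i + p + j)"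
  by (simp add: st_def m_tens_id add.assoc)
lemma st_add: "st i (f +\<^sub>B g) j = st i f j +\<^sub>B st i g j"
  by (simp add: st_def m_tens_add_left m_tens_add_right)
lemma st_scale: "st i (a *\<^sub>B f) j = a *\<^sub>B st i f j"
  by (simp add: st_def m_tens_scale_left m_tens_scale_right)
lemma st_comp:
  assumes "f \<in> m_hom p q" "g \<in> m_hom q r"
  shows "st i (g \<circ>\<^sub>B f) j = st i g j \<circ>\<^sub>B st i f j"
proof -
  have i: "m_id k = m_id k \<circ>\<^sub>B m_id k" for k
    by (rule m_comp_id[symmetric, OF hom_id[OF HOL.refl]])
  have "m_id i \<otimes>\<^sub>B (g \<circ>\<^sub>B f) \<otimes>\<^sub>B m_id j = m_id i \<otimes>\<^sub>B ((g \<otimes>\<^sub>B m_id j) \<circ>\<^sub>B (f \<otimes>\<^sub>B m_id j))"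
    by (metis i m_interchange assms hom_id)
  also have "\<dots> = (m_id i \<otimes>\<^sub>B g \<otimes>\<^sub>B m_id j) \<circ>\<^sub>B (m_id i \<otimes>\<^sub>B f \<otimes>\<^sub>B m_id j)"
    by (subst i) (rule m_interchange; (rule hom_id hom_tens assms HOL.refl)+)
  finally show ?thesis by (simp add: st_def)
qed
lemma tens_eq_st:
  assumes "f \<in> m_hom p q" "g \<in> m_hom p' q'"
  shows "f \<otimes>\<^sub>B g = st 0 f q' \<circ>\<^sub>B st p g 0" "f \<otimes>\<^sub>B g = st q g 0 \<circ>\<^sub>B st 0 f p'"
proof -
  have "f \<otimes>\<^sub>B g = (f \<circ>\<^sub>B m_id p) \<otimes>\<^sub>B (m_id q' \<circ>\<^sub>B g)"
    using assms by (simp add: m_comp_id m_id_comp)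
  also have "\<dots> = (f \<otimes>\<^sub>B m_id q') \<circ>\<^sub>B (m_id p \<otimes>\<^sub>B g)"
    by (rule m_interchange; (rule hom_id assms HOL.refl)+)
  finally show "f \<otimes>\<^sub>B g = st 0 f q' \<circ>\<^sub>B st p g 0" by (simp add: st_def)
  have "f \<otimes>\<^sub>B g = (m_id q \<circ>\<^sub>B f) \<otimes>\<^sub>B (g \<circ>\<^sub>B m_id p')"
    using assms by (simp add: m_comp_id m_id_comp)
  also have "\<dots> = (m_id q \<otimes>\<^sub>B g) \<circ>\<^sub>B (f \<otimes>\<^sub>B m_id p')"
    by (rule m_interchange; (rule hom_id assms HOL.refl)+)
  finally show "f \<otimes>\<^sub>B g = st q g 0 \<circ>\<^sub>B st 0 f p'" by (simp add: st_def)
qed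

lemma st_commute_tens:
  assumes "f \<in> m_hom p p'" "g \<in> m_hom q q'"
  shows "st i (f \<otimes>\<^sub>B m_id k \<otimes>\<^sub>B g) j = st (i + p' + k) g j \<circ>\<^sub>B st i f (k + q + j)"
    and "st i (f \<otimes>\<^sub>B m_id k \<otimes>\<^sub>B g) j = st i f (k + q' + j) \<circ>\<^sub>B st (i + p + k) g j"
proof -
  have g: "m_id k \<otimes>\<^sub>B g = st k g 0" by (simp add: st_def)
  have hg: "st k g 0 \<in> m_hom (k + q) (k + q')" by (rule hom_st assms)+ simp_all
  note t = tens_eq_st[OF assms(1) hg]
  show "st i (f \<otimes>\<^sub>B m_id k \<otimes>\<^sub>B g) j = st (i + p' + k) g j \<circ>\<^sub>B st i f (k + q + j)"
    unfolding g t(2)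
    by (subst st_comp[of _ "p + (k + q)" "p' + (k + q)" _ "p' + (k + q')"])
       (rule hom_st hg assms | simp add: add.assoc)+
  show "st i (f \<otimes>\<^sub>B m_id k \<otimes>\<^sub>B g) j = st i f (k + q' + j) \<circ>\<^sub>B st (i + p + k) g j"
    unfolding g t(1)
    by (subst st_comp[of _ "p + (k + q)" "p + (k + q')" _ "p' + (k + q')"])
       (rule hom_st hg assms | simp add: add.assoc)+
qed

text \<open>The positions are given by equations, so that the rule applies up to arithmetic.\<close>

lemma st_commute:
  assumes "f \<in> m_hom p p'" "g \<in> m_hom q q'"
    and "i2 = i + p' + k" "i3 = i + p + k" "j2 = k + q + j" "j3 = k + q' + j"
  shows "st i2 g j \<circ>\<^sub>B st i f j2 = st i f j3 \<circ>\<^sub>B st i3 g j"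
  using st_commute_tens[OF assms(1,2), of i k j] assms(3-6) by metis

section \<open>Generators and relations on strands\<close>

lemma zigzag_left: "st 0 m_cap 1 \<circ>\<^sub>B st 1 m_cup 0 = m_id 1"
  unfolding st_def m_unit_tens m_tens_unit by transfer (rule tangle_eq.zigzag_left)
lemma zigzag_right: "st 1 m_cap 0 \<circ>\<^sub>B st 0 m_cup 1 = m_id 1"
  unfolding st_def m_unit_tens m_tens_unit by transfer (rule tangle_eq.zigzag_right)
lemma reidemeister_1: "st 1 m_cap 0 \<circ>\<^sub>B st 0 m_cross 1 \<circ>\<^sub>B st 1 m_cup 0 =
    st 0 m_cap 1 \<circ>\<^sub>B st 1 m_cross 0 \<circ>\<^sub>B st 0 m_cup 1"
  unfolding st_def m_unit_tens m_tens_unit by transfer (rule tangle_eq.reidemeister_1)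
lemma reidemeister_2: "m_cross \<circ>\<^sub>B m_cross_inv = m_id 2"
  by transfer (rule tangle_eq.reidemeister_2)
lemma reidemeister_2': "m_cross_inv \<circ>\<^sub>B m_cross = m_id 2"
  by transfer (rule tangle_eq.reidemeister_2')
lemma reidemeister_3: "st 0 m_cross 1 \<circ>\<^sub>B st 1 m_cross 0 \<circ>\<^sub>B st 0 m_cross 1 =
    st 1 m_cross 0 \<circ>\<^sub>B st 0 m_cross 1 \<circ>\<^sub>B st 1 m_cross 0"
  unfolding st_def m_unit_tens m_tens_unit by transfer (rule tangle_eq.reidemeister_3)
lemma cap_slide: "st 0 m_cap 1 \<circ>\<^sub>B st 1 m_cross 0 = st 1 m_cap 0 \<circ>\<^sub>B st 0 m_cross_inv 1"
  unfolding st_def m_unit_tens m_tens_unit by transfer (rule tangle_eq.cap_slide)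
lemma cap_slide': "st 0 m_cap 1 \<circ>\<^sub>B st 1 m_cross_inv 0 = st 1 m_cap 0 \<circ>\<^sub>B st 0 m_cross 1"
  unfolding st_def m_unit_tens m_tens_unit by transfer (rule tangle_eq.cap_slide')
lemma cup_slide: "st 1 m_cross 0 \<circ>\<^sub>B st 0 m_cup 1 = st 0 m_cross_inv 1 \<circ>\<^sub>B st 1 m_cup 0"
  unfolding st_def m_unit_tens m_tens_unit by transfer (rule tangle_eq.cup_slide)
lemma cup_slide': "st 1 m_cross_inv 0 \<circ>\<^sub>B st 0 m_cup 1 = st 0 m_cross 1 \<circ>\<^sub>B st 1 m_cup 0"
  unfolding st_def m_unit_tens m_tens_unit by transfer (rule tangle_eq.cup_slide')
lemma skein_loop: "m_cap \<circ>\<^sub>B m_cup = ((\<z> * inverse \<q> + inverse \<z> * \<q>) * \<delta>) *\<^sub>B m_id 0"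
  by transfer (rule tangle_eq.skein_loop)
lemma skein_kink: "m_cross \<circ>\<^sub>B m_cup \<circ>\<^sub>B m_cap = (\<z> powi (-2) * \<q>) *\<^sub>B (m_cup \<circ>\<^sub>B m_cap)"
  by transfer (rule tangle_eq.skein_kink)
lemma skein_kink': "m_cross_inv \<circ>\<^sub>B m_cup \<circ>\<^sub>B m_cap = (\<z>\<^sup>2 * inverse \<q>) *\<^sub>B (m_cup \<circ>\<^sub>B m_cap)"
  by transfer (rule tangle_eq.skein_kink')
lemma skein_cross: "m_cross +\<^sub>B (-1) *\<^sub>B m_cross_inv =
    (\<q> - inverse \<q>) *\<^sub>B (m_id 2 +\<^sub>B (-1) *\<^sub>B (m_cup \<circ>\<^sub>B m_cap))"
  by transfer (rule tangle_eq.skein_cross)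

text \<open>Strand counts are often the literal \<open>1\<close>, as in \<open>m_id 1\<close>; it has to survive simplification
  to match the rules below.\<close>

declare One_nat_def [simp del]

section \<open>Scalars\<close>

lemma qvar_power: "\<q> ^ k = Fract [:monom 1 k:] 1"
  by (induction k) (simp_all add: qvar_def One_fract_def monom_Suc one_pCons monom_0)

lemma zvar_power2: "\<z>\<^sup>2 = Fract [:0, 0, 1:] 1"
  by (simp add: zvar_def power2_eq_square)

lemma qvar_nonzero [simp]: "\<q> \<noteq> 0"
  by (simp add: qvar_def Zero_fract_def eq_fract)

lemma zvar_nonzero [simp]: "\<z> \<noteq> 0"
  by (simp add: zvar_def Zero_fract_def eq_fract)

lemma qvar_power_neq_1: "k > 0 \<Longrightarrow> \<q> ^ k \<noteq> 1"
proof
  assume k: "k > 0" and "\<q> ^ k = 1"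
  then have "monom (1::rat) k = 1"
    by (simp add: qvar_power One_fract_def eq_fract one_pCons)
  then have "degree (monom (1::rat) k) = 0" by simp
  with k show False by (simp add: degree_monom_eq)
qed

text \<open>Comparison of degrees in \<open>\<z>\<close>. The sign -1 serves to exclude {k} = 0 and
  a coincidence of eigenvalues of the crossing, the sign 1 to exclude \<delta> = 0.\<close>

lemma zvar_power2_neq: "\<q> ^ k * \<z>\<^sup>2 \<noteq> c * \<q> ^ l" if "c = 1 \<or> c = -1"
proof
  assume "\<q> ^ k * \<z>\<^sup>2 = c * \<q> ^ l"
  with that have "[:monom 1 k:] * [:0, 0, 1:] = [:monom (1::rat) l:] \<or>
      [:monom 1 k:] * [:0, 0, 1:] = - [:monom (1::rat) l:]"
    by (auto simp: qvar_power zvar_power2 eq_fract)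
  then show False by auto
qed

lemma qdiff_nonzero [simp]: "\<q> - inverse \<q> \<noteq> 0"
proof
  assume "\<q> - inverse \<q> = 0"
  then have "\<q> ^ 2 = 1" by (simp add: field_simps power2_eq_square)
  then show False using qvar_power_neq_1[of 2] by simp
qed

lemma qvar_neq_inverse [simp]: "\<q> \<noteq> inverse \<q>" "\<q> * \<q> \<noteq> 1"
  using qdiff_nonzero by (auto simp: field_simps simp del: qdiff_nonzero)

lemma qint_0_nonzero: assumes "k > 0" shows "qint 0 (int k) \<noteq> 0"
proof
  assume "qint 0 (int k) = 0"
  then have "\<q> ^ k = inverse (\<q> ^ k)"
    by (simp add: qint_def power_int_minus)
  then have "\<q> ^ (k + k) = 1" by (simp add: field_simps power_add)
  then show False using qvar_power_neq_1[of "k + k"] assms by simp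
qed

lemma qbrace_nonzero [simp]: "qbrace k \<noteq> 0"
proof
  assume z: "qbrace k = 0"
  define x where "x = \<q> powi k"
  have x: "x \<noteq> 0" by (simp add: x_def)
  have "\<z> * inverse x + inverse \<z> * x = 0"
    using z by (simp add: qbrace_def power_int_minus x_def)
  then have "\<z> * \<z> + x * x = 0" using x by (simp add: field_simps)
  then have 1: "\<z> ^ 2 = - (x ^ 2)" by (simp add: power2_eq_square eq_neg_iff_add_eq_0)
  show False
  proof (cases k rule: int_cases2)
    case (nonneg n)
    then have "x ^ 2 = \<q> ^ (2 * n)" by (simp add: x_def power_mult mult.commute)
    with 1 show False using zvar_power2_neq[of "-1" 0 "2 * n"] by simp
  next
    case (nonpos n)
    then have "x ^ 2 = inverse (\<q> ^ (2 * n))"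
      by (simp add: x_def power_int_minus power_mult mult.commute power_inverse)
    with 1 have "\<q> ^ (2 * n) * \<z>\<^sup>2 = -1" by simp
    then show False using zvar_power2_neq[of "-1" "2 * n" 0] by simp
  qed
qed

lemma loop_nonzero [simp]: "\<delta> \<noteq> 0"
proof
  assume "\<delta> = 0"
  then have "\<z>\<^sup>2 = 1" by (simp add: loop_def field_simps power2_eq_square)
  then show False using zvar_power2_neq[of 1 0 0] by simp
qed

section \<open>Kinks\<close>

abbreviation (input) kink :: scalar where "kink \<equiv> \<z> powi (-2) * \<q>"
abbreviation (input) kink' :: scalar where "kink' \<equiv> \<z>\<^sup>2 * inverse \<q>"
abbreviation (input) dimV :: scalar where "dimV \<equiv> (\<z> * inverse \<q> + inverse \<z> * \<q>) * \<delta>"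

lemma dimV_nonzero: "dimV \<noteq> 0"
proof -
  have "\<z> * inverse \<q> + inverse \<z> * \<q> = qbrace 1" by (simp add: qbrace_def power_int_minus)
  then show ?thesis by simp
qed

lemma scale_cancel: "\<lbrakk>a *\<^sub>B f = a *\<^sub>B g; a \<noteq> 0\<rbrakk> \<Longrightarrow> f = g"
  by (metis left_inverse m_one_scale m_scale_scale)

text \<open>The skein relations describe crossings on the hook \<open>m_cup\<close> after
  \<open>m_cap\<close>. A further cup closes a loop whose value \<open>dimV\<close> is invertible
  and can be cancelled.\<close>

lemma comp_cup_of_comp_cup_cap:
  assumes "f \<in> m_hom 2 2" "f \<circ>\<^sub>B m_cup \<circ>\<^sub>B m_cap = c *\<^sub>B (m_cup \<circ>\<^sub>B m_cap)"
  shows "f \<circ>\<^sub>B m_cup = c *\<^sub>B m_cup"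
proof (rule scale_cancel[OF _ dimV_nonzero])
  have cup: "m_cup \<circ>\<^sub>B m_id 0 = m_cup" by (rule m_comp_id[OF hom_cup])
  have "(f \<circ>\<^sub>B m_cup \<circ>\<^sub>B m_cap) \<circ>\<^sub>B m_cup = dimV *\<^sub>B (f \<circ>\<^sub>B m_cup)"
    by (simp add: m_comp_assoc skein_loop m_comp_scale_right cup)
  moreover have "(m_cup \<circ>\<^sub>B m_cap) \<circ>\<^sub>B m_cup = dimV *\<^sub>B m_cup"
    by (simp add: m_comp_assoc skein_loop m_comp_scale_right cup)
  ultimately show "dimV *\<^sub>B (f \<circ>\<^sub>B m_cup) = dimV *\<^sub>B c *\<^sub>B m_cup"
    using assms(2) by (simp add: m_comp_scale_left mult.commute)
qed

lemma cross_cup: "m_cross \<circ>\<^sub>B m_cup = kink *\<^sub>B m_cup"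
  by (rule comp_cup_of_comp_cup_cap[OF hom_cross skein_kink])
lemma cross_inv_cup: "m_cross_inv \<circ>\<^sub>B m_cup = kink' *\<^sub>B m_cup"
  by (rule comp_cup_of_comp_cup_cap[OF hom_cross_inv skein_kink'])

text \<open>Sliding the cap past the crossing inverts the crossing, so the curl made from
  \<open>m_cross\<close> has the value \<open>kink'\<close> of the inverse crossing on a cup. These
  are the partial traces of the two crossings.\<close>

lemma kink_right:
  shows "st 1 m_cap 0 \<circ>\<^sub>B st 0 m_cross 1 \<circ>\<^sub>B st 1 m_cup 0 = kink' *\<^sub>B m_id 1"
    and "st 1 m_cap 0 \<circ>\<^sub>B st 0 m_cross_inv 1 \<circ>\<^sub>B st 1 m_cup 0 = kink *\<^sub>B m_id 1"
proof -
  have "st 1 m_cap 0 \<circ>\<^sub>B st 0 m_cross 1 \<circ>\<^sub>B st 1 m_cup 0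
      = st 0 m_cap 1 \<circ>\<^sub>B st 1 m_cross_inv 0 \<circ>\<^sub>B st 1 m_cup 0"
    using cap_slide' by (simp flip: m_comp_assoc)
  then show "st 1 m_cap 0 \<circ>\<^sub>B st 0 m_cross 1 \<circ>\<^sub>B st 1 m_cup 0 = kink' *\<^sub>B m_id 1"
    by (simp add: st_comp[OF hom_cup hom_cross_inv, symmetric] cross_inv_cup st_scale
        m_comp_scale_right zigzag_left)
  have "st 1 m_cap 0 \<circ>\<^sub>B st 0 m_cross_inv 1 \<circ>\<^sub>B st 1 m_cup 0
      = st 0 m_cap 1 \<circ>\<^sub>B st 1 m_cross 0 \<circ>\<^sub>B st 1 m_cup 0"
    using cap_slide by (simp flip: m_comp_assoc)
  then show "st 1 m_cap 0 \<circ>\<^sub>B st 0 m_cross_inv 1 \<circ>\<^sub>B st 1 m_cup 0 = kink *\<^sub>B m_id 1"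
    by (simp add: st_comp[OF hom_cup hom_cross, symmetric] cross_cup st_scale
        m_comp_scale_right zigzag_left)
qed

lemma m_add_cancel:
  assumes "f +\<^sub>B g = f +\<^sub>B h" "f \<in> m_hom p q" "g \<in> m_hom p q" "h \<in> m_hom p q"
  shows "g = h"
proof -
  have "(-1) *\<^sub>B f +\<^sub>B (f +\<^sub>B x) = x" if "x \<in> m_hom p q" for x
  proof -
    have "(-1) *\<^sub>B f +\<^sub>B (f +\<^sub>B x) = x +\<^sub>B (f +\<^sub>B (-1) *\<^sub>B f)"
      by (simp only: m_add_ac)
    then show ?thesis
      by (simp only: m_add_inverse[OF assms(2)] m_add_zero[OF that])
  qed
  from this[OF assms(3)] this[OF assms(4)] show ?thesis unfolding assms(1) by simp
qed

text \<open>The axioms give the kink on the cup side only. By \<open>skein_cross\<close> the hook is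
  a combination of the identity and the two crossings, hence commutes with
  \<open>m_cross\<close>.\<close>

lemma cup_cap_cross: "(m_cup \<circ>\<^sub>B m_cap) \<circ>\<^sub>B m_cross = kink *\<^sub>B (m_cup \<circ>\<^sub>B m_cap)"
proof -
  let ?u = "m_cup \<circ>\<^sub>B m_cap"
  let ?c = "\<q> - inverse \<q>"
  have hu: "?u \<in> m_hom 2 2" by (rule homs)+
  have "?c *\<^sub>B (m_cross +\<^sub>B (-1) *\<^sub>B (m_cross \<circ>\<^sub>B ?u))
      = m_cross \<circ>\<^sub>B (?c *\<^sub>B (m_id 2 +\<^sub>B (-1) *\<^sub>B ?u))"
    by (simp add: m_comp_scale_right m_comp_add_right m_comp_id[OF hom_cross])
  also have "\<dots> = (?c *\<^sub>B (m_id 2 +\<^sub>B (-1) *\<^sub>B ?u)) \<circ>\<^sub>B m_cross"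
    by (simp add: skein_cross[symmetric] m_comp_scale_right m_comp_add_right m_comp_scale_left
        m_comp_add_left reidemeister_2 reidemeister_2')
  also have "\<dots> = ?c *\<^sub>B (m_cross +\<^sub>B (-1) *\<^sub>B (?u \<circ>\<^sub>B m_cross))"
    by (simp add: m_comp_scale_left m_comp_add_left m_id_comp[OF hom_cross])
  finally have "m_cross +\<^sub>B (-1) *\<^sub>B (m_cross \<circ>\<^sub>B ?u) = m_cross +\<^sub>B (-1) *\<^sub>B (?u \<circ>\<^sub>B m_cross)"
    by (rule scale_cancel) (rule qdiff_nonzero)
  then have "(-1) *\<^sub>B (m_cross \<circ>\<^sub>B ?u) = (-1) *\<^sub>B (?u \<circ>\<^sub>B m_cross)"
    by (rule m_add_cancel) (rule homs hu)+
  then have "m_cross \<circ>\<^sub>B ?u = ?u \<circ>\<^sub>B m_cross" by (rule scale_cancel) simp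
  then show ?thesis by (simp add: skein_kink)
qed

lemma cap_cross: "m_cap \<circ>\<^sub>B m_cross = kink *\<^sub>B m_cap"
proof (rule scale_cancel[OF _ dimV_nonzero])
  have "m_cap \<circ>\<^sub>B (m_cup \<circ>\<^sub>B m_cap) \<circ>\<^sub>B m_cross = m_cap \<circ>\<^sub>B (kink *\<^sub>B (m_cup \<circ>\<^sub>B m_cap))"
    by (simp add: cup_cap_cross)
  moreover have "m_id 0 \<circ>\<^sub>B m_cap = m_cap" by (rule m_id_comp[OF hom_cap])
  ultimately show "dimV *\<^sub>B (m_cap \<circ>\<^sub>B m_cross) = dimV *\<^sub>B kink *\<^sub>B m_cap"
    by (simp add: skein_loop m_comp_scale_left m_comp_scale_right m_comp_assoc mult.commute
        m_id_comp[OF hom_cap] m_id_comp[OF hom_comp[OF hom_cap hom_cross]] flip: m_comp_assoc[of m_cap m_cup])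
qed

lemma cap_cross_inv: "m_cap \<circ>\<^sub>B m_cross_inv = kink' *\<^sub>B m_cap"
proof (rule scale_cancel)
  have kk: "kink * kink' = 1" by (simp add: power_int_minus field_simps)
  have "m_cap = (m_cap \<circ>\<^sub>B m_cross) \<circ>\<^sub>B m_cross_inv"
    by (simp add: m_comp_assoc reidemeister_2 m_comp_id[OF hom_cap])
  then have "m_cap = kink *\<^sub>B (m_cap \<circ>\<^sub>B m_cross_inv)"
    by (simp add: cap_cross m_comp_scale_left)
  then show "kink *\<^sub>B (m_cap \<circ>\<^sub>B m_cross_inv) = kink *\<^sub>B kink' *\<^sub>B m_cap"
    using kk by simp
  show "kink \<noteq> 0" by simp
qed

section \<open>The antisymmetrisers\<close>

abbreviation (input) qd :: scalar where "qd \<equiv> \<q> - inverse \<q>"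
abbreviation m_hook :: mor where "m_hook \<equiv> m_cup \<circ>\<^sub>B m_cap"

lemma hom_hook: "m_hook \<in> m_hom 2 2" by (rule homs)+

lemma m_add_both_cancel:
  assumes "f +\<^sub>B (-1) *\<^sub>B g = h" "f \<in> m_hom p q" "g \<in> m_hom p q"
  shows "f = g +\<^sub>B h"
proof -
  have "g +\<^sub>B h = f +\<^sub>B (g +\<^sub>B (-1) *\<^sub>B g)" by (simp add: assms(1)[symmetric] m_add_ac)
  then show ?thesis using assms by (simp add: m_add_inverse m_add_zero)
qed

lemma cross_eq: "m_cross = m_cross_inv +\<^sub>B (qd *\<^sub>B m_id 2 +\<^sub>B (- qd) *\<^sub>B m_hook)"
  by (rule m_add_both_cancel[OF _ hom_cross hom_cross_inv])
    (simp add: skein_cross m_scale_add)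

lemma cross_inv_eq: "m_cross_inv = m_cross +\<^sub>B ((- qd) *\<^sub>B m_id 2 +\<^sub>B qd *\<^sub>B m_hook)"
proof (rule m_add_both_cancel[OF _ hom_cross_inv hom_cross])
  have "(-1) *\<^sub>B (m_cross +\<^sub>B (-1) *\<^sub>B m_cross_inv) =
      (-1) *\<^sub>B (qd *\<^sub>B (m_id 2 +\<^sub>B (-1) *\<^sub>B m_hook))"
    by (simp only: skein_cross)
  then show "m_cross_inv +\<^sub>B (-1) *\<^sub>B m_cross = (- qd) *\<^sub>B m_id 2 +\<^sub>B qd *\<^sub>B m_hook"
    by (simp add: m_scale_add m_add_ac)
qed

lemma hook_eq:
  "m_hook = m_id 2 +\<^sub>B ((- inverse qd) *\<^sub>B m_cross +\<^sub>B inverse qd *\<^sub>B m_cross_inv)"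
proof (rule m_add_both_cancel[OF _ hom_hook hom_id[OF HOL.refl]])
  have "(- inverse qd) *\<^sub>B (m_cross +\<^sub>B (-1) *\<^sub>B m_cross_inv) =
      (- inverse qd) *\<^sub>B (qd *\<^sub>B (m_id 2 +\<^sub>B (-1) *\<^sub>B m_hook))"
    by (simp only: skein_cross)
  moreover have "- inverse qd * qd = -1" by simp
  ultimately show "m_hook +\<^sub>B (-1) *\<^sub>B m_id 2 =
      (- inverse qd) *\<^sub>B m_cross +\<^sub>B inverse qd *\<^sub>B m_cross_inv"
    by (simp add: m_scale_add m_add_ac del: minus_diff_eq)
qed

section \<open>Relations on three strands\<close>

lemma st_hook: "st i m_hook j = st i m_cup j \<circ>\<^sub>B st i m_cap j"
  by (rule st_comp) (rule homs)+

text \<open>This is \<open>reidemeister_3\<close> multiplied on both sides by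
  \<open>?t1 \<circ>\<^sub>B ?t2\<close>.\<close>

lemma three_strands_reidemeister_inv:
  "st 1 m_cross 0 \<circ>\<^sub>B st 0 m_cross_inv 1 \<circ>\<^sub>B st 1 m_cross_inv 0 =
   st 0 m_cross_inv 1 \<circ>\<^sub>B st 1 m_cross_inv 0 \<circ>\<^sub>B st 0 m_cross 1" (is "?s2 \<circ>\<^sub>B ?t1 \<circ>\<^sub>B ?t2 = ?t1 \<circ>\<^sub>B ?t2 \<circ>\<^sub>B ?s1")
proof -
  have st1: "?s1 \<circ>\<^sub>B ?t1 = m_id 3" "?t1 \<circ>\<^sub>B ?s1 = m_id 3"
    by (simp_all add: st_comp[symmetric, OF hom_cross hom_cross_inv] reidemeister_2
        st_comp[symmetric, OF hom_cross_inv hom_cross] reidemeister_2')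
  have st2: "?s2 \<circ>\<^sub>B ?t2 = m_id 3"  "?t2 \<circ>\<^sub>B ?s2 = m_id 3"
    by (simp_all add: st_comp[symmetric, OF hom_cross hom_cross_inv] reidemeister_2
        st_comp[symmetric, OF hom_cross_inv hom_cross] reidemeister_2')
  have h: "?s1 \<in> m_hom 3 3" "?s2 \<in> m_hom 3 3" "?t1 \<in> m_hom 3 3" "?t2 \<in> m_hom 3 3"
    by (rule homs | simp)+
  have "?s2 \<circ>\<^sub>B ?t1 \<circ>\<^sub>B ?t2 = ((?t1 \<circ>\<^sub>B ?t2) \<circ>\<^sub>B (?s2 \<circ>\<^sub>B ?s1 \<circ>\<^sub>B ?s2)) \<circ>\<^sub>B ?t1 \<circ>\<^sub>B ?t2"
  proof -
    have "(?t1 \<circ>\<^sub>B ?t2) \<circ>\<^sub>B (?s2 \<circ>\<^sub>B ?s1 \<circ>\<^sub>B ?s2) = ?t1 \<circ>\<^sub>B (?t2 \<circ>\<^sub>B ?s2) \<circ>\<^sub>B ?s1 \<circ>\<^sub>B ?s2"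
      by (simp only: m_comp_assoc)
    also have "\<dots> = (?t1 \<circ>\<^sub>B ?s1) \<circ>\<^sub>B ?s2"
      by (simp only: st2 m_comp_assoc) (metis hom_comp[OF h(1) h(2)] hom_comp[OF h(2) h(1)] m_id_comp)
    also have "\<dots> = ?s2" by (simp only: st1 m_id_comp[OF h(2)])
    finally show ?thesis by simp
  qed
  also have "\<dots> = ((?t1 \<circ>\<^sub>B ?t2) \<circ>\<^sub>B ?s1 \<circ>\<^sub>B ?s2 \<circ>\<^sub>B ?s1) \<circ>\<^sub>B ?t1 \<circ>\<^sub>B ?t2"
    by (simp only: reidemeister_3)
  also have "\<dots> = (?t1 \<circ>\<^sub>B ?t2 \<circ>\<^sub>B ?s1) \<circ>\<^sub>B (?s2 \<circ>\<^sub>B (?s1 \<circ>\<^sub>B ?t1) \<circ>\<^sub>B ?t2)"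
    by (simp only: m_comp_assoc)
  also have "?s2 \<circ>\<^sub>B (?s1 \<circ>\<^sub>B ?t1) \<circ>\<^sub>B ?t2 = m_id 3"
    by (simp only: st1 m_id_comp[OF h(4)] st2)
  finally show ?thesis by (simp add: m_comp_assoc m_comp_id[OF h(1)])
qed

text \<open>A cap slide followed by the cancellation of inverse crossings moves the cap from the
  first pair of strands to the second. Both sides of the first two equations become a cup on the
  first pair after a cap on the second; the third equation slides that cup.\<close>

lemma three_strands_hook:
  shows "st 0 m_hook 1 \<circ>\<^sub>B st 1 m_cross 0 \<circ>\<^sub>B st 0 m_cross 1 = st 0 m_hook 1 \<circ>\<^sub>B st 1 m_hook 0"
    and "st 0 m_hook 1 \<circ>\<^sub>B st 1 m_cross_inv 0 \<circ>\<^sub>B st 0 m_cross_inv 1 = st 0 m_hook 1 \<circ>\<^sub>B st 1 m_hook 0"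
    and "st 1 m_cross 0 \<circ>\<^sub>B st 0 m_hook 1 \<circ>\<^sub>B st 1 m_hook 0 = st 0 m_cross_inv 1 \<circ>\<^sub>B st 1 m_hook 0"
proof -
  have i1: "st 0 m_cross_inv 1 \<circ>\<^sub>B st 0 m_cross 1 = m_id 3"
    "st 0 m_cross 1 \<circ>\<^sub>B st 0 m_cross_inv 1 = m_id 3"
    by (simp_all add: st_comp[symmetric, OF hom_cross hom_cross_inv] reidemeister_2
        st_comp[symmetric, OF hom_cross_inv hom_cross] reidemeister_2')
  have hc: "st 1 m_cap 0 \<in> m_hom 3 1" by (rule homs | simp)+
  have zz: "st 0 m_cap 1 \<circ>\<^sub>B st 1 m_cup 0 \<circ>\<^sub>B st 1 m_cap 0 = st 1 m_cap 0"
    by (simp add: m_comp_assoc[symmetric] zigzag_left m_id_comp[OF hc])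
  have u: "st 0 m_hook 1 \<circ>\<^sub>B st 1 m_hook 0 = st 0 m_cup 1 \<circ>\<^sub>B st 1 m_cap 0"
    by (simp add: st_hook m_comp_assoc zz)
  have "st 0 m_cap 1 \<circ>\<^sub>B st 1 m_cross 0 \<circ>\<^sub>B st 0 m_cross 1 = st 1 m_cap 0"
    using cap_slide i1(1) by (metis m_comp_assoc m_comp_id[OF hc])
  then show "st 0 m_hook 1 \<circ>\<^sub>B st 1 m_cross 0 \<circ>\<^sub>B st 0 m_cross 1 = st 0 m_hook 1 \<circ>\<^sub>B st 1 m_hook 0"
    by (simp only: u) (simp add: st_hook m_comp_assoc)
  have "st 0 m_cap 1 \<circ>\<^sub>B st 1 m_cross_inv 0 \<circ>\<^sub>B st 0 m_cross_inv 1 = st 1 m_cap 0"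
    using cap_slide' i1(2) by (metis m_comp_assoc m_comp_id[OF hc])
  then show "st 0 m_hook 1 \<circ>\<^sub>B st 1 m_cross_inv 0 \<circ>\<^sub>B st 0 m_cross_inv 1 = st 0 m_hook 1 \<circ>\<^sub>B st 1 m_hook 0"
    by (simp only: u) (simp add: st_hook m_comp_assoc)
  show "st 1 m_cross 0 \<circ>\<^sub>B st 0 m_hook 1 \<circ>\<^sub>B st 1 m_hook 0 = st 0 m_cross_inv 1 \<circ>\<^sub>B st 1 m_hook 0"
    by (simp only: u) (simp add: st_hook cup_slide flip: m_comp_assoc)
qed

text \<open>\<open>S_mor x\<close> is the operator $S_1(x)$ on two strands, written as
  \<open>S_A x + S_B x \<sigma> + S_C x \<sigma>\<^sup>-\<^sup>1\<close>.\<close>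

definition S_den :: "scalar \<Rightarrow> scalar" where
  "S_den x = (x * inverse \<z> + inverse x * \<z>) * (x * \<q> - inverse x * inverse \<q>)"
definition S_A :: "scalar \<Rightarrow> scalar" where
  "S_A x = inverse (S_den x) * ((\<z> + inverse \<z>) * qd)"
definition S_B :: "scalar \<Rightarrow> scalar" where
  "S_B x = inverse (S_den x) * ((inverse x - x) * (inverse x * \<z>))"
definition S_C :: "scalar \<Rightarrow> scalar" where
  "S_C x = inverse (S_den x) * ((inverse x - x) * (x * inverse \<z>))"
definition S_mor :: "scalar \<Rightarrow> mor" where
  "S_mor x = S_A x *\<^sub>B m_id 2 +\<^sub>B (S_B x *\<^sub>B m_cross +\<^sub>B S_C x *\<^sub>B m_cross_inv)"

lemma hom_S: "S_mor x \<in> m_hom 2 2"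
  unfolding S_mor_def by (rule homs | simp)+

lemma S_op_eq: "S_op (Suc (Suc k)) (Suc k) x = st k (S_mor x) 0"
  by (simp add: S_op_def S_mor_def strand_op_def st_def[of k m_cross 0, symmetric, simplified]
      st_def[of k m_cross_inv 0, symmetric, simplified] st_add st_scale m_scale_add S_A_def
      S_B_def S_C_def S_den_def m_add_ac mult.assoc)

section \<open>Scalar identities for the coefficients of S(x)\<close>

lemma qint_0_nat: "qint 0 (int k) = (\<q> ^ k - inverse (\<q> ^ k)) / qd"
  by (simp add: qint_def power_int_minus)

lemma S_den_nonzero: "S_den (\<q> ^ p) \<noteq> 0"
proof -
  have "\<q> ^ p * inverse \<z> + inverse (\<q> ^ p) * \<z> = qbrace (int p)"
    by (simp add: qbrace_def power_int_minus mult.commute add.commute)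
  moreover have "\<q> ^ p * \<q> - inverse (\<q> ^ p) * inverse \<q> = qint 0 (int (Suc p)) * qd"
    by (simp only: qint_0_nat) (simp add: mult.commute)
  ultimately show ?thesis using qint_0_nonzero[of "Suc p"] by (simp add: S_den_def)
qed

lemma S_1: "S_A 1 = 1" "S_B 1 = 0" "S_C 1 = 0" "S_den 1 \<noteq> 0"
proof -
  have d1: "S_den 1 = (\<z> + inverse \<z>) * qd" by (simp add: S_den_def add.commute)
  have d0: "S_den 1 \<noteq> 0" using S_den_nonzero[of 0] by simp
  show "S_A 1 = 1" "S_B 1 = 0" "S_C 1 = 0" "S_den 1 \<noteq> 0"
    using d0 by (simp_all add: S_A_def S_B_def S_C_def d1[symmetric])
qed

text \<open>The left side is the scalar by which S(x) acts where sigma acts by -q^-1 and its inverse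
  by -q; such vectors are therefore fixed by S(x).\<close>

lemma S_ABC:
  assumes "S_den x \<noteq> 0" "x \<noteq> 0"
  shows "S_A x - S_B x * inverse \<q> - S_C x * \<q> = 1"
proof -
  have "S_A x - S_B x * inverse \<q> - S_C x * \<q> = inverse (S_den x) *
    ((\<z> + inverse \<z>) * qd - (inverse x - x) * (inverse x * \<z>) * inverse \<q>
      - (inverse x - x) * (x * inverse \<z>) * \<q>)"
    by (simp add: S_A_def S_B_def S_C_def algebra_simps)
  also have "(\<z> + inverse \<z>) * qd - (inverse x - x) * (inverse x * \<z>) * inverse \<q>
      - (inverse x - x) * (x * inverse \<z>) * \<q> = S_den x"
    using assms(2) by (simp add: S_den_def field_simps)
  finally show ?thesis using assms by simp
qed


text \<open>These are the factors \<open>a - \<kappa> * c\<close> and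
  \<open>a + \<kappa> * b\<close> that appear in \<open>three_strands\<close> when the skein
  relation exchanges a crossing and its inverse. The factor of \<open>S_den y\<close> involving
  \<open>\<z>\<close> cancels in both.\<close>

lemma S_AC_AB:
  assumes "S_den y \<noteq> 0" "y \<noteq> 0"
  defines "e \<equiv> y * \<q> - inverse y * inverse \<q>"
  shows "(S_A y - qd * S_C y) * e = qd * y" "(S_A y + qd * S_B y) * e = qd * inverse y"
proof -
  have d: "S_den y = (y * inverse \<z> + inverse y * \<z>) * e" by (simp add: S_den_def e_def)
  have 1: "S_A y - qd * S_C y = inverse (S_den y) * qd * (y * (y * inverse \<z> + inverse y * \<z>))"
    "S_A y + qd * S_B y = inverse (S_den y) * qd * (inverse y * (y * inverse \<z> + inverse y * \<z>))"
    unfolding S_A_def S_B_def S_C_def using right_inverse[OF assms(2)] by algebra+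
  have 2: "inverse (S_den y) * ((y * inverse \<z> + inverse y * \<z>) * e) = 1"
    using left_inverse[OF assms(1)] by (simp only: d)
  show "(S_A y - qd * S_C y) * e = qd * y" "(S_A y + qd * S_B y) * e = qd * inverse y"
    unfolding 1 using 2 by algebra+
qed

text \<open>The shift of the parameter by q is chosen so that \<open>inverse x - x\<close> cancels
  the factor \<open>e\<close> of \<open>S_AC_AB\<close>. Up to the common factor \<open>r\<close>
  the results do not depend on \<open>y\<close>; for y = 1 they are the coefficients of
  S(q).\<close>

lemma S_step:
  fixes y :: scalar
  assumes "S_den y \<noteq> 0" "y \<noteq> 0"
  defines "x \<equiv> \<q> * y"
  defines "r \<equiv> inverse (S_den x) * qd"
  shows "S_A x = r * (\<z> + inverse \<z>)" "S_B x * (S_A y - qd * S_C y) = - r * inverse \<q> * \<z>"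
    "S_C x * (S_A y + qd * S_B y) = - r * \<q> * inverse \<z>"
proof -
  define e where "e = y * \<q> - inverse y * inverse \<q>"
  have e: "inverse x - x = - e" by (simp add: x_def e_def mult.commute)
  note AC = S_AC_AB[OF assms(1,2), folded e_def]
  show "S_A x = r * (\<z> + inverse \<z>)" by (simp add: S_A_def r_def)
  have "S_B x * (S_A y - qd * S_C y) =
      - inverse (S_den x) * (inverse x * \<z>) * ((S_A y - qd * S_C y) * e)"
    unfolding S_B_def e by (simp add: mult_ac)
  also have "\<dots> = - r * (inverse x * y) * \<z>" unfolding AC by (simp add: r_def mult_ac)
  also have "inverse x * y = inverse \<q>" using assms(2) by (simp add: x_def)
  finally show "S_B x * (S_A y - qd * S_C y) = - r * inverse \<q> * \<z>" .
  have "S_C x * (S_A y + qd * S_B y) =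
      - inverse (S_den x) * (x * inverse \<z>) * ((S_A y + qd * S_B y) * e)"
    unfolding S_C_def e by (simp add: mult_ac)
  also have "\<dots> = - r * (x * inverse y) * inverse \<z>" unfolding AC by (simp add: r_def mult_ac)
  also have "x * inverse y = \<q>" using assms(2) by (simp add: x_def)
  finally show "S_C x * (S_A y + qd * S_B y) = - r * \<q> * inverse \<z>" .
qed

text \<open>The cubic equation of sigma, with the hook eliminated and expressed through 1, sigma and
  its inverse.\<close>

lemma m_cross_square:
  "m_cross \<circ>\<^sub>B m_cross = (1 - qd * kink) *\<^sub>B m_id 2 +\<^sub>B
     ((qd + kink) *\<^sub>B m_cross +\<^sub>B (- kink) *\<^sub>B m_cross_inv)"
proof -
  have "m_cross \<circ>\<^sub>B m_cross = m_cross \<circ>\<^sub>B (m_cross_inv +\<^sub>B (qd *\<^sub>B m_id 2 +\<^sub>B (- qd) *\<^sub>B m_hook))"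
    by (subst (2) cross_eq) simp
  also have "\<dots> = m_id 2 +\<^sub>B (qd *\<^sub>B m_cross +\<^sub>B (- qd * kink) *\<^sub>B m_hook)"
    by (simp only: m_comp_add_right m_comp_scale_right reidemeister_2 m_comp_id[OF hom_cross]
        skein_kink m_scale_scale)
  also have "\<dots> = m_id 2 +\<^sub>B (qd *\<^sub>B m_cross +\<^sub>B (- qd * kink) *\<^sub>B (m_id 2 +\<^sub>B ((- inverse qd) *\<^sub>B m_cross +\<^sub>B inverse qd *\<^sub>B m_cross_inv)))"
    by (simp only: hook_eq[symmetric])
  also have "\<dots> = (m_id 2 +\<^sub>B (- qd * kink) *\<^sub>B m_id 2) +\<^sub>B ((qd *\<^sub>B m_cross +\<^sub>B kink *\<^sub>B m_cross) +\<^sub>B (- kink) *\<^sub>B m_cross_inv)"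
  proof -
    have "qd * inverse qd = 1" by simp
    then have c: "(- qd * kink) * (- inverse qd) = kink" "(- qd * kink) * inverse qd = - kink"
      by algebra+
    show ?thesis by (simp only: m_scale_add m_scale_scale c m_add_ac)
  qed
  also have "m_id 2 +\<^sub>B (- qd * kink) *\<^sub>B m_id 2 = (1 - qd * kink) *\<^sub>B m_id 2"
    by (simp only: diff_conv_add_uminus m_add_scale m_one_scale mult_minus_left)
  finally show ?thesis by (simp only: m_add_scale)
qed

text \<open>Since E(2) = S(q), this is the base case of the alternating property.\<close>

lemma cross_S: "m_cross \<circ>\<^sub>B S_mor \<q> = (- inverse \<q>) *\<^sub>B S_mor \<q>"
proof -
  let ?A = "S_A \<q>" and ?B = "S_B \<q>" and ?C = "S_C \<q>"
  define r where "r = inverse (S_den \<q>) * qd"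
  define k where "k = kink"
  have ABC: "?A = r * (\<z> + inverse \<z>)" "?B = - r * inverse \<q> * \<z>" "?C = - r * \<q> * inverse \<z>"
    using S_step[OF S_1(4)] by (simp_all add: S_1 r_def)
  have inv: "\<q> * inverse \<q> = 1" "\<z> * inverse \<z> = 1" by simp_all
  have k: "k = inverse \<z> * inverse \<z> * \<q>" by (simp add: k_def power_int_minus power2_eq_square)
  have "m_cross \<circ>\<^sub>B S_mor \<q> = ?A *\<^sub>B m_cross +\<^sub>B (?B *\<^sub>B ((1 - qd * k) *\<^sub>B m_id 2 +\<^sub>B
     ((qd + k) *\<^sub>B m_cross +\<^sub>B (- k) *\<^sub>B m_cross_inv)) +\<^sub>B ?C *\<^sub>B m_id 2)"
    by (simp only: S_mor_def m_comp_add_right m_comp_scale_right m_comp_id[OF hom_cross]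
        m_cross_square reidemeister_2 k_def)
  also have "\<dots> = (?B * (1 - qd * k) + ?C) *\<^sub>B m_id 2 +\<^sub>B
      ((?A + ?B * (qd + k)) *\<^sub>B m_cross +\<^sub>B (?B * (- k)) *\<^sub>B m_cross_inv)"
    by (simp only: m_scale_add m_scale_scale m_add_scale m_add_ac distrib_left)
  also have "?B * (1 - qd * k) + ?C = - inverse \<q> * ?A"
    unfolding ABC k using inv by algebra
  also have "?A + ?B * (qd + k) = - inverse \<q> * ?B"
    unfolding ABC k using inv by algebra
  also have "?B * (- k) = - inverse \<q> * ?C"
    unfolding ABC k using inv by algebra
  finally show ?thesis by (simp only: S_mor_def m_scale_add m_scale_scale)
qed

text \<open>If \<open>\<sigma>\<^sub>1 X = -q\<^sup>-\<^sup>1 X\<close>, then $\sigma_2$ acts by $-q^{-1}$ on $S_1(y) S_2(qy) X$. This is what the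
  Yang--Baxter equation gives with \<open>X = S\<^sub>1(q) X\<close>; it is proved directly, because the six vectors
  in \<open>lc\<close> below span the left module generated by \<open>X\<close> over the three-strand algebra.\<close>

lemma three_strands:
  fixes s1 s2 t1 t2 u1 u2 X :: mor and a b c a' b' c' \<kappa> k q qi :: scalar
  assumes \<kappa>: "\<kappa> \<noteq> 0"
    and s1X: "s1 \<circ>\<^sub>B X = (- qi) *\<^sub>B X" and t1X: "t1 \<circ>\<^sub>B X = (- q) *\<^sub>B X"
    and r1: "s2 \<circ>\<^sub>B s1 \<circ>\<^sub>B s2 \<circ>\<^sub>B X = s1 \<circ>\<^sub>B s2 \<circ>\<^sub>B s1 \<circ>\<^sub>B X"
    and r2: "s2 \<circ>\<^sub>B t1 \<circ>\<^sub>B t2 \<circ>\<^sub>B X = t1 \<circ>\<^sub>B t2 \<circ>\<^sub>B s1 \<circ>\<^sub>B X"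
    and r3: "u1 \<circ>\<^sub>B s2 \<circ>\<^sub>B s1 \<circ>\<^sub>B X = u1 \<circ>\<^sub>B u2 \<circ>\<^sub>B X"
    and r4: "u1 \<circ>\<^sub>B t2 \<circ>\<^sub>B t1 \<circ>\<^sub>B X = u1 \<circ>\<^sub>B u2 \<circ>\<^sub>B X"
    and r5: "s2 \<circ>\<^sub>B u1 \<circ>\<^sub>B u2 \<circ>\<^sub>B X = t1 \<circ>\<^sub>B u2 \<circ>\<^sub>B X"
    and k1: "s1 \<circ>\<^sub>B t2 \<circ>\<^sub>B X = (t1 \<circ>\<^sub>B t2 \<circ>\<^sub>B X) +\<^sub>B (\<kappa> *\<^sub>B (t2 \<circ>\<^sub>B X) +\<^sub>B (- \<kappa>) *\<^sub>B (u1 \<circ>\<^sub>B t2 \<circ>\<^sub>B X))"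
    and k2: "t1 \<circ>\<^sub>B s2 \<circ>\<^sub>B X = (s1 \<circ>\<^sub>B s2 \<circ>\<^sub>B X) +\<^sub>B ((- \<kappa>) *\<^sub>B (s2 \<circ>\<^sub>B X) +\<^sub>B \<kappa> *\<^sub>B (u1 \<circ>\<^sub>B s2 \<circ>\<^sub>B X))"
    and k3: "u2 \<circ>\<^sub>B X = X +\<^sub>B ((- inverse \<kappa>) *\<^sub>B (s2 \<circ>\<^sub>B X) +\<^sub>B inverse \<kappa> *\<^sub>B (t2 \<circ>\<^sub>B X))"
    and st2: "s2 \<circ>\<^sub>B t2 \<circ>\<^sub>B X = X"
    and s22: "s2 \<circ>\<^sub>B s2 \<circ>\<^sub>B X = (1 - \<kappa> * k) *\<^sub>B X +\<^sub>B ((\<kappa> + k) *\<^sub>B (s2 \<circ>\<^sub>B X) +\<^sub>B (- k) *\<^sub>B (t2 \<circ>\<^sub>B X))"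
    and q: "q * qi = 1"
    and SY: "SX = a' *\<^sub>B X +\<^sub>B (b' *\<^sub>B (s2 \<circ>\<^sub>B X) +\<^sub>B c' *\<^sub>B (t2 \<circ>\<^sub>B X))"
    and Y: "Y = a *\<^sub>B SX +\<^sub>B (b *\<^sub>B (s1 \<circ>\<^sub>B SX) +\<^sub>B c *\<^sub>B (t1 \<circ>\<^sub>B SX))"
    and abc: "a - b * qi - c * q = 1"
    and e0: "c' * b * qi = q * b' * c"
    and e1: "c' * (a + \<kappa> * b) = q * k * b' * (a - \<kappa> * c)"
    and e2: "b' * (a - \<kappa> * c) * (1 - \<kappa> * k) + c' * (a + \<kappa> * b) = - qi * a'"
    and e3: "a' + b' * (a - \<kappa> * c) * (\<kappa> + k) = - qi * (b' * (a - \<kappa> * c))"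
    and X: "X \<in> m_hom n p"
    and h: "s1 \<in> m_hom p p" "s2 \<in> m_hom p p" "t1 \<in> m_hom p p" "t2 \<in> m_hom p p"
      "u1 \<in> m_hom p p" "u2 \<in> m_hom p p"
  shows "s2 \<circ>\<^sub>B Y = (- qi) *\<^sub>B Y"
proof -
  define lc where "lc x1 x2 x3 x4 x5 x6 = x1 *\<^sub>B X +\<^sub>B (x2 *\<^sub>B (s2 \<circ>\<^sub>B X) +\<^sub>B (x3 *\<^sub>B (t2 \<circ>\<^sub>B X) +\<^sub>B
    (x4 *\<^sub>B (s1 \<circ>\<^sub>B s2 \<circ>\<^sub>B X) +\<^sub>B (x5 *\<^sub>B (t1 \<circ>\<^sub>B t2 \<circ>\<^sub>B X) +\<^sub>B x6 *\<^sub>B (u1 \<circ>\<^sub>B u2 \<circ>\<^sub>B X)))))"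
    for x1 x2 x3 x4 x5 x6 
  have lc_add: "lc x1 x2 x3 x4 x5 x6 +\<^sub>B lc y1 y2 y3 y4 y5 y6 =
      lc (x1 + y1) (x2 + y2) (x3 + y3) (x4 + y4) (x5 + y5) (x6 + y6)"
    for x1 x2 x3 x4 x5 x6 y1 y2 y3 y4 y5 y6
    by (simp only: lc_def m_add_scale m_add_ac)
  have lc_scale: "r *\<^sub>B lc x1 x2 x3 x4 x5 x6 =
      lc (r * x1) (r * x2) (r * x3) (r * x4) (r * x5) (r * x6)" for r x1 x2 x3 x4 x5 x6 
    by (simp only: lc_def m_scale_add m_scale_scale)
  have w: "X \<in> m_hom n p" "s2 \<circ>\<^sub>B X \<in> m_hom n p" "t2 \<circ>\<^sub>B X \<in> m_hom n p" "s1 \<circ>\<^sub>B s2 \<circ>\<^sub>B X \<in> m_hom n p"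
    "t1 \<circ>\<^sub>B t2 \<circ>\<^sub>B X \<in> m_hom n p" "u1 \<circ>\<^sub>B u2 \<circ>\<^sub>B X \<in> m_hom n p"
    using X h by (metis hom_comp)+
  have z: "f +\<^sub>B m_zero n p = f" "m_zero n p +\<^sub>B f = f" if "f \<in> m_hom n p" for f
    using m_add_zero[OF that] by (simp_all add: m_add_commute)
  have b: "X = lc 1 0 0 0 0 0" "s2 \<circ>\<^sub>B X = lc 0 1 0 0 0 0" "t2 \<circ>\<^sub>B X = lc 0 0 1 0 0 0"
    "s1 \<circ>\<^sub>B s2 \<circ>\<^sub>B X = lc 0 0 0 1 0 0" "t1 \<circ>\<^sub>B t2 \<circ>\<^sub>B X = lc 0 0 0 0 1 0"
    "u1 \<circ>\<^sub>B u2 \<circ>\<^sub>B X = lc 0 0 0 0 0 1"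
    unfolding lc_def using w by (simp_all add: m_zero_scale z hom_zero)
  have qi: "(- qi) * (- q) = 1" using q by (simp add: mult.commute)
  have X_t1: "X = (- qi) *\<^sub>B (t1 \<circ>\<^sub>B X)" "X = (- q) *\<^sub>B (s1 \<circ>\<^sub>B X)"
    using qi by (simp_all add: s1X t1X q)
  \<comment> \<open>\<open>r4\<close> needs a \<open>t1\<close> next to \<open>X\<close>; the
    eigenvalue of \<open>t1\<close> on \<open>X\<close> allows one to be inserted.\<close>
  have u1t2: "u1 \<circ>\<^sub>B t2 \<circ>\<^sub>B X = lc 0 0 0 0 0 (- qi)"
    by (subst X_t1(1)) (simp only: m_comp_scale_right r4 b(6) lc_scale, simp)
  have u1s2: "u1 \<circ>\<^sub>B s2 \<circ>\<^sub>B X = lc 0 0 0 0 0 (- q)"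
    by (subst X_t1(2)) (simp only: m_comp_scale_right r3 b(6) lc_scale, simp)
  have s1t2: "s1 \<circ>\<^sub>B t2 \<circ>\<^sub>B X = lc 0 0 \<kappa> 0 1 (\<kappa> * qi)"
    by (simp only: k1 u1t2) ((simp only: b(4-6))?, (simp only: b(2-3))?, simp only: b(1) lc_scale lc_add, simp)
  have t1s2: "t1 \<circ>\<^sub>B s2 \<circ>\<^sub>B X = lc 0 (- \<kappa>) 0 1 0 (- \<kappa> * q)"
    by (simp only: k2 u1s2) ((simp only: b(4-6))?, (simp only: b(2-3))?, simp only: b(1) lc_scale lc_add, simp)
  have SX_lc: "SX = lc a' b' c' 0 0 0"
    by (simp only: SY) ((simp only: b(4-6))?, (simp only: b(2-3))?, simp only: b(1) lc_scale lc_add, simp)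
  have s1SX: "s1 \<circ>\<^sub>B SX = lc (- qi * a') 0 (\<kappa> * c') b' c' (\<kappa> * qi * c')"
    by (simp only: SY m_comp_add_right m_comp_scale_right s1X s1t2)
      ((simp only: b(4-6))?, (simp only: b(2-3))?, simp only: b(1) lc_scale lc_add, simp add: mult_ac)
  have t1SX: "t1 \<circ>\<^sub>B SX = lc (- q * a') (- \<kappa> * b') 0 b' c' (- \<kappa> * q * b')"
    by (simp only: SY m_comp_add_right m_comp_scale_right t1X t1s2)
      ((simp only: b(4-6))?, (simp only: b(2-3))?, simp only: b(1) lc_scale lc_add, simp add: mult_ac)
  \<comment> \<open>\<open>P\<close> and \<open>Q\<close> will be the coefficients of
    \<open>s2 \<circ>\<^sub>B X\<close> and \<open>t2 \<circ>\<^sub>B X\<close> in \<open>Y\<close>;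
    in the application these are the products evaluated by \<open>S_step\<close>.\<close>
  define P where "P = b' * (a - \<kappa> * c)"
  define Q where "Q = c' * (a + \<kappa> * b)"
  have "Y = lc (a' * (a - b * qi - c * q)) P Q (b' * (b + c)) (c' * (b + c))
      (\<kappa> * (c' * b * qi - q * b' * c))"
    by (simp only: Y s1SX t1SX, simp only: SX_lc lc_scale lc_add) (simp add: P_def Q_def algebra_simps)
  \<comment> \<open>\<open>e0\<close> removes the component along the two hooks, so
    \<open>s2\<close> only has to be applied to the other five vectors.\<close>
  then have Y_lc: "Y = lc a' P Q (b' * (b + c)) (c' * (b + c)) 0"
    using abc e0 by simp
  have b2: "s2 \<circ>\<^sub>B X = lc 0 1 0 0 0 0" by (fact b(2))
  have b22: "s2 \<circ>\<^sub>B s2 \<circ>\<^sub>B X = lc (1 - \<kappa> * k) (\<kappa> + k) (- k) 0 0 0"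
    by (simp only: s22) ((simp only: b(4-6))?, (simp only: b(2-3))?, simp only: b(1) lc_scale lc_add, simp)
  have bt2: "s2 \<circ>\<^sub>B t2 \<circ>\<^sub>B X = lc 1 0 0 0 0 0"
    by (simp only: st2 b(1)[symmetric])
  have b12: "s2 \<circ>\<^sub>B s1 \<circ>\<^sub>B s2 \<circ>\<^sub>B X = lc 0 0 0 (- qi) 0 0"
    by (simp only: r1, simp only: s1X m_comp_scale_right, simp only: b(4) lc_scale, simp)
  have bt12: "s2 \<circ>\<^sub>B t1 \<circ>\<^sub>B t2 \<circ>\<^sub>B X = lc 0 0 0 0 (- qi) 0"
    by (simp only: r2, simp only: s1X m_comp_scale_right, simp only: b(5) lc_scale, simp)
  have "Y = a' *\<^sub>B X +\<^sub>B (P *\<^sub>B (s2 \<circ>\<^sub>B X) +\<^sub>B (Q *\<^sub>B (t2 \<circ>\<^sub>B X) +\<^sub>B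
    ((b' * (b + c)) *\<^sub>B (s1 \<circ>\<^sub>B s2 \<circ>\<^sub>B X) +\<^sub>B (c' * (b + c)) *\<^sub>B (t1 \<circ>\<^sub>B t2 \<circ>\<^sub>B X))))"
    by (simp only: Y_lc) ((simp only: b(4-6))?, (simp only: b(2-3))?, simp only: b(1) lc_scale lc_add, simp)
  then have "s2 \<circ>\<^sub>B Y = a' *\<^sub>B lc 0 1 0 0 0 0 +\<^sub>B (P *\<^sub>B lc (1 - \<kappa> * k) (\<kappa> + k) (- k) 0 0 0 +\<^sub>B
      (Q *\<^sub>B lc 1 0 0 0 0 0 +\<^sub>B ((b' * (b + c)) *\<^sub>B lc 0 0 0 (- qi) 0 0
       +\<^sub>B (c' * (b + c)) *\<^sub>B lc 0 0 0 0 (- qi) 0)))"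
    by (simp only: m_comp_add_right m_comp_scale_right b22 bt2 b12 bt12) (simp only: b2)
  also have "\<dots> = lc (P * (1 - \<kappa> * k) + Q) (a' + P * (\<kappa> + k)) (- k * P)
     (- qi * (b' * (b + c))) (- qi * (c' * (b + c))) 0"
    by (simp only: lc_scale lc_add) (simp add: mult_ac)
  also have "- k * P = - qi * Q"
    using e1 q unfolding P_def Q_def by algebra
  also have "P * (1 - \<kappa> * k) + Q = - qi * a'" using e2 by (simp add: P_def Q_def)
  also have "a' + P * (\<kappa> + k) = - qi * P" using e3 by (simp add: P_def)
  finally show ?thesis by (simp only: Y_lc lc_scale) simp
qed

section \<open>The idempotents E(p) and alternating morphisms\<close>

lemma hom_cast: "f \<in> m_hom p q \<Longrightarrow> p = p' \<Longrightarrow> q = q' \<Longrightarrow> f \<in> m_hom p' q'"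
  by simp

lemma S_op_eq': "S_op (Suc k + 1) (Suc k) x = st k (S_mor x) 0"
  using S_op_eq[of k x] by (simp only: Suc_eq_plus1)

lemma E_step: "E (Suc (Suc k)) =
    st 0 (E (Suc k)) 1 \<circ>\<^sub>B st k (S_mor (\<q> ^ Suc k)) 0 \<circ>\<^sub>B st 0 (E (Suc k)) 1"
  unfolding E.simps Let_def S_op_eq' by (simp only: st_def[of 0] m_unit_tens)

lemma E_2: "E 2 = S_mor \<q>"
proof -
  have "(0::nat) + 1 + 1 = 2" by simp
  then have "st 0 (E (Suc 0)) 1 = m_id 2" by (simp only: E.simps st_id)
  then show ?thesis
    using E_step[of 0] m_comp_id[OF hom_S] m_id_comp[OF hom_S]
    by (simp add: numeral_2_eq_2[symmetric] del: E.simps)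
qed

lemma hom_E: "E p \<in> m_hom p p"
proof (induction p rule: E.induct)
  case (3 k)
  then show ?case
    unfolding E_step
    by (intro hom_comp[where q = "Suc (Suc k)"] hom_st[where p = "Suc k" and q = "Suc k"]
        hom_st[where p = 2 and q = 2] hom_S) simp_all
qed (use hom_id[of 0 0] hom_id[of 1 1] in \<open>simp_all only: E.simps One_nat_def\<close>)

lemma st_comp_left:
  assumes "f \<in> m_hom p q" "g \<in> m_hom q r"
  shows "st i (g \<circ>\<^sub>B f) j \<circ>\<^sub>B X = st i g j \<circ>\<^sub>B st i f j \<circ>\<^sub>B X"
  by (simp only: st_comp[OF assms] m_comp_assoc)

text \<open>\<open>alternating i p j X\<close>: the outputs \<open>i + 1, \<dots>, i + p\<close> of \<open>X\<close>, out of \<open>i + p + j\<close>, are antisymmetric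
  in the $q$-deformed sense.\<close>

definition alternating :: "nat \<Rightarrow> nat \<Rightarrow> nat \<Rightarrow> mor \<Rightarrow> bool" where
  "alternating i p j X \<longleftrightarrow>
    (\<forall>k l. k + 2 + l = p \<longrightarrow> st (i + k) m_cross (l + j) \<circ>\<^sub>B X = (- inverse \<q>) *\<^sub>B X)"

lemma alternatingD:
  "alternating i p j X \<Longrightarrow> k + 2 + l = p \<Longrightarrow> i' = i + k \<Longrightarrow> j' = l + j
    \<Longrightarrow> st i' m_cross j' \<circ>\<^sub>B X = (- inverse \<q>) *\<^sub>B X"
  by (auto simp: alternating_def)

lemma alternating_st:
  assumes "alternating i p j X" "X \<in> m_hom n (i + p + j)"
  shows "alternating (k + i) p (j + l) (st k X l)"
  unfolding alternating_def
proof (intro allI impI)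
  fix a b assume ab: "a + 2 + b = p"
  have h: "st (i + a) m_cross (b + j) \<in> m_hom (i + p + j) (i + p + j)"
    by (rule hom_st[OF hom_cross]) (use ab in simp_all)
  have "st (i + a) m_cross (b + j) \<circ>\<^sub>B X = (- inverse \<q>) *\<^sub>B X"
    by (rule alternatingD[OF assms(1) ab]) simp_all
  then have "st k (st (i + a) m_cross (b + j)) l \<circ>\<^sub>B st k X l = (- inverse \<q>) *\<^sub>B st k X l"
    by (simp only: st_comp[OF assms(2) h, symmetric] st_scale)
  then show "st (k + i + a) m_cross (b + (j + l)) \<circ>\<^sub>B st k X l = (- inverse \<q>) *\<^sub>B st k X l"
    by (simp add: add.assoc)
qed

lemma cross_inv_eigen:
  assumes X: "X \<in> m_hom n (i + 2 + j)" and e: "st i m_cross j \<circ>\<^sub>B X = (- inverse \<q>) *\<^sub>B X"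
  shows "st i m_cross_inv j \<circ>\<^sub>B X = (- \<q>) *\<^sub>B X"
proof -
  have "X = st i (m_cross_inv \<circ>\<^sub>B m_cross) j \<circ>\<^sub>B X"
    by (simp only: reidemeister_2' st_id m_id_comp[OF X])
  also have "\<dots> = (- inverse \<q>) *\<^sub>B (st i m_cross_inv j \<circ>\<^sub>B X)"
    by (simp only: st_comp_left[OF hom_cross hom_cross_inv] e m_comp_scale_right)
  finally have "(- \<q>) *\<^sub>B X = (- \<q>) *\<^sub>B (- inverse \<q>) *\<^sub>B (st i m_cross_inv j \<circ>\<^sub>B X)" by simp
  then show ?thesis by simp
qed

lemma S_eigen:
  assumes X: "X \<in> m_hom n (i + 2 + j)" and e: "st i m_cross j \<circ>\<^sub>B X = (- inverse \<q>) *\<^sub>B X"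
    and x: "S_den x \<noteq> 0" "x \<noteq> 0"
  shows "st i (S_mor x) j \<circ>\<^sub>B X = X"
proof -
  have "st i (S_mor x) j \<circ>\<^sub>B X =
      S_A x *\<^sub>B X +\<^sub>B (S_B x *\<^sub>B (- inverse \<q>) *\<^sub>B X +\<^sub>B S_C x *\<^sub>B (- \<q>) *\<^sub>B X)"
    by (simp only: S_mor_def st_add st_scale m_comp_add_left m_comp_scale_left e
        cross_inv_eigen[OF X e] st_id m_id_comp[OF X])
  also have "\<dots> = (S_A x - S_B x * inverse \<q> - S_C x * \<q>) *\<^sub>B X"
    by (simp only: m_scale_scale m_add_scale[symmetric]) (simp add: algebra_simps)
  finally show ?thesis by (simp only: S_ABC[OF x] m_one_scale)
qed

text \<open>Each of the three factors in the recursion for \<open>E\<close> fixes \<open>X\<close>: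
  the outer ones by induction, the middle one by \<open>S_eigen\<close>.\<close>

lemma E_absorb:
  "X \<in> m_hom n (i + p + j) \<Longrightarrow> alternating i p j X \<Longrightarrow> st i (E p) j \<circ>\<^sub>B X = X"
proof (induction p arbitrary: j rule: E.induct)
  case (1 j)
  then show ?case by (simp add: m_id_comp)
next
  case (2 j)
  have "X \<in> m_hom n (i + 1 + j)" by (rule hom_cast[OF 2(1)]) simp_all
  then show ?case by (simp only: E.simps st_id m_id_comp)
next
  case (3 k j)
  have X: "X \<in> m_hom n (i + Suc k + (1 + j))" by (rule hom_cast[OF "3.prems"(1)]) simp_all
  have a: "alternating i (Suc k) (1 + j) X"
    unfolding alternating_def
    by (intro allI impI) (rule alternatingD[OF "3.prems"(2), of _ "Suc _"], auto)
  note IH = 3(1)[OF HOL.refl X a]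
  have e: "st (i + k) m_cross j \<circ>\<^sub>B X = (- inverse \<q>) *\<^sub>B X"
    by (rule alternatingD[OF "3.prems"(2), of k 0]) simp_all
  have S: "st (i + k) (S_mor (\<q> ^ Suc k)) j \<circ>\<^sub>B X = X"
    by (rule S_eigen[OF _ e S_den_nonzero]) (rule hom_cast[OF "3.prems"(1)], simp_all)
  have h: "st 0 (E (Suc k)) 1 \<in> m_hom (Suc (Suc k)) (Suc (Suc k))"
    "st k (S_mor (\<q> ^ Suc k)) 0 \<in> m_hom (Suc (Suc k)) (Suc (Suc k))"
    by (rule homs hom_E hom_S | simp)+
  have "st i (E (Suc (Suc k))) j \<circ>\<^sub>B X = st i (E (Suc k)) (1 + j) \<circ>\<^sub>B
      st (i + k) (S_mor (\<q> ^ Suc k)) j \<circ>\<^sub>B st i (E (Suc k)) (1 + j) \<circ>\<^sub>B X"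
    unfolding E_step by (simp add: st_comp_left[OF h] st_comp_left[OF hom_comp[OF h(2,1)] h(1)]
      st_comp_left[OF h(1) h(2)] del: E.simps power_Suc)
  then show ?case by (simp only: IH S)
qed

lemma lift2:
  assumes "f \<circ>\<^sub>B g = r" "f \<in> m_hom p p" "g \<in> m_hom p p"
  shows "st i f j \<circ>\<^sub>B st i g j \<circ>\<^sub>B X = st i r j \<circ>\<^sub>B X"
  using st_comp_left[OF assms(3,2), of i j X] assms(1) by simp

lemma lift3:
  assumes "f \<circ>\<^sub>B g \<circ>\<^sub>B h = r" "f \<in> m_hom p p" "g \<in> m_hom p p" "h \<in> m_hom p p"
  shows "st i f j \<circ>\<^sub>B st i g j \<circ>\<^sub>B st i h j \<circ>\<^sub>B X = st i r j \<circ>\<^sub>B X"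
  using lift2[OF assms(1) assms(2) hom_comp[OF assms(3,4)], of i j X]
    st_comp_left[OF assms(4,3), of i j X] by simp

text \<open>Two successive unfoldings of \<open>E\<close> produce exactly this product of two
  \<open>S_mor\<close> whose parameters differ by a factor q. With the values from
  \<open>S_step\<close>, the scalar conditions \<open>e1\<close>, \<open>e2\<close>,
  \<open>e3\<close> of \<open>three_strands\<close> become identities in q, z and their
  inverses.\<close>

lemma S_S_eigen:
  assumes X: "X \<in> m_hom m (n + 3)" and e: "st n m_cross 1 \<circ>\<^sub>B X = (- inverse \<q>) *\<^sub>B X"
    and y: "S_den y \<noteq> 0" "y \<noteq> 0"
  defines "Y \<equiv> st n (S_mor y) 1 \<circ>\<^sub>B st (n + 1) (S_mor (\<q> * y)) 0 \<circ>\<^sub>B X"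
  shows "st (n + 1) m_cross 0 \<circ>\<^sub>B Y = (- inverse \<q>) *\<^sub>B Y"
proof -
  have h: "st 0 m_cross 1 \<in> m_hom 3 3" "st 1 m_cross 0 \<in> m_hom 3 3"
    "st 0 m_cross_inv 1 \<in> m_hom 3 3" "st 1 m_cross_inv 0 \<in> m_hom 3 3"
    "st 0 m_hook 1 \<in> m_hom 3 3" "st 1 m_hook 0 \<in> m_hom 3 3"
    by (rule hom_st hom_cross hom_cross_inv hom_hook | simp)+
  have hn: "st n m_cross 1 \<in> m_hom (n + 3) (n + 3)" "st (n + 1) m_cross 0 \<in> m_hom (n + 3) (n + 3)"
    "st n m_cross_inv 1 \<in> m_hom (n + 3) (n + 3)" "st (n + 1) m_cross_inv 0 \<in> m_hom (n + 3) (n + 3)"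
    "st n m_hook 1 \<in> m_hom (n + 3) (n + 3)" "st (n + 1) m_hook 0 \<in> m_hom (n + 3) (n + 3)"
    by (rule hom_st hom_cross hom_cross_inv hom_hook | simp)+
  have X1: "X \<in> m_hom m (n + 2 + 1)" and X2: "X \<in> m_hom m (n + 1 + 2 + 0)"
    by (rule hom_cast[OF X]; simp)+
  note X3 = m_id_comp[OF X1] m_id_comp[OF X2]
  have hX: "st (n+1) m_cross 0 \<circ>\<^sub>B X \<in> m_hom m (n + 2 + 1)"
    "st (n+1) m_cross_inv 0 \<circ>\<^sub>B X \<in> m_hom m (n + 2 + 1)"
    by (rule hom_cast[OF hom_comp[OF hn(2) X]] hom_cast[OF hom_comp[OF hn(4) X]]; simp)+
  define x where "x = \<q> * y"
  define r where "r = inverse (S_den x) * qd"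
  define k where "k = kink"
  have inv: "\<q> * inverse \<q> = 1" "\<z> * inverse \<z> = 1" by simp_all
  have k: "k = inverse \<z> * inverse \<z> * \<q>" by (simp add: k_def power_int_minus power2_eq_square)
  have s: "S_A x = r * (\<z> + inverse \<z>)" "S_B x * (S_A y - qd * S_C y) = - r * inverse \<q> * \<z>"
    "S_C x * (S_A y + qd * S_B y) = - r * \<q> * inverse \<z>"
    using S_step[OF y] by (simp_all add: x_def r_def)
  have e0: "S_C x * S_B y * inverse \<q> = \<q> * S_B x * S_C y"
    using y(2) by (simp add: S_C_def S_B_def x_def field_simps)
  show ?thesis
  proof (rule three_strands)
    show "qd \<noteq> 0" by simp
    show "st n m_cross 1 \<circ>\<^sub>B X = (- inverse \<q>) *\<^sub>B X" by (fact e)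
    show "st n m_cross_inv 1 \<circ>\<^sub>B X = (- \<q>) *\<^sub>B X" by (rule cross_inv_eigen[OF X1 e])
    show "\<q> * inverse \<q> = 1" by simp
    show "S_A y - S_B y * inverse \<q> - S_C y * \<q> = 1" by (rule S_ABC[OF y])
    show "S_C x * S_B y * inverse \<q> = \<q> * S_B x * S_C y" by (fact e0)
    show "S_C x * (S_A y + qd * S_B y) = \<q> * k * S_B x * (S_A y - qd * S_C y)"
      using s k inv by algebra
    show "S_B x * (S_A y - qd * S_C y) * (1 - qd * k) + S_C x * (S_A y + qd * S_B y) = - inverse \<q> * S_A x"
      unfolding s k using inv by algebra
    show "S_A x + S_B x * (S_A y - qd * S_C y) * (qd + k) = - inverse \<q> * (S_B x * (S_A y - qd * S_C y))"
      unfolding s k using inv by algebra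
    show "Y = S_A y *\<^sub>B (st (n+1) (S_mor x) 0 \<circ>\<^sub>B X) +\<^sub>B
       (S_B y *\<^sub>B (st n m_cross 1 \<circ>\<^sub>B st (n+1) (S_mor x) 0 \<circ>\<^sub>B X) +\<^sub>B
        S_C y *\<^sub>B (st n m_cross_inv 1 \<circ>\<^sub>B st (n+1) (S_mor x) 0 \<circ>\<^sub>B X))"
    proof -
      have "st (n+1) (S_mor x) 0 \<circ>\<^sub>B X \<in> m_hom m (n + 2 + 1)"
        by (rule hom_comp[OF hom_st[OF hom_S] X]) simp_all
      then show ?thesis
        by (simp add: Y_def x_def[symmetric] S_mor_def[of y] st_add st_scale m_comp_add_left
          m_comp_scale_left m_id_comp)
    qed
    show "st (n+1) (S_mor x) 0 \<circ>\<^sub>B X = S_A x *\<^sub>B X +\<^sub>B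
       (S_B x *\<^sub>B (st (n+1) m_cross 0 \<circ>\<^sub>B X) +\<^sub>B S_C x *\<^sub>B (st (n+1) m_cross_inv 0 \<circ>\<^sub>B X))"
      using X3(2) by (simp add: S_mor_def st_add st_scale m_comp_add_left m_comp_scale_left)
    show "X \<in> m_hom m (n + 3)" by (fact X)
    show "st (n + 1) m_cross 0 \<circ>\<^sub>B st n m_cross 1 \<circ>\<^sub>B st (n + 1) m_cross 0 \<circ>\<^sub>B X =
        st n m_cross 1 \<circ>\<^sub>B st (n + 1) m_cross 0 \<circ>\<^sub>B st n m_cross 1 \<circ>\<^sub>B X"
      using lift3[OF reidemeister_3[symmetric] h(2,1,2), of n 0 X] lift3[OF HOL.refl h(1,2,1), of n 0 X] by simp
    show "st (n + 1) m_cross 0 \<circ>\<^sub>B st n m_cross_inv 1 \<circ>\<^sub>B st (n + 1) m_cross_inv 0 \<circ>\<^sub>B X =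
        st n m_cross_inv 1 \<circ>\<^sub>B st (n + 1) m_cross_inv 0 \<circ>\<^sub>B st n m_cross 1 \<circ>\<^sub>B X"
      using lift3[OF three_strands_reidemeister_inv h(2,3,4), of n 0 X] lift3[OF HOL.refl h(3,4,1), of n 0 X] by simp
    show "st n m_hook 1 \<circ>\<^sub>B st (n + 1) m_cross 0 \<circ>\<^sub>B st n m_cross 1 \<circ>\<^sub>B X =
        st n m_hook 1 \<circ>\<^sub>B st (n + 1) m_hook 0 \<circ>\<^sub>B X"
      using lift3[OF three_strands_hook(1) h(5,2,1), of n 0 X] lift2[OF HOL.refl h(5,6), of n 0 X] by simp
    show "st n m_hook 1 \<circ>\<^sub>B st (n + 1) m_cross_inv 0 \<circ>\<^sub>B st n m_cross_inv 1 \<circ>\<^sub>B X =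
        st n m_hook 1 \<circ>\<^sub>B st (n + 1) m_hook 0 \<circ>\<^sub>B X"
      using lift3[OF three_strands_hook(2) h(5,4,3), of n 0 X] lift2[OF HOL.refl h(5,6), of n 0 X] by simp
    show "st (n + 1) m_cross 0 \<circ>\<^sub>B st n m_hook 1 \<circ>\<^sub>B st (n + 1) m_hook 0 \<circ>\<^sub>B X =
        st n m_cross_inv 1 \<circ>\<^sub>B st (n + 1) m_hook 0 \<circ>\<^sub>B X"
      using lift3[OF three_strands_hook(3) h(2,5,6), of n 0 X] lift2[OF HOL.refl h(3,6), of n 0 X] by simp
    show "st n m_cross 1 \<circ>\<^sub>B st (n + 1) m_cross_inv 0 \<circ>\<^sub>B X =
        (st n m_cross_inv 1 \<circ>\<^sub>B st (n + 1) m_cross_inv 0 \<circ>\<^sub>B X) +\<^sub>B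
        (qd *\<^sub>B (st (n + 1) m_cross_inv 0 \<circ>\<^sub>B X) +\<^sub>B
         (- qd) *\<^sub>B (st n m_hook 1 \<circ>\<^sub>B st (n + 1) m_cross_inv 0 \<circ>\<^sub>B X))"
      by (subst cross_eq) (simp only: st_add st_scale m_comp_add_left m_comp_scale_left st_id m_id_comp[OF hX(2)])
    show "st n m_cross_inv 1 \<circ>\<^sub>B st (n + 1) m_cross 0 \<circ>\<^sub>B X =
        (st n m_cross 1 \<circ>\<^sub>B st (n + 1) m_cross 0 \<circ>\<^sub>B X) +\<^sub>B
        ((- qd) *\<^sub>B (st (n + 1) m_cross 0 \<circ>\<^sub>B X) +\<^sub>B
         qd *\<^sub>B (st n m_hook 1 \<circ>\<^sub>B st (n + 1) m_cross 0 \<circ>\<^sub>B X))"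
      by (subst cross_inv_eq) (simp only: st_add st_scale m_comp_add_left m_comp_scale_left st_id m_id_comp[OF hX(1)])
    show "st (n + 1) m_hook 0 \<circ>\<^sub>B X = X +\<^sub>B ((- inverse qd) *\<^sub>B (st (n + 1) m_cross 0 \<circ>\<^sub>B X) +\<^sub>B
        inverse qd *\<^sub>B (st (n + 1) m_cross_inv 0 \<circ>\<^sub>B X))"
      by (subst hook_eq) (simp only: st_add st_scale m_comp_add_left m_comp_scale_left st_id X3)
    show "st (n + 1) m_cross 0 \<circ>\<^sub>B st (n + 1) m_cross_inv 0 \<circ>\<^sub>B X = X"
      using lift2[OF reidemeister_2 hom_cross hom_cross_inv, of "n+1" 0 X] X3 by simp
    show "st (n + 1) m_cross 0 \<circ>\<^sub>B st (n + 1) m_cross 0 \<circ>\<^sub>B X =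
       (1 - qd * k) *\<^sub>B X +\<^sub>B ((qd + k) *\<^sub>B (st (n + 1) m_cross 0 \<circ>\<^sub>B X) +\<^sub>B
        (- k) *\<^sub>B (st (n + 1) m_cross_inv 0 \<circ>\<^sub>B X))"
      unfolding k_def
      by (simp only: lift2[OF m_cross_square hom_cross hom_cross] st_add st_scale m_comp_add_left m_comp_scale_left st_id X3)
  qed (fact hn)+
qed

text \<open>Every crossing but the last meets the left factor E(p-1) and is covered by induction.
  For the last one, E(p-2) is pulled out to the left, where it commutes with the crossing, and
  \<open>S_S_eigen\<close> applies to what remains.\<close>

lemma E_alternating: "alternating 0 p 0 (E p)"
proof (induction p rule: less_induct)
  case (less p)
  have "st k m_cross l \<circ>\<^sub>B E p = (- inverse \<q>) *\<^sub>B E p" if kl: "k + 2 + l = p" for k l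
  proof -
    obtain m where p: "p = Suc (Suc m)" using kl by (metis add_2_eq_Suc add_Suc add_2_eq_Suc')
    have h: "st 0 (E (Suc m)) 1 \<in> m_hom (Suc (Suc m)) (Suc (Suc m))"
      by (rule homs hom_E hom_S | simp)+
    show ?thesis
    proof (cases l)
      case (Suc l')
      have "alternating (0 + 0) (Suc m) (0 + 1) (st 0 (E (Suc m)) 1)"
        by (rule alternating_st[OF less(1) hom_cast[OF hom_E HOL.refl]]) (simp_all add: p)
      then have "st k m_cross l \<circ>\<^sub>B st 0 (E (Suc m)) 1 = (- inverse \<q>) *\<^sub>B st 0 (E (Suc m)) 1"
        by (rule alternatingD[of _ _ _ _ k l']) (use kl p Suc in simp_all)
      then show ?thesis
        unfolding p E_step by (simp only: m_comp_assoc[symmetric] m_comp_scale_left)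
    next
      case 0
      then have k: "k = m" using kl p by simp
      show ?thesis
      proof (cases m)
        case 0
        then show ?thesis using cross_S
          by (simp add: p k \<open>l = 0\<close> E_2 numeral_2_eq_2[symmetric])
      next
        case (Suc n)
        define X where "X = st 0 (E (Suc m)) 1"
        define E1 where "E1 = st 0 (E (Suc n)) 2"
        have hX: "X \<in> m_hom (n + 3) (n + 3)" using h by (simp add: X_def Suc numeral_3_eq_3)
        have hX': "X \<in> m_hom (n + 3) (0 + Suc n + 2)" using hX by (simp add: numeral_3_eq_3 numeral_2_eq_2)
        have E1: "E1 \<in> m_hom (n + 3) (n + 3)" unfolding E1_def
          by (rule homs hom_E hom_S | simp)+
        have aX: "alternating 0 (Suc m) 1 X"
          using alternating_st[OF less(1)[of "Suc m"] hom_cast[OF hom_E HOL.refl], of 0 1]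
          by (simp add: p X_def)
        have E1X: "E1 \<circ>\<^sub>B X = X" unfolding E1_def
        proof (rule E_absorb[OF hX'], unfold alternating_def, intro allI impI)
          fix k l assume "k + 2 + l = Suc n"
          then show "st (0 + k) m_cross (l + 2) \<circ>\<^sub>B X = (- inverse \<q>) *\<^sub>B X"
            by (intro alternatingD[OF aX, of k "l + 1"]) (auto simp: Suc)
        qed
        have e: "st n m_cross 1 \<circ>\<^sub>B X = (- inverse \<q>) *\<^sub>B X"
          by (rule alternatingD[OF aX, of n 0]) (simp_all add: Suc)
        define Y where "Y = st n (S_mor (\<q> ^ Suc n)) 1 \<circ>\<^sub>B st (n + 1) (S_mor (\<q> * \<q> ^ Suc n)) 0 \<circ>\<^sub>B X"
        have hY: "Y \<in> m_hom (n + 3) (n + 3)" unfolding Y_def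
          by (intro hom_comp[where q = "n + 3"] hom_st[OF hom_S] hX) simp_all
        have Y: "st (n + 1) m_cross 0 \<circ>\<^sub>B Y = (- inverse \<q>) *\<^sub>B Y"
          unfolding Y_def by (rule S_S_eigen[OF hX e S_den_nonzero]) simp
        have c1: "E1 \<circ>\<^sub>B st (n + 1) (S_mor (\<q> * \<q> ^ Suc n)) 0 = st (n + 1) (S_mor (\<q> * \<q> ^ Suc n)) 0 \<circ>\<^sub>B E1"
          unfolding E1_def by (rule st_commute[OF hom_E hom_S, symmetric]) simp_all
        have c2: "E1 \<circ>\<^sub>B st (n + 1) m_cross 0 = st (n + 1) m_cross 0 \<circ>\<^sub>B E1"
          unfolding E1_def by (rule st_commute[OF hom_E hom_cross, symmetric]) simp_all
        have X_eq: "X = E1 \<circ>\<^sub>B st n (S_mor (\<q> ^ Suc n)) 1 \<circ>\<^sub>B E1"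
        proof -
          have h': "st 0 (E (Suc n)) 1 \<in> m_hom (Suc (Suc n)) (Suc (Suc n))"
            "st n (S_mor (\<q> ^ Suc n)) 0 \<in> m_hom (Suc (Suc n)) (Suc (Suc n))"
            by (rule homs hom_E hom_S | simp)+
          show ?thesis
            unfolding X_def E1_def Suc E_step
            by (simp add: st_comp[OF h'] st_comp[OF hom_comp[OF h'(2,1)] h'(1)] del: E.simps power_Suc)
        qed
        have "E p = X \<circ>\<^sub>B st (n + 1) (S_mor (\<q> * \<q> ^ Suc n)) 0 \<circ>\<^sub>B X"
          unfolding p E_step X_def Suc power_Suc by (simp only: Suc_eq_plus1)
        \<comment> \<open>Only the left \<open>X\<close> is unfolded; its inner \<open>E1\<close>
          then passes the second \<open>S_mor\<close> and is absorbed by the right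
          \<open>X\<close>.\<close>
        also have "\<dots> = E1 \<circ>\<^sub>B st n (S_mor (\<q> ^ Suc n)) 1 \<circ>\<^sub>B (E1 \<circ>\<^sub>B st (n + 1) (S_mor (\<q> * \<q> ^ Suc n)) 0) \<circ>\<^sub>B X"
          by (subst (1) X_eq) (simp only: m_comp_assoc)
        also have "\<dots> = E1 \<circ>\<^sub>B Y"
          by (simp only: c1 m_comp_assoc E1X Y_def)
        finally have Ep: "E p = E1 \<circ>\<^sub>B Y" .
        have "st k m_cross l \<circ>\<^sub>B E p = (E1 \<circ>\<^sub>B st (n + 1) m_cross 0) \<circ>\<^sub>B Y"
          by (simp only: c2 Ep m_comp_assoc k Suc 0 Suc_eq_plus1)
        also have "\<dots> = (- inverse \<q>) *\<^sub>B E p"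
          by (simp only: m_comp_assoc Y Ep m_comp_scale_right)
        finally show ?thesis .
      qed
    qed
  qed
  then show ?case by (simp add: alternating_def)
qed

section \<open>Reflections of tangles\<close>

text \<open>A half turn about the vertical axis rather than a planar reflection: the order of the
  strands is reversed while crossings keep their sign.\<close>

primrec mirror :: "tangle_expr \<Rightarrow> tangle_expr" where
  "mirror (TId p) = TId p"
| "mirror TCap = TCap"
| "mirror TCup = TCup"
| "mirror TCross = TCross"
| "mirror TCrossInv = TCrossInv"
| "mirror (TComp g f) = TComp (mirror g) (mirror f)"
| "mirror (TTens f g) = TTens (mirror g) (mirror f)"
| "mirror (TZero p q) = TZero p q"
| "mirror (TAdd f g) = TAdd (mirror f) (mirror g)"
| "mirror (TScale a f) = TScale a (mirror f)"

text \<open>A half turn about the horizontal axis of the page, which exchanges inputs and outputs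
  and again keeps crossings.\<close>

primrec flip :: "tangle_expr \<Rightarrow> tangle_expr" where
  "flip (TId p) = TId p"
| "flip TCap = TCup"
| "flip TCup = TCap"
| "flip TCross = TCross"
| "flip TCrossInv = TCrossInv"
| "flip (TComp g f) = TComp (flip f) (flip g)"
| "flip (TTens f g) = TTens (flip f) (flip g)"
| "flip (TZero p q) = TZero q p"
| "flip (TAdd f g) = TAdd (flip f) (flip g)"
| "flip (TScale a f) = TScale a (flip f)"

lemma tangle_mirror: "tangle p q f \<Longrightarrow> tangle p q (mirror f)"
proof (induction rule: tangle.induct)
  case (7 p q f p' q' g)
  then have "tangle (p' + p) (q' + q) (mirror (TTens f g))" by (simp add: tangle.intros)
  then show ?case by (simp only: add.commute)
qed (auto intro: tangle.intros)

lemma tangle_flip: "tangle p q f \<Longrightarrow> tangle q p (flip f)"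
  by (induction rule: tangle.induct) (auto intro: tangle.intros)

lemma mirror_mirror [simp]: "mirror (mirror f) = f"
  by (induction f) simp_all

lemma flip_flip [simp]: "flip (flip f) = f"
  by (induction f) simp_all

lemma tens_id_swap: "TTens (TId q) (TId p) \<approx> TId (p + q)"
  using tangle_eq.tens_id[of q p] by (simp add: add.commute)

lemma mirror_cong: "f \<approx> g \<Longrightarrow> mirror f \<approx> mirror g"
proof (induction rule: tangle_eq.induct)
  case (sym f g)
  then show ?case using tangle_eq.sym by simp
next
  case (trans f g h)
  then show ?case using tangle_eq.trans by blast
qed (simp_all only: mirror.simps,
     (rule tangle_eq.refl tangle_eq.cong_comp tangle_eq.cong_tens tangle_eq.cong_add
       tangle_eq.cong_scale tangle_eq.add_assoc tangle_eq.add_commute tangle_eq.add_zero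
       tangle_eq.add_inverse tangle_eq.scale_add tangle_eq.add_scale tangle_eq.scale_scale
       tangle_eq.one_scale tangle_eq.comp_id tangle_eq.id_comp tangle_eq.comp_assoc
       tangle_eq.comp_add_left tangle_eq.comp_add_right tangle_eq.comp_scale_left
       tangle_eq.comp_scale_right tens_id_swap tangle_eq.tens_assoc[THEN tangle_eq.sym]
       tangle_eq.tens_unit tangle_eq.unit_tens tangle_eq.interchange tangle_eq.tens_add_left
       tangle_eq.tens_add_right tangle_eq.tens_scale_left tangle_eq.tens_scale_right
       tangle_eq.zigzag_left tangle_eq.zigzag_right tangle_eq.reidemeister_1[THEN tangle_eq.sym]
       tangle_eq.reidemeister_2 tangle_eq.reidemeister_2'
       tangle_eq.reidemeister_3[THEN tangle_eq.sym]
       tangle_eq.cap_slide[THEN tangle_eq.sym] tangle_eq.cap_slide'[THEN tangle_eq.sym]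
       tangle_eq.cup_slide[THEN tangle_eq.sym] tangle_eq.cup_slide'[THEN tangle_eq.sym]
       tangle_eq.skein_loop tangle_eq.skein_kink tangle_eq.skein_kink' tangle_eq.skein_cross;
      (assumption | rule tangle_mirror, assumption)?)+)

lemma cup_cap_cross_inv: "m_hook \<circ>\<^sub>B m_cross_inv = kink' *\<^sub>B m_hook"
  by (simp add: m_comp_assoc cap_cross_inv m_comp_scale_right)

text \<open>The flip of a kink on a cup is a kink on a cap. This is not one of the generating
  relations and has to be supplied for \<open>flip_cong\<close>.\<close>

lemma skein_kink_flip:
  "TComp (TComp TCup TCap) TCross \<approx> TScale (\<z> powi (-2) * \<q>) (TComp TCup TCap)"
  "TComp (TComp TCup TCap) TCrossInv \<approx> TScale (\<z>\<^sup>2 * inverse \<q>) (TComp TCup TCap)"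
  using cup_cap_cross cup_cap_cross_inv
  by (simp_all add: m_cup_def m_cap_def m_cross_def m_cross_inv_def m_comp.abs_eq m_scale.abs_eq
      mor.abs_eq_iff)

lemma reidemeister_1_flip: 
  "TComp (TComp (TTens (TId 1) TCap) (TTens TCross (TId 1))) (TTens (TId 1) TCup)
    \<approx> TComp (TComp (TTens TCap (TId 1)) (TTens (TId 1) TCross)) (TTens TCup (TId 1))"
  by (blast intro: tangle_eq.trans tangle_eq.comp_assoc tangle_eq.sym tangle_eq.reidemeister_1)

lemma reidemeister_3_flip: 
  "TComp (TComp (TTens TCross (TId 1)) (TTens (TId 1) TCross)) (TTens TCross (TId 1))
    \<approx> TComp (TComp (TTens (TId 1) TCross) (TTens TCross (TId 1))) (TTens (TId 1) TCross)"
  by (blast intro: tangle_eq.trans tangle_eq.comp_assoc tangle_eq.sym tangle_eq.reidemeister_3)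

lemma flip_cong: "f \<approx> g \<Longrightarrow> flip f \<approx> flip g"
proof (induction rule: tangle_eq.induct)
  case (sym f g)
  then show ?case using tangle_eq.sym by simp
next
  case (trans f g h)
  then show ?case using tangle_eq.trans by blast
qed (simp_all only: flip.simps,
     (rule tangle_eq.refl tangle_eq.cong_comp tangle_eq.cong_tens tangle_eq.cong_add
       tangle_eq.cong_scale tangle_eq.add_assoc tangle_eq.add_commute tangle_eq.add_zero
       tangle_eq.add_inverse tangle_eq.scale_add tangle_eq.add_scale tangle_eq.scale_scale
       tangle_eq.one_scale tangle_eq.comp_id tangle_eq.id_comp
       tangle_eq.comp_assoc[THEN tangle_eq.sym]
       tangle_eq.comp_add_left tangle_eq.comp_add_right tangle_eq.comp_scale_left
       tangle_eq.comp_scale_right tangle_eq.tens_id tangle_eq.tens_assoc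
       tangle_eq.tens_unit tangle_eq.unit_tens tangle_eq.interchange tangle_eq.tens_add_left
       tangle_eq.tens_add_right tangle_eq.tens_scale_left tangle_eq.tens_scale_right
       tangle_eq.zigzag_left tangle_eq.zigzag_right reidemeister_1_flip
       tangle_eq.reidemeister_2 tangle_eq.reidemeister_2' reidemeister_3_flip
       tangle_eq.cap_slide tangle_eq.cap_slide' tangle_eq.cup_slide tangle_eq.cup_slide'
       tangle_eq.skein_loop skein_kink_flip tangle_eq.skein_cross;
      (assumption | rule tangle_flip, assumption)?)+)

lift_definition m_mirror :: "mor \<Rightarrow> mor" is mirror by (rule mirror_cong)
lift_definition m_flip :: "mor \<Rightarrow> mor" is flip by (rule flip_cong)

lemma m_mirror_simps [simp]:
  "m_mirror (m_id p) = m_id p" "m_mirror m_cap = m_cap" "m_mirror m_cup = m_cup"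
  "m_mirror m_cross = m_cross" "m_mirror m_cross_inv = m_cross_inv"
  "m_mirror (g \<circ>\<^sub>B f) = m_mirror g \<circ>\<^sub>B m_mirror f" "m_mirror (f \<otimes>\<^sub>B g) = m_mirror g \<otimes>\<^sub>B m_mirror f"
  "m_mirror (f +\<^sub>B g) = m_mirror f +\<^sub>B m_mirror g" "m_mirror (a *\<^sub>B f) = a *\<^sub>B m_mirror f"
  "m_mirror (m_mirror f) = f"
  by (transfer, simp add: tangle_eq.refl)+

lemma m_flip_simps [simp]:
  "m_flip (m_id p) = m_id p" "m_flip m_cap = m_cup" "m_flip m_cup = m_cap"
  "m_flip m_cross = m_cross" "m_flip m_cross_inv = m_cross_inv"
  "m_flip (g \<circ>\<^sub>B f) = m_flip f \<circ>\<^sub>B m_flip g" "m_flip (f \<otimes>\<^sub>B g) = m_flip f \<otimes>\<^sub>B m_flip g"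
  "m_flip (f +\<^sub>B g) = m_flip f +\<^sub>B m_flip g" "m_flip (a *\<^sub>B f) = a *\<^sub>B m_flip f"
  "m_flip (m_flip f) = f"
  by (transfer, simp add: tangle_eq.refl)+

lemma m_mirror_st [simp]: "m_mirror (st i f j) = st j (m_mirror f) i"
  by (simp add: st_def m_tens_assoc)
lemma m_flip_st [simp]: "m_flip (st i f j) = st i (m_flip f) j"
  by (simp add: st_def)

lemma hom_mirror: "f \<in> m_hom p q \<Longrightarrow> m_mirror f \<in> m_hom p q"
  by (elim m_homE) (simp add: m_mirror.abs_eq m_homI tangle_mirror)
lemma hom_flip: "f \<in> m_hom p q \<Longrightarrow> m_flip f \<in> m_hom q p"
  by (elim m_homE) (simp add: m_flip.abs_eq m_homI tangle_flip)

text \<open>The recursion for \<open>E\<close> is palindromic, and the flip fixes identities and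
  both crossings, hence \<open>S_mor\<close>.\<close>

lemma m_flip_E: "m_flip (E p) = E p"
proof (induction p rule: E.induct)
  case (3 k)
  then show ?case unfolding E_step by (simp add: S_mor_def m_comp_assoc del: E.simps)
qed simp_all

lemma E_cross: 
  assumes "k + 2 + l = p"
  shows "st k m_cross l \<circ>\<^sub>B E p = (- inverse \<q>) *\<^sub>B E p" "E p \<circ>\<^sub>B st k m_cross l = (- inverse \<q>) *\<^sub>B E p"
proof -
  show 1: "st k m_cross l \<circ>\<^sub>B E p = (- inverse \<q>) *\<^sub>B E p"
    by (rule alternatingD[OF E_alternating assms]) simp_all
  from arg_cong[OF 1, of m_flip]
  show "E p \<circ>\<^sub>B st k m_cross l = (- inverse \<q>) *\<^sub>B E p" by (simp add: m_flip_E)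
qed

text \<open>The recursion singles out the last strand, so this symmetry cannot be read off. It
  follows from uniqueness: \<open>E p\<close> and its mirror image are alternating on both sides, so
  their product equals either of them.\<close>

lemma m_mirror_E: "m_mirror (E p) = E p"
proof -
  have 1: "st k m_cross l \<circ>\<^sub>B m_mirror (E p) = (- inverse \<q>) *\<^sub>B m_mirror (E p)" 
    "m_mirror (E p) \<circ>\<^sub>B st k m_cross l = (- inverse \<q>) *\<^sub>B m_mirror (E p)" 
    if "k + 2 + l = p" for k l
    using arg_cong[OF E_cross(1)[of l k p], of m_mirror] arg_cong[OF E_cross(2)[of l k p], of m_mirror]
      that by (simp_all add: add.commute add.left_commute)
  have h: "m_mirror (E p) \<in> m_hom p p" by (rule hom_mirror[OF hom_E])
  have "st 0 (E p) 0 \<circ>\<^sub>B m_mirror (E p) = m_mirror (E p)"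
    by (rule E_absorb[of _ p]) (use h 1 in \<open>simp_all add: alternating_def\<close>)
  then have "m_mirror (E p \<circ>\<^sub>B m_mirror (E p)) = m_mirror (m_mirror (E p))" by simp
  then have 2: "m_mirror (E p) \<circ>\<^sub>B E p = E p" by simp
  have 3: "st k m_cross l \<circ>\<^sub>B m_flip (m_mirror (E p)) = (- inverse \<q>) *\<^sub>B m_flip (m_mirror (E p))" 
    if "k + 2 + l = p" for k l
    using arg_cong[OF 1(2)[OF that], of m_flip] by simp
  have "st 0 (E p) 0 \<circ>\<^sub>B m_flip (m_mirror (E p)) = m_flip (m_mirror (E p))"
    by (rule E_absorb[of _ p]) (use hom_flip[OF h] 3 in \<open>simp_all add: alternating_def\<close>)
  then have "m_flip (E p \<circ>\<^sub>B m_flip (m_mirror (E p))) = m_flip (m_flip (m_mirror (E p)))" by simp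
  then have "m_mirror (E p) \<circ>\<^sub>B E p = m_mirror (E p)" by (simp add: m_flip_E)
  with 2 show ?thesis by simp
qed

section \<open>Chords\<close>

lemmas nat_norm = One_nat_def numeral_2_eq_2 numeral_3_eq_3

section \<open>Braiding one strand past several\<close>

lemma hom_braid_one: "braid_one b \<in> m_hom (Suc b) (Suc b)"
proof (induction b)
  case 0
  then show ?case using hom_id[of 1 1] by (simp add: nat_norm)
next
  case (Suc b)
  have "st b m_cross 0 \<circ>\<^sub>B st 0 (braid_one b) 1 \<in> m_hom (Suc (Suc b)) (Suc (Suc b))"
    by (rule hom_comp[OF hom_st[OF hom_cross] hom_st[OF Suc]]) simp_all
  then show ?case by (simp add: st_def)
qed

lemma braid_one_Suc: "braid_one (Suc b) = st b m_cross 0 \<circ>\<^sub>B st 0 (braid_one b) 1"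
  by (simp add: st_def)

lemma braid_one_add: "braid_one (m + n) = st m (braid_one n) 0 \<circ>\<^sub>B st 0 (braid_one m) n"
proof (induction n)
  case 0
  have "m_id (m + 1 + 0) \<circ>\<^sub>B braid_one m = braid_one m"
    by (rule m_id_comp[OF hom_cast[OF hom_braid_one]]) simp_all
  then show ?case by (simp only: braid_one.simps st_id st_0 add_0_right)
next
  case (Suc n)
  have h: "st m (braid_one n) 0 \<in> m_hom (Suc (m + n)) (Suc (m + n))"
    "st 0 (braid_one m) n \<in> m_hom (Suc (m + n)) (Suc (m + n))"
    by (rule hom_st[OF hom_braid_one]; simp)+
  have h': "st n m_cross 0 \<in> m_hom (Suc (Suc n)) (Suc (Suc n))"
    "st 0 (braid_one n) 1 \<in> m_hom (Suc (Suc n)) (Suc (Suc n))"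
    by (rule hom_st[OF hom_braid_one] hom_st[OF hom_cross]; simp)+
  have "braid_one (m + Suc n) = st (m + n) m_cross 0 \<circ>\<^sub>B st 0 (braid_one (m + n)) 1"
    by (simp only: braid_one_Suc add_Suc_right)
  also have "\<dots> = st (m + n) m_cross 0 \<circ>\<^sub>B st m (braid_one n) 1 \<circ>\<^sub>B st 0 (braid_one m) (n + 1)"
    by (simp only: Suc st_comp[OF h(2,1)] st_st add_0 add_0_right)
  also have "\<dots> = st m (braid_one (Suc n)) 0 \<circ>\<^sub>B st 0 (braid_one m) (Suc n)"
    by (simp only: braid_one_Suc st_comp[OF h'(2,1)] st_st m_comp_assoc add_0_right) (simp add: nat_norm)
  finally show ?case .
qed

lemma cross_braid_one_2:
  "st 0 m_cross 1 \<circ>\<^sub>B braid_one 2 = braid_one 2 \<circ>\<^sub>B st 1 m_cross 0"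
proof -
  have h: "st 0 m_cross 1 \<in> m_hom 3 (1 + 1 + 1)" by (rule hom_st[OF hom_cross]) simp_all
  have "(0::nat) + 1 + 1 = 2" by simp
  then have "braid_one 1 = m_cross"
    by (simp only: One_nat_def braid_one_Suc braid_one.simps(1))
      (simp only: One_nat_def[symmetric] st_id st_0 m_comp_id[OF hom_cross])
  then have "braid_one 2 = st 1 m_cross 0 \<circ>\<^sub>B st 0 m_cross 1"
    using braid_one_Suc[of 1] by (simp only: Suc_1)
  then show ?thesis by (simp only: m_comp_assoc reidemeister_3)
qed

lemma st_eq_comp:
  assumes "f \<circ>\<^sub>B g = f' \<circ>\<^sub>B g'" "g \<in> m_hom p q" "f \<in> m_hom q r" "g' \<in> m_hom p q'" "f' \<in> m_hom q' r"
  shows "st i f j \<circ>\<^sub>B st i g j = st i f' j \<circ>\<^sub>B st i g' j"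
  using st_comp[OF assms(2,3)] st_comp[OF assms(4,5)] assms(1) by metis

text \<open>Splitting \<open>braid_one b\<close> around the two strands of the crossing leaves
  \<open>braid_one 2\<close>, where the claim is the third Reidemeister move; the outer pieces
  commute with the crossing.\<close>

lemma cross_braid_one:
  assumes b: "b = k + (2 + l)"
  shows "st k m_cross (l + 1) \<circ>\<^sub>B braid_one b = braid_one b \<circ>\<^sub>B st (k + 1) m_cross l"
proof -
  have e: "braid_one b = st (k + 2) (braid_one l) 0 \<circ>\<^sub>B st k (braid_one 2) l \<circ>\<^sub>B st 0 (braid_one k) (2 + l)"
  proof -
    have h: "st 2 (braid_one l) 0 \<in> m_hom (Suc (2 + l)) (Suc (2 + l))"
      "st 0 (braid_one 2) l \<in> m_hom (Suc (2 + l)) (Suc (2 + l))"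
      by (rule hom_st[OF hom_braid_one]; simp)+
    show ?thesis
      by (simp only: b braid_one_add[of k] braid_one_add[of 2] st_comp[OF h(2,1)] st_st m_comp_assoc
        add_0_right)
  qed
  have c1: "st k m_cross (l + 1) \<circ>\<^sub>B st (k + 2) (braid_one l) 0 =
      st (k + 2) (braid_one l) 0 \<circ>\<^sub>B st k m_cross (l + 1)"
    by (rule st_commute[OF hom_cross hom_braid_one, where k = 0, symmetric]) simp_all
  have c2: "st (k + 1) m_cross l \<circ>\<^sub>B st 0 (braid_one k) (2 + l) =
      st 0 (braid_one k) (2 + l) \<circ>\<^sub>B st (k + 1) m_cross l"
    by (rule st_commute[OF hom_braid_one hom_cross, where k = 0]) simp_all
  have h3: "st 0 m_cross 1 \<in> m_hom 3 3" "st 1 m_cross 0 \<in> m_hom 3 3" "braid_one 2 \<in> m_hom 3 3"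
    by (rule hom_st[OF hom_cross] | simp | rule hom_cast[OF hom_braid_one])+
  have c3: "st k m_cross (l + 1) \<circ>\<^sub>B st k (braid_one 2) l = st k (braid_one 2) l \<circ>\<^sub>B st (k + 1) m_cross l"
    using st_eq_comp[OF cross_braid_one_2 h3(3,1,2,3), of k l] by (simp add: nat_norm)
  have "st k m_cross (l + 1) \<circ>\<^sub>B braid_one b =
     (st k m_cross (l + 1) \<circ>\<^sub>B st (k + 2) (braid_one l) 0) \<circ>\<^sub>B st k (braid_one 2) l \<circ>\<^sub>B st 0 (braid_one k) (2 + l)"
    by (simp only: e m_comp_assoc)
  also have "\<dots> = st (k + 2) (braid_one l) 0 \<circ>\<^sub>B (st k m_cross (l + 1) \<circ>\<^sub>B st k (braid_one 2) l)
      \<circ>\<^sub>B st 0 (braid_one k) (2 + l)"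
    by (simp only: c1 m_comp_assoc)
  also have "\<dots> = st (k + 2) (braid_one l) 0 \<circ>\<^sub>B st k (braid_one 2) l \<circ>\<^sub>B
      (st (k + 1) m_cross l \<circ>\<^sub>B st 0 (braid_one k) (2 + l))"
    by (simp only: c3 m_comp_assoc)
  also have "\<dots> = braid_one b \<circ>\<^sub>B st (k + 1) m_cross l"
    by (simp only: c2 e m_comp_assoc)
  finally show ?thesis .
qed

text \<open>A cup whose right leg crosses the \<open>b\<close> strands beside it; \<open>chords a b j X\<close> nests \<open>a\<close> of them around
  the first \<open>b\<close> strands of \<open>X\<close>, the innermost one added last.\<close>

definition chord :: "nat \<Rightarrow> mor" where
  "chord b = st 1 (braid_one b) 0 \<circ>\<^sub>B st 0 m_cup b"

lemma chord_0: "chord 0 = m_cup"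
proof -
  have "m_id (1 + 1 + 0) \<circ>\<^sub>B m_cup = m_cup" by (rule m_id_comp[OF hom_cast[OF hom_cup]]) simp_all
  then show ?thesis by (simp only: chord_def braid_one.simps st_id st_0)
qed

lemma hom_chord: "chord b \<in> m_hom b (b + 2)"
  unfolding chord_def by (rule hom_comp[OF hom_st[OF hom_braid_one] hom_st[OF hom_cup]]) simp_all

lemma cross_chord:
  assumes "b = k + (2 + l)"
  shows "st (k + 1) m_cross (l + 1) \<circ>\<^sub>B chord b = chord b \<circ>\<^sub>B st k m_cross l"
proof -
  have h: "st k m_cross (l + 1) \<in> m_hom (Suc b) (Suc b)" "st (k + 1) m_cross l \<in> m_hom (Suc b) (Suc b)"
    by (rule hom_st[OF hom_cross]; simp add: assms)+
  have c1: "st (k + 1) m_cross (l + 1) \<circ>\<^sub>B st 1 (braid_one b) 0 = st 1 (braid_one b) 0 \<circ>\<^sub>B st (k + 2) m_cross l"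
    using st_eq_comp[OF cross_braid_one[OF assms] hom_braid_one h(1,2) hom_braid_one, of 1 0]
    by (simp add: nat_norm)
  have c2: "st (k + 2) m_cross l \<circ>\<^sub>B st 0 m_cup b = st 0 m_cup b \<circ>\<^sub>B st k m_cross l"
    by (rule st_commute[OF hom_cup hom_cross, where k = k]) (simp_all add: assms)
  show ?thesis unfolding chord_def
    by (simp only: m_comp_assoc[symmetric] c1) (simp only: m_comp_assoc c2)
qed

lemma two_braids_Suc:
  "st 0 (braid_one (Suc b)) 1 \<circ>\<^sub>B st 1 (braid_one (Suc b)) 0 =
   st b m_cross 1 \<circ>\<^sub>B st (b + 1) m_cross 0 \<circ>\<^sub>B st 0 (braid_one b) 2 \<circ>\<^sub>B st 1 (braid_one b) 1"
proof -
  have h: "st b m_cross 0 \<in> m_hom (Suc (Suc b)) (Suc (Suc b))"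
    "st 0 (braid_one b) 1 \<in> m_hom (Suc (Suc b)) (Suc (Suc b))"
    by (rule hom_st[OF hom_cross] hom_st[OF hom_braid_one]; simp)+
  have c: "st (b + 1) m_cross 0 \<circ>\<^sub>B st 0 (braid_one b) 2 = st 0 (braid_one b) 2 \<circ>\<^sub>B st (b + 1) m_cross 0"
    by (rule st_commute[OF hom_braid_one hom_cross, where k = 0]) simp_all
  have "st 0 (braid_one (Suc b)) 1 = st b m_cross 1 \<circ>\<^sub>B st 0 (braid_one b) 2"
    "st 1 (braid_one (Suc b)) 0 = st (b + 1) m_cross 0 \<circ>\<^sub>B st 1 (braid_one b) 1"
    by (simp_all only: braid_one_Suc st_comp[OF h(2,1)] st_st) (simp_all add: nat_norm)
  then show ?thesis by (simp only: m_comp_assoc[symmetric]) (simp only: m_comp_assoc c)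
qed

text \<open>If the left leg of a chord is braided past the \<open>b\<close> strands as well, the
  whole cup has crossed them; \<open>cup_slide\<close> cancels the two crossings with each
  strand.\<close>

lemma braid_one_chord: "st 0 (braid_one b) 1 \<circ>\<^sub>B chord b = st b m_cup 0"
proof (induction b)
  case 0
  have "m_id 2 \<circ>\<^sub>B m_id 2 \<circ>\<^sub>B m_cup = m_cup" by (simp add: m_id_comp[OF hom_cup])
  moreover have "(0::nat) + 1 + 1 = 2" "(1::nat) + 1 + 0 = 2" by simp_all
  ultimately show ?case unfolding chord_def braid_one.simps st_id by (simp only: st_0)
next
  case (Suc b)
  have h: "st 1 (braid_one b) 0 \<in> m_hom (b + 2) (b + 2)" "st 0 (braid_one b) 1 \<in> m_hom (b + 2) (b + 2)"
    "st 0 m_cup b \<in> m_hom b (b + 2)"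
    by (rule hom_st[OF hom_cup] hom_st[OF hom_braid_one]; simp)+
  have "st 0 (braid_one b) 2 \<circ>\<^sub>B st 1 (braid_one b) 1 \<circ>\<^sub>B st 0 m_cup (Suc b)
      = st 0 (st 0 (braid_one b) 1 \<circ>\<^sub>B chord b) 1"
    by (simp add: st_comp[OF hom_chord h(2)], simp add: chord_def st_comp[OF h(3,1)], simp add: nat_norm)
  also have "\<dots> = st b m_cup 1" by (simp add: Suc)
  finally have 1: "st 0 (braid_one b) 2 \<circ>\<^sub>B st 1 (braid_one b) 1 \<circ>\<^sub>B st 0 m_cup (Suc b) = st b m_cup 1" .
  have c: "st 0 m_cross 1 \<circ>\<^sub>B st 1 m_cross 0 \<circ>\<^sub>B st 0 m_cup 1 = st 1 m_cup 0"
  proof -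
    have "st 0 m_cross 1 \<circ>\<^sub>B st 0 m_cross_inv 1 = m_id 3"
      by (simp add: st_comp[symmetric, OF hom_cross_inv hom_cross] reidemeister_2)
    moreover have "st 1 m_cup 0 \<in> m_hom 1 3" by (rule hom_st[OF hom_cup]) simp_all
    ultimately show ?thesis by (simp only: cup_slide m_comp_assoc[symmetric] m_id_comp)
  qed
  have hc: "st 0 m_cross 1 \<in> m_hom 3 3" "st 1 m_cross 0 \<in> m_hom 3 3" "st 0 m_cup 1 \<in> m_hom 1 3"
    by (rule hom_st[OF hom_cross] hom_st[OF hom_cup]; simp)+
  have c': "st b m_cross 1 \<circ>\<^sub>B st (b + 1) m_cross 0 \<circ>\<^sub>B st b m_cup 1 = st (b + 1) m_cup 0"
    using arg_cong[OF c, of "\<lambda>f. st b f 0"]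
    by (simp add: st_comp[OF hom_comp[OF hc(2,3)] hc(1)] st_comp[OF hc(3,2)])
  have "st 0 (braid_one (Suc b)) 1 \<circ>\<^sub>B chord (Suc b) =
     (st 0 (braid_one (Suc b)) 1 \<circ>\<^sub>B st 1 (braid_one (Suc b)) 0) \<circ>\<^sub>B st 0 m_cup (Suc b)"
    by (simp only: chord_def m_comp_assoc)
  also have "\<dots> = st (b + 1) m_cup 0"
    by (simp only: two_braids_Suc m_comp_assoc 1 c')
  finally show ?case by (simp only: Suc_eq_plus1)
qed

text \<open>Joining the left legs of two nested chords straightens them, by a zigzag, into one arc
  around the \<open>b\<close> strands; \<open>braid_one_chord\<close> pulls this arc off to their
  right.\<close>

lemma cap_chord_chord:
  "st 0 m_cap (b + 2) \<circ>\<^sub>B st 1 (chord b) 1 \<circ>\<^sub>B chord b = st b m_cup 0"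
proof -
  have h: "st 1 (braid_one b) 0 \<in> m_hom (b + 2) (b + 2)" "st 0 m_cup b \<in> m_hom b (b + 2)"
    by (rule hom_st[OF hom_cup] hom_st[OF hom_braid_one]; simp)+
  have e: "st 1 (chord b) 1 = st 2 (braid_one b) 1 \<circ>\<^sub>B st 1 m_cup (b + 1)"
    by (simp add: chord_def st_comp[OF h(2,1)])
  have c: "st 0 m_cap (b + 2) \<circ>\<^sub>B st 2 (braid_one b) 1 = st 0 (braid_one b) 1 \<circ>\<^sub>B st 0 m_cap (b + 2)"
    by (rule st_commute[OF hom_cap hom_braid_one, where k = 0, symmetric]) simp_all
  have hz: "st 0 m_cap 1 \<in> m_hom 3 1" "st 1 m_cup 0 \<in> m_hom 1 3"
    by (rule hom_st[OF hom_cap] hom_st[OF hom_cup]; simp)+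
  have z: "st 0 m_cap (b + 2) \<circ>\<^sub>B st 1 m_cup (b + 1) = m_id (b + 2)"
    using st_comp[OF hz(2,1), of 0 "b + 1"] by (simp add: zigzag_left, simp add: nat_norm)
  have "st 0 m_cap (b + 2) \<circ>\<^sub>B st 1 (chord b) 1 \<circ>\<^sub>B chord b
     = (st 0 m_cap (b + 2) \<circ>\<^sub>B st 2 (braid_one b) 1) \<circ>\<^sub>B st 1 m_cup (b + 1) \<circ>\<^sub>B chord b"
    by (simp only: e m_comp_assoc)
  also have "\<dots> = st 0 (braid_one b) 1 \<circ>\<^sub>B (st 0 m_cap (b + 2) \<circ>\<^sub>B st 1 m_cup (b + 1)) \<circ>\<^sub>B chord b"
    by (simp only: c m_comp_assoc)
  also have "\<dots> = st b m_cup 0"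
    by (simp only: z m_id_comp[OF hom_chord] braid_one_chord)
  finally show ?thesis .
qed

text \<open>Naturality of the braiding for a pair of parallel strands, with one third Reidemeister
  move for each strand passed.\<close>

lemma cross_two_braids:
  "st b m_cross 0 \<circ>\<^sub>B st 0 (braid_one b) 1 \<circ>\<^sub>B st 1 (braid_one b) 0 =
   (st 0 (braid_one b) 1 \<circ>\<^sub>B st 1 (braid_one b) 0) \<circ>\<^sub>B st 0 m_cross b"
proof (induction b)
  case 0
  have "m_id 2 \<circ>\<^sub>B m_id 2 = m_id 2" by (rule m_id_comp[OF hom_id[OF HOL.refl]])
  moreover have "(0::nat) + 1 + 1 = 2" "(1::nat) + 1 + 0 = 2" by simp_all
  ultimately show ?case unfolding braid_one.simps st_id
    by (simp only: st_0 m_comp_id[OF hom_cross] m_id_comp[OF hom_cross])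
next
  case (Suc b)
  have h: "st 1 (braid_one b) 0 \<in> m_hom (b + 2) (b + 2)" "st 0 (braid_one b) 1 \<in> m_hom (b + 2) (b + 2)"
    "st b m_cross 0 \<in> m_hom (b + 2) (b + 2)" "st 0 m_cross b \<in> m_hom (b + 2) (b + 2)"
    by (rule hom_st[OF hom_cross] hom_st[OF hom_braid_one]; simp)+
  have 1: "st b m_cross 1 \<circ>\<^sub>B st 0 (braid_one b) 2 \<circ>\<^sub>B st 1 (braid_one b) 1 =
     st 0 (braid_one b) 2 \<circ>\<^sub>B st 1 (braid_one b) 1 \<circ>\<^sub>B st 0 m_cross (Suc b)"
    using arg_cong[OF Suc, of "\<lambda>f. st 0 f 1"]
    by (simp add: st_comp[OF hom_comp[OF h(2,1)] h(3)] st_comp[OF h(1,2)]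
      st_comp[OF hom_comp[OF h(1,4)] h(2)] st_comp[OF h(4,1)] m_comp_assoc, simp add: nat_norm)
  have hc: "st 0 m_cross 1 \<in> m_hom 3 3" "st 1 m_cross 0 \<in> m_hom 3 3"
    by (rule hom_st[OF hom_cross]; simp)+
  have 2: "st (b + 1) m_cross 0 \<circ>\<^sub>B st b m_cross 1 \<circ>\<^sub>B st (b + 1) m_cross 0 \<circ>\<^sub>B f =
      st b m_cross 1 \<circ>\<^sub>B st (b + 1) m_cross 0 \<circ>\<^sub>B st b m_cross 1 \<circ>\<^sub>B f" for f
    using lift3[OF reidemeister_3[symmetric] hc(2,1,2), of b 0 f] lift3[OF HOL.refl hc(1,2,1), of b 0 f]
    by simp
  show ?case
    by (simp only: two_braids_Suc) (simp only: m_comp_assoc 2 1 Suc_eq_plus1)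
qed

text \<open>Both sides equal an inverse crossing between two cups standing side by side.\<close>

lemma cross_nested_cup_2:
  "st 0 m_cross 2 \<circ>\<^sub>B st 1 m_cup 1 \<circ>\<^sub>B m_cup = st 2 m_cross 0 \<circ>\<^sub>B st 1 m_cup 1 \<circ>\<^sub>B m_cup"
proof -
  have h: "st 0 m_cross 1 \<in> m_hom 3 3" "st 1 m_cross 0 \<in> m_hom 3 3"
    "st 0 m_cross_inv 1 \<in> m_hom 3 3" "st 1 m_cross_inv 0 \<in> m_hom 3 3"
    "st 0 m_cup 1 \<in> m_hom 1 3" "st 1 m_cup 0 \<in> m_hom 1 3"
    by (rule hom_st[OF hom_cross] hom_st[OF hom_cross_inv] hom_st[OF hom_cup]; simp)+
  have 1: "st 0 m_cross 2 \<circ>\<^sub>B st 1 m_cup 1 = st 1 m_cross_inv 1 \<circ>\<^sub>B st 0 m_cup 2"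
    using arg_cong[OF cup_slide', of "\<lambda>f. st 0 f 1"]
    by (simp add: st_comp[OF h(5,4)] st_comp[OF h(6,1)])
  have 2: "st 2 m_cross 0 \<circ>\<^sub>B st 1 m_cup 1 = st 1 m_cross_inv 1 \<circ>\<^sub>B st 2 m_cup 0"
    using arg_cong[OF cup_slide, of "\<lambda>f. st 1 f 0"]
    by (simp add: st_comp[OF h(5,2)] st_comp[OF h(6,3)])
  have 3: "st 2 m_cup 0 \<circ>\<^sub>B st 0 m_cup 0 = st 0 m_cup 2 \<circ>\<^sub>B st 0 m_cup 0"
    by (rule st_commute[OF hom_cup hom_cup, where k = 0]) simp_all
  have "st 0 m_cross 2 \<circ>\<^sub>B st 1 m_cup 1 \<circ>\<^sub>B m_cup = st 1 m_cross_inv 1 \<circ>\<^sub>B st 0 m_cup 2 \<circ>\<^sub>B m_cup"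
    using 1 by (metis m_comp_assoc)
  also have "\<dots> = st 1 m_cross_inv 1 \<circ>\<^sub>B st 2 m_cup 0 \<circ>\<^sub>B m_cup" using 3 by simp
  also have "\<dots> = st 2 m_cross 0 \<circ>\<^sub>B st 1 m_cup 1 \<circ>\<^sub>B m_cup" using 2 by (metis m_comp_assoc)
  finally show ?thesis .
qed

lemma cross_chord_chord:
  "st 0 m_cross (b + 2) \<circ>\<^sub>B st 1 (chord b) 1 \<circ>\<^sub>B chord b =
   st (b + 2) m_cross 0 \<circ>\<^sub>B st 1 (chord b) 1 \<circ>\<^sub>B chord b"
proof -
  have h: "st 1 (braid_one b) 0 \<in> m_hom (b + 2) (b + 2)" "st 0 m_cup b \<in> m_hom b (b + 2)"
    "st 0 (braid_one b) 1 \<in> m_hom (b + 2) (b + 2)" "st b m_cross 0 \<in> m_hom (b + 2) (b + 2)"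
    "st 0 m_cross b \<in> m_hom (b + 2) (b + 2)"
    by (rule hom_st[OF hom_cup] hom_st[OF hom_braid_one] hom_st[OF hom_cross]; simp)+
  define W where "W = st 0 (braid_one b) 1 \<circ>\<^sub>B st 1 (braid_one b) 0"
  define U where "U = st 1 m_cup 1 \<circ>\<^sub>B m_cup"
  have hW: "W \<in> m_hom (b + 2) (b + 2)" unfolding W_def by (rule hom_comp[OF h(3,1)])
  have hu: "st 1 m_cup 1 \<in> m_hom 2 4" "st 0 m_cross 2 \<in> m_hom 4 4" "st 2 m_cross 0 \<in> m_hom 4 4"
    by (rule hom_st[OF hom_cup] hom_st[OF hom_cross]; simp)+
  have hU: "U \<in> m_hom 0 4" unfolding U_def by (rule hom_comp[OF hu(1) hom_cup])
  have c: "st 1 m_cup (b + 1) \<circ>\<^sub>B st 1 (braid_one b) 0 = st 3 (braid_one b) 0 \<circ>\<^sub>B st 1 m_cup (b + 1)"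
    by (rule st_commute[OF hom_cup hom_braid_one, where k = 0, symmetric]) simp_all
  have "st 1 (chord b) 1 \<circ>\<^sub>B chord b = st 2 (braid_one b) 1 \<circ>\<^sub>B (st 1 m_cup (b + 1) \<circ>\<^sub>B st 1 (braid_one b) 0) \<circ>\<^sub>B st 0 m_cup b"
    by (simp add: chord_def st_comp[OF h(2,1)] m_comp_assoc)
  also have "\<dots> = (st 2 (braid_one b) 1 \<circ>\<^sub>B st 3 (braid_one b) 0) \<circ>\<^sub>B st 1 m_cup (b + 1) \<circ>\<^sub>B st 0 m_cup b"
    by (simp only: c m_comp_assoc)
  also have "\<dots> = st 2 W 0 \<circ>\<^sub>B st 0 U b"
    by (simp add: W_def U_def st_comp[OF h(1,3)] st_comp[OF hom_cup hu(1)], simp add: nat_norm)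
  finally have e: "st 1 (chord b) 1 \<circ>\<^sub>B chord b = st 2 W 0 \<circ>\<^sub>B st 0 U b" .
  have W: "st b m_cross 0 \<circ>\<^sub>B W = W \<circ>\<^sub>B st 0 m_cross b"
    unfolding W_def by (rule cross_two_braids)
  have W2: "st (b + 2) m_cross 0 \<circ>\<^sub>B st 2 W 0 = st 2 W 0 \<circ>\<^sub>B st 2 m_cross b"
    using st_eq_comp[OF W hW h(4,5) hW, of 2 0] by (simp add: nat_norm)
  have W3: "st 0 m_cross (b + 2) \<circ>\<^sub>B st 2 W 0 = st 2 W 0 \<circ>\<^sub>B st 0 m_cross (b + 2)"
    by (rule st_commute[OF hom_cross hW, where k = 0, symmetric]) simp_all
  have U: "st 0 m_cross (b + 2) \<circ>\<^sub>B st 0 U b = st 2 m_cross b \<circ>\<^sub>B st 0 U b"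
    using arg_cong[OF cross_nested_cup_2[folded U_def], of "\<lambda>f. st 0 f b"]
    by (simp add: st_comp[OF hU hu(2)] st_comp[OF hU hu(3)], simp add: nat_norm)
  have "st 0 m_cross (b + 2) \<circ>\<^sub>B st 2 W 0 \<circ>\<^sub>B st 0 U b = st 2 W 0 \<circ>\<^sub>B st 0 m_cross (b + 2) \<circ>\<^sub>B st 0 U b"
    using W3 by (metis m_comp_assoc)
  also have "\<dots> = st (b + 2) m_cross 0 \<circ>\<^sub>B st 2 W 0 \<circ>\<^sub>B st 0 U b"
    using W2 U by (metis m_comp_assoc)
  finally show ?thesis by (simp only: e)
qed

primrec chords :: "nat \<Rightarrow> nat \<Rightarrow> nat \<Rightarrow> mor \<Rightarrow> mor" where
  "chords 0 b j X = X"
| "chords (Suc a) b j X = st a (chord b) (a + j) \<circ>\<^sub>B chords a b j X"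

lemma hom_chords: "X \<in> m_hom n (b + j) \<Longrightarrow> chords a b j X \<in> m_hom n (a + b + a + j)"
proof (induction a)
  case (Suc a)
  then have "st a (chord b) (a + j) \<circ>\<^sub>B chords a b j X \<in> m_hom n (Suc a + b + Suc a + j)"
    by (intro hom_comp[where q = "a + b + a + j"] hom_st[OF hom_chord]) simp_all
  then show ?case by simp
qed simp

lemma chords_Suc_Suc: "chords (Suc (Suc k)) b j X =
    st (k + 1) (chord b) (k + 1 + j) \<circ>\<^sub>B st k (chord b) (k + j) \<circ>\<^sub>B chords k b j X"
  by (simp add: nat_norm)

lemma st_chord_chord:
  assumes "f \<in> m_hom (b + 4) r"
  shows "st k f (k + j) \<circ>\<^sub>B st (k + 1) (chord b) (k + 1 + j) \<circ>\<^sub>B st k (chord b) (k + j) \<circ>\<^sub>B X =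
    st k (f \<circ>\<^sub>B st 1 (chord b) 1 \<circ>\<^sub>B chord b) (k + j) \<circ>\<^sub>B X"
proof -
  have h: "st 1 (chord b) 1 \<in> m_hom (b + 2) (b + 4)" by (rule hom_st[OF hom_chord]) simp_all
  show ?thesis
    by (simp add: st_comp[OF hom_comp[OF h hom_chord] assms] st_comp[OF hom_chord h] m_comp_assoc)
      (simp add: nat_norm)
qed

lemma cap_chords:
  "st k m_cap (b + 2 + (k + j)) \<circ>\<^sub>B chords (Suc (Suc k)) b j X =
    st (k + b) m_cup (k + j) \<circ>\<^sub>B chords k b j X"
proof -
  have "st 0 m_cap (b + 2) \<in> m_hom (b + 4) (b + 2)" by (rule hom_st[OF hom_cap]) simp_all
  from st_chord_chord[OF this, of k j "chords k b j X"] show ?thesis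
    unfolding chords_Suc_Suc cap_chord_chord st_st by simp
qed

text \<open>The crossing travels along its two chords from the left legs to the right legs. Nesting
  reverses the order, so \<open>k\<close> now counts chord legs to the right of the crossing. Only
  the two innermost chords need an argument; any other crossing commutes with the chord added
  last.\<close>

lemma cross_chords:
  assumes "k + 2 + l = a"
  shows "st k m_cross (l + b + a + j) \<circ>\<^sub>B chords a b j X =
    st (a + b + l) m_cross (k + j) \<circ>\<^sub>B chords a b j X"
  using assms
proof (induction a arbitrary: l)
  case (Suc a)
  show ?case
  proof (cases l)
    case 0
    then have a: "a = Suc k" using Suc.prems by simp
    have h: "st 0 m_cross (b + 2) \<in> m_hom (b + 4) (b + 4)" "st (b + 2) m_cross 0 \<in> m_hom (b + 4) (b + 4)"
      by (rule hom_st[OF hom_cross]; simp)+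
    have "st k (st 0 m_cross (b + 2)) (k + j) \<circ>\<^sub>B chords (Suc a) b j X =
        st k (st (b + 2) m_cross 0) (k + j) \<circ>\<^sub>B chords (Suc a) b j X"
      by (simp only: a chords_Suc_Suc st_chord_chord[OF h(1)] st_chord_chord[OF h(2)] cross_chord_chord)
    moreover have "l + b + Suc a + j = b + 2 + (k + j)" "Suc a + b + l = k + (b + 2)" using 0 a by simp_all
    ultimately show ?thesis by (simp only: st_st add_0_right add_0)
  next
    case (Suc l')
    then have a: "k + 2 + l' = a" using Suc.prems by simp
    have c1: "st a (chord b) (a + j) \<circ>\<^sub>B st k m_cross (l' + b + a + j) =
        st k m_cross (l + b + Suc a + j) \<circ>\<^sub>B st a (chord b) (a + j)"
      by (rule st_commute[OF hom_cross hom_chord, where k = l']) (use a Suc in simp_all)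
    have c2: "st a (chord b) (a + j) \<circ>\<^sub>B st (a + b + l') m_cross (k + j) =
        st (Suc a + b + l) m_cross (k + j) \<circ>\<^sub>B st a (chord b) (a + j)"
      by (rule st_commute[OF hom_chord hom_cross, where k = l', symmetric]) (use a Suc in simp_all)
    have "st k m_cross (l + b + Suc a + j) \<circ>\<^sub>B chords (Suc a) b j X =
        st a (chord b) (a + j) \<circ>\<^sub>B st k m_cross (l' + b + a + j) \<circ>\<^sub>B chords a b j X"
      by (simp only: chords.simps m_comp_assoc[symmetric] c1)
    also have "\<dots> = st a (chord b) (a + j) \<circ>\<^sub>B st (a + b + l') m_cross (k + j) \<circ>\<^sub>B chords a b j X"
      by (simp only: Suc.IH[OF a])
    also have "\<dots> = st (Suc a + b + l) m_cross (k + j) \<circ>\<^sub>B chords (Suc a) b j X"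
      by (simp only: chords.simps m_comp_assoc[symmetric] c2)
    finally show ?thesis .
  qed
qed simp

lemma alternating_comp:
  assumes "alternating i p j X"
    and "\<And>k l. k + 2 + l = p \<Longrightarrow>
      st (i' + k) m_cross (l + j') \<circ>\<^sub>B f = f \<circ>\<^sub>B st (i + k) m_cross (l + j)"
  shows "alternating i' p j' (f \<circ>\<^sub>B X)"
  unfolding alternating_def
proof (intro allI impI)
  fix k l assume kl: "k + 2 + l = p"
  have "st (i' + k) m_cross (l + j') \<circ>\<^sub>B f \<circ>\<^sub>B X = f \<circ>\<^sub>B st (i + k) m_cross (l + j) \<circ>\<^sub>B X"
    by (simp only: m_comp_assoc[symmetric] assms(2)[OF kl])
  also have "\<dots> = (- inverse \<q>) *\<^sub>B (f \<circ>\<^sub>B X)"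
    by (simp only: alternatingD[OF assms(1) kl HOL.refl HOL.refl] m_comp_scale_right)
  finally show "st (i' + k) m_cross (l + j') \<circ>\<^sub>B f \<circ>\<^sub>B X = (- inverse \<q>) *\<^sub>B (f \<circ>\<^sub>B X)" .
qed

lemma alternating_chord:
  assumes "alternating i b j Y"
  shows "alternating (i + 1) b (j + 1) (st i (chord b) j \<circ>\<^sub>B Y)"
proof (rule alternating_comp[OF assms])
  fix k l assume kl: "k + 2 + l = b"
  have h: "st (k + 1) m_cross (l + 1) \<in> m_hom (b + 2) (b + 2)" "st k m_cross l \<in> m_hom b b"
    by (rule hom_st[OF hom_cross]; use kl in simp)+
  have "b = k + (2 + l)" using kl by simp
  from st_eq_comp[OF cross_chord[OF this] hom_chord h hom_chord, of i j]
  show "st (i + 1 + k) m_cross (l + (j + 1)) \<circ>\<^sub>B st i (chord b) j =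
      st i (chord b) j \<circ>\<^sub>B st (i + k) m_cross (l + j)"
    by (simp add: nat_norm)
qed

lemma alternating_chords:
  "alternating 0 b j X \<Longrightarrow> alternating a b (a + j) (chords a b j X)"
proof (induction a)
  case (Suc a)
  from alternating_chord[OF Suc.IH[OF Suc.prems]]
  show ?case by (simp add: nat_norm)
qed simp

lemma alternating_E:
  assumes "Y \<in> m_hom n (i + p + j)"
  shows "alternating i p j (st i (E p) j \<circ>\<^sub>B Y)"
  unfolding alternating_def
proof (intro allI impI)
  fix k l assume kl: "k + 2 + l = p"
  have h: "st k m_cross l \<in> m_hom p p" by (rule hom_st[OF hom_cross]; use kl in simp)
  have "st (i + k) m_cross (l + j) \<circ>\<^sub>B st i (E p) j = (- inverse \<q>) *\<^sub>B st i (E p) j"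
    using st_comp[OF hom_E h, of i j] by (simp add: E_cross(1)[OF kl] st_scale)
  then show "st (i + k) m_cross (l + j) \<circ>\<^sub>B st i (E p) j \<circ>\<^sub>B Y = (- inverse \<q>) *\<^sub>B (st i (E p) j \<circ>\<^sub>B Y)"
    by (simp only: m_comp_assoc[symmetric] m_comp_scale_left)
qed

lemma E_idem: "E p \<circ>\<^sub>B E p = E p"
  using E_absorb[of "E p" p 0 p 0] E_alternating[of p] hom_E[of p] by simp

lemma alternating_mono:
  assumes "alternating i p j X" "i \<le> i'" "j \<le> j'" "i' + p' + j' = i + p + j"
  shows "alternating i' p' j' X"
  unfolding alternating_def
proof (intro allI impI)
  fix k l assume "k + 2 + l = p'"
  then show "st (i' + k) m_cross (l + j') \<circ>\<^sub>B X = (- inverse \<q>) *\<^sub>B X"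
    by (intro alternatingD[OF assms(1), of "i' - i + k" "j' - j + l"]) (use assms in simp_all)
qed

text \<open>By \<open>cross_chords\<close>, being alternating on the left legs and on the right legs
  is the same condition. Hence after either copy of \<open>E a\<close> the other is absorbed, and
  the two copies commute.\<close>

lemma E_chords:
  assumes X: "X \<in> m_hom n (b + j)"
  shows "st 0 (E a) (b + a + j) \<circ>\<^sub>B chords a b j X = st (a + b) (E a) j \<circ>\<^sub>B chords a b j X"
proof -
  define Y where "Y = chords a b j X"
  define L where "L = st 0 (E a) (b + a + j)"
  define R where "R = st (a + b) (E a) j"
  have hY: "Y \<in> m_hom n (a + b + a + j)" unfolding Y_def by (rule hom_chords[OF X])
  have hL: "L \<in> m_hom (a + b + a + j) (a + b + a + j)" "R \<in> m_hom (a + b + a + j) (a + b + a + j)"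
    unfolding L_def R_def by (rule hom_st[OF hom_E]; simp)+
  have LR: "R \<circ>\<^sub>B L = L \<circ>\<^sub>B R" unfolding L_def R_def
    by (rule st_commute[OF hom_E hom_E, where k = b]) simp_all
  have aL: "alternating 0 a (b + a + j) (L \<circ>\<^sub>B Y)" unfolding L_def
    by (rule alternating_E[OF hom_cast[OF hY]]) simp_all
  have aR: "alternating (a + b) a j (R \<circ>\<^sub>B Y)" unfolding R_def
    by (rule alternating_E[OF hom_cast[OF hY]]) simp_all
  have sLR: "st k m_cross (l + b + a + j) \<circ>\<^sub>B R = R \<circ>\<^sub>B st k m_cross (l + b + a + j)"
    "st (a + b + l) m_cross (k + j) \<circ>\<^sub>B L = L \<circ>\<^sub>B st (a + b + l) m_cross (k + j)"
    if "k + 2 + l = a" for k l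
    unfolding R_def L_def
    by (rule st_commute[OF hom_cross hom_E, where k = "l + b", symmetric]
        st_commute[OF hom_E hom_cross, where k = "b + l"]; use that in simp)+
  have "alternating 0 a (b + a + j) (R \<circ>\<^sub>B Y)"
    unfolding alternating_def
  proof (intro allI impI)
    fix k l assume kl: "k + 2 + l = a"
    have "st k m_cross (l + b + a + j) \<circ>\<^sub>B R \<circ>\<^sub>B Y = R \<circ>\<^sub>B st k m_cross (l + b + a + j) \<circ>\<^sub>B Y"
      by (simp only: m_comp_assoc[symmetric] sLR[OF kl])
    also have "\<dots> = R \<circ>\<^sub>B st (a + b + l) m_cross (k + j) \<circ>\<^sub>B Y"
      by (simp only: Y_def cross_chords[OF kl])
    also have "\<dots> = (- inverse \<q>) *\<^sub>B (R \<circ>\<^sub>B Y)"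
    proof -
      have h: "st l m_cross k \<in> m_hom a a" by (rule hom_st[OF hom_cross]; use kl in simp)
      have lk: "l + 2 + k = a" using kl by simp
      have "R \<circ>\<^sub>B st (a + b + l) m_cross (k + j) = (- inverse \<q>) *\<^sub>B R"
        unfolding R_def using st_comp[OF h hom_E, of "a + b" j] 
        by (simp add: E_cross(2)[OF lk] st_scale)
      then show ?thesis by (simp only: m_comp_assoc[symmetric] m_comp_scale_left)
    qed
    finally show "st (0 + k) m_cross (l + (b + a + j)) \<circ>\<^sub>B R \<circ>\<^sub>B Y = (- inverse \<q>) *\<^sub>B (R \<circ>\<^sub>B Y)"
      by (simp add: add.assoc)
  qed
  then have 1: "L \<circ>\<^sub>B R \<circ>\<^sub>B Y = R \<circ>\<^sub>B Y" unfolding L_def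
    by (intro E_absorb[of _ n]) (rule hom_cast[OF hom_comp[OF hL(2) hY]], simp_all)
  have "alternating (a + b) a j (L \<circ>\<^sub>B Y)"
    unfolding alternating_def
  proof (intro allI impI)
    fix l k assume "l + 2 + k = a"
    then have kl: "k + 2 + l = a" by simp
    have "st (a + b + l) m_cross (k + j) \<circ>\<^sub>B L \<circ>\<^sub>B Y = L \<circ>\<^sub>B st (a + b + l) m_cross (k + j) \<circ>\<^sub>B Y"
      by (simp only: m_comp_assoc[symmetric] sLR[OF kl])
    also have "\<dots> = L \<circ>\<^sub>B st k m_cross (l + b + a + j) \<circ>\<^sub>B Y"
      by (simp only: Y_def cross_chords[OF kl])
    also have "\<dots> = (- inverse \<q>) *\<^sub>B (L \<circ>\<^sub>B Y)"
    proof -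
      have h: "st k m_cross l \<in> m_hom a a" by (rule hom_st[OF hom_cross]; use kl in simp)
      have "L \<circ>\<^sub>B st k m_cross (l + b + a + j) = (- inverse \<q>) *\<^sub>B L"
        unfolding L_def using st_comp[OF h hom_E, of 0 "b + a + j"] 
        by (simp add: E_cross(2)[OF kl] st_scale add.assoc)
      then show ?thesis by (simp only: m_comp_assoc[symmetric] m_comp_scale_left)
    qed
    finally show "st (a + b + l) m_cross (k + j) \<circ>\<^sub>B L \<circ>\<^sub>B Y = (- inverse \<q>) *\<^sub>B (L \<circ>\<^sub>B Y)" .
  qed
  then have 2: "R \<circ>\<^sub>B L \<circ>\<^sub>B Y = L \<circ>\<^sub>B Y" unfolding R_def
    by (intro E_absorb[of _ n]) (rule hom_cast[OF hom_comp[OF hL(1) hY]], simp_all)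
  have "L \<circ>\<^sub>B Y = R \<circ>\<^sub>B Y" using 1 2 LR by (metis m_comp_assoc)
  then show ?thesis by (simp add: L_def R_def Y_def)
qed

section \<open>The crossing of two bundles as nested chords\<close>

lemma hom_nested_cup: "nested_cup a \<in> m_hom 0 (a + a)"
proof (induction a)
  case 0
  then show ?case using hom_id[of 0 0] by simp
next
  case (Suc a)
  have "st 1 (nested_cup a) 1 \<circ>\<^sub>B m_cup \<in> m_hom 0 (Suc a + Suc a)"
    by (rule hom_comp[OF hom_st[OF Suc] hom_cup]) simp_all
  then show ?case by (simp add: st_def)
qed

text \<open>The definition adds the outermost cup, whereas \<open>chords\<close> adds the innermost
  one last.\<close>

lemma nested_cup_Suc: "nested_cup (Suc a) = st a m_cup a \<circ>\<^sub>B nested_cup a"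
proof (induction a)
  case 0
  have "m_id 2 \<circ>\<^sub>B m_cup = m_cup" by (rule m_id_comp[OF hom_cup])
  then show ?case by (simp add: m_tens_id m_comp_id[OF hom_cup])
next
  case (Suc a)
  have h: "st a m_cup a \<in> m_hom (a + a) (a + 2 + a)" by (rule hom_st[OF hom_cup]) simp_all
  have "nested_cup (Suc (Suc a)) = st 1 (nested_cup (Suc a)) 1 \<circ>\<^sub>B m_cup" by (simp add: st_def)
  also have "\<dots> = st (Suc a) m_cup (Suc a) \<circ>\<^sub>B st 1 (nested_cup a) 1 \<circ>\<^sub>B m_cup"
    by (simp only: Suc st_comp[OF hom_nested_cup h] st_st m_comp_assoc) (simp only: Suc_eq_plus1 add.commute)
  also have "st 1 (nested_cup a) 1 \<circ>\<^sub>B m_cup = nested_cup (Suc a)" by (simp add: st_def)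
  finally show ?case .
qed

lemma hom_braid: "braid a b \<in> m_hom (a + b) (b + a)"
proof (induction a)
  case 0
  then show ?case using hom_id[of b b] by simp
next
  case (Suc a)
  have "st 0 (braid_one b) a \<circ>\<^sub>B st 1 (braid a b) 0 \<in> m_hom (Suc a + b) (b + Suc a)"
    by (rule hom_comp[OF hom_st[OF hom_braid_one] hom_st[OF Suc]]) simp_all
  then show ?case by (simp add: st_def)
qed

text \<open>The innermost right leg is the leftmost strand entering the braiding and passes the
  \<open>b\<close> strands last, so it can be peeled off together with the innermost cup.\<close>

lemma braid_nested_cup:
  assumes "X \<in> m_hom n (b + j)"
  shows "st a (braid a b) j \<circ>\<^sub>B st 0 (nested_cup a) (b + j) \<circ>\<^sub>B X = chords a b j X"
proof (induction a)
  case 0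
  show ?case using m_id_comp[OF assms] by simp
next
  case (Suc a)
  have h1: "st 1 (braid a b) 0 \<in> m_hom (Suc (a + b)) (Suc (b + a))" "st 0 (braid_one b) a \<in> m_hom (Suc (b + a)) (Suc (b + a))"
    by (rule hom_st[OF hom_braid] hom_st[OF hom_braid_one]; simp)+
  have h2: "st a m_cup a \<in> m_hom (a + a) (a + 2 + a)" by (rule hom_st[OF hom_cup]) simp_all
  have h3: "st 0 m_cup b \<in> m_hom b (b + 2)" "st 1 (braid_one b) 0 \<in> m_hom (b + 2) (b + 2)"
    by (rule hom_st[OF hom_cup] hom_st[OF hom_braid_one]; simp)+
  have e1: "st (Suc a) (braid (Suc a) b) j = st (a + 1) (braid_one b) (a + j) \<circ>\<^sub>B st (a + 2) (braid a b) j"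
  proof -
    have "braid (Suc a) b = st 0 (braid_one b) a \<circ>\<^sub>B st 1 (braid a b) 0" by (simp add: st_def)
    then have "st (Suc a) (braid (Suc a) b) j =
        st (Suc a) (st 0 (braid_one b) a) j \<circ>\<^sub>B st (Suc a) (st 1 (braid a b) 0) j"
      by (simp only: st_comp[OF h1])
    then show ?thesis by (simp only: st_st) (simp add: nat_norm)
  qed
  have e2: "st 0 (nested_cup (Suc a)) (b + j) = st a m_cup (a + b + j) \<circ>\<^sub>B st 0 (nested_cup a) (b + j)"
    by (simp only: nested_cup_Suc st_comp[OF hom_nested_cup h2] st_st add_0 add.assoc)
  have c: "st (a + 2) (braid a b) j \<circ>\<^sub>B st a m_cup (a + b + j) = st a m_cup (b + a + j) \<circ>\<^sub>B st a (braid a b) j"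
    by (rule st_commute[OF hom_cup hom_braid, where k = 0]) simp_all
  have e3: "st a (chord b) (a + j) = st (a + 1) (braid_one b) (a + j) \<circ>\<^sub>B st a m_cup (b + a + j)"
    by (simp only: chord_def st_comp[OF h3] st_st) (simp add: add.assoc)
  have "st (Suc a) (braid (Suc a) b) j \<circ>\<^sub>B st 0 (nested_cup (Suc a)) (b + j) \<circ>\<^sub>B X =
    st (a + 1) (braid_one b) (a + j) \<circ>\<^sub>B (st (a + 2) (braid a b) j \<circ>\<^sub>B st a m_cup (a + b + j))
     \<circ>\<^sub>B st 0 (nested_cup a) (b + j) \<circ>\<^sub>B X"
    by (simp only: e1 e2 m_comp_assoc)
  also have "\<dots> = (st (a + 1) (braid_one b) (a + j) \<circ>\<^sub>B st a m_cup (b + a + j)) \<circ>\<^sub>B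
     st a (braid a b) j \<circ>\<^sub>B st 0 (nested_cup a) (b + j) \<circ>\<^sub>B X"
    by (simp only: c m_comp_assoc)
  also have "\<dots> = chords (Suc a) b j X"
    by (simp only: e3[symmetric] Suc chords.simps)
  finally show ?case .
qed

section \<open>Clifford functionals\<close>

context field_embedding
begin

lemma embed_zero [simp]: "\<iota> 0 = 0"
  using embed_add[of 0 0] by (metis add.right_neutral add_left_cancel)
lemma embed_minus [simp]: "\<iota> (- x) = - \<iota> x"
  using embed_add[of x "- x"] by (simp add: eq_neg_iff_add_eq_0 add.commute)
lemma embed_diff [simp]: "\<iota> (x - y) = \<iota> x - \<iota> y"
  using embed_add[of x "- y"] by simp
lemma embed_nonzero: "x \<noteq> 0 \<Longrightarrow> \<iota> x \<noteq> 0"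
  using embed_mult[of x "inverse x"] embed_one by auto

end

text \<open>A functional on closed diagrams with \<open>p\<close> free ends, the model being the insertion of these ends
  into the spin loop. Working with its scalar values avoids linear algebra in the target category.\<close>

locale clifford_functional = field_embedding \<iota>
  for \<iota> :: "scalar \<Rightarrow> 'l :: field" +
  fixes \<phi> :: "nat \<Rightarrow> mor \<Rightarrow> 'l"
  assumes phi_add: "\<lbrakk>f \<in> m_hom 0 p; g \<in> m_hom 0 p\<rbrakk> \<Longrightarrow> \<phi> p (f +\<^sub>B g) = \<phi> p f + \<phi> p g"
    and phi_scale: "f \<in> m_hom 0 p \<Longrightarrow> \<phi> p (a *\<^sub>B f) = \<iota> a * \<phi> p f"
    and phi_cross: "h \<in> m_hom 0 (i + 2 + j) \<Longrightarrow> \<phi> (i + 2 + j) (st i m_cross j \<circ>\<^sub>B h) =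
      \<iota> (inverse \<z>) * \<phi> (i + j) (st i m_cap j \<circ>\<^sub>B h) - \<iota> (inverse \<q>) * \<phi> (i + 2 + j) h"
    and phi_cross_inv: "h \<in> m_hom 0 (i + 2 + j) \<Longrightarrow> \<phi> (i + 2 + j) (st i m_cross_inv j \<circ>\<^sub>B h) =
      \<iota> \<z> * \<phi> (i + j) (st i m_cap j \<circ>\<^sub>B h) - \<iota> \<q> * \<phi> (i + 2 + j) h"
    and phi_cup: "h \<in> m_hom 0 (i + j) \<Longrightarrow>
      \<phi> (i + 2 + j) (st i m_cup j \<circ>\<^sub>B h) = \<iota> \<delta> * \<phi> (i + j) h"

text \<open>The axioms are invariant under exchanging \<open>i\<close> and \<open>j\<close>, so
  results at the right end of a row of strands transfer to the left end.\<close>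

lemma clifford_functional_mirror:
  assumes "clifford_functional \<iota> \<phi>"
  shows "clifford_functional \<iota> (\<lambda>p f. \<phi> p (m_mirror f))"
proof -
  interpret clifford_functional \<iota> \<phi> by (fact assms)
  show ?thesis
  proof
    fix h i j assume h: "h \<in> m_hom 0 (i + 2 + j)"
    have c: "i + 2 + j = j + 2 + i" "i + j = j + i" by simp_all
    have h': "m_mirror h \<in> m_hom 0 (j + 2 + i)" using hom_mirror[OF h] by (simp only: c)
    show "\<phi> (i + 2 + j) (m_mirror (st i m_cross j \<circ>\<^sub>B h)) =
      \<iota> (inverse \<z>) * \<phi> (i + j) (m_mirror (st i m_cap j \<circ>\<^sub>B h)) - \<iota> (inverse \<q>) * \<phi> (i + 2 + j) (m_mirror h)"
      using phi_cross[OF h'] by (simp only: c m_mirror_simps m_mirror_st)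
    show "\<phi> (i + 2 + j) (m_mirror (st i m_cross_inv j \<circ>\<^sub>B h)) =
      \<iota> \<z> * \<phi> (i + j) (m_mirror (st i m_cap j \<circ>\<^sub>B h)) - \<iota> \<q> * \<phi> (i + 2 + j) (m_mirror h)"
      using phi_cross_inv[OF h'] by (simp only: c m_mirror_simps m_mirror_st)
  next
    fix h i j assume h: "h \<in> m_hom 0 (i + j)"
    have c: "i + 2 + j = j + 2 + i" "i + j = j + i" by simp_all
    have h': "m_mirror h \<in> m_hom 0 (j + i)" using hom_mirror[OF h] by (simp only: c)
    show "\<phi> (i + 2 + j) (m_mirror (st i m_cup j \<circ>\<^sub>B h)) = \<iota> \<delta> * \<phi> (i + j) (m_mirror h)"
      using phi_cup[OF h'] by (simp only: c m_mirror_simps m_mirror_st)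
  qed (simp_all add: phi_add phi_scale hom_mirror)
qed

text \<open>The coefficients of $\Gamma_{a+1} = \gamma_{a+1}(E(a)\otimes 1) + r_a \gamma_{a-1} \mathrm{ev}_a (E(a)\otimes 1)$,
  of the contraction of \<open>E(a) \<otimes> 1\<close> with a cup, and of the removal of one chord around \<open>E(b)\<close>.\<close>

definition fierz_r :: "nat \<Rightarrow> scalar" where
  "fierz_r a = - qint 0 (int a) / qbrace (int a)"
definition fierz_s :: "nat \<Rightarrow> scalar" where
  "fierz_s a = qint 2 (1 - int a) / qbrace (int a - 1)"
definition fierz_l :: "nat \<Rightarrow> scalar" where
  "fierz_l b = (- 1) ^ b * qint 1 (- int b)"

section \<open>Scalar identities for the recursion coefficients\<close>

lemma qbrace_nat: "qbrace (int k) = \<z> * inverse (\<q> ^ k) + inverse \<z> * \<q> ^ k"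
  by (simp add: qbrace_def power_int_minus)
lemma qbrace_nat_diff_1: "qbrace (int k - 1) = \<z> * (inverse (\<q> ^ k) * \<q>) + inverse \<z> * (\<q> ^ k * inverse \<q>)"
  by (simp add: qbrace_def power_int_diff power_int_minus field_simps)

lemma S_den_eq: "S_den (\<q> ^ a) = qbrace (int a) * (\<q> ^ a * \<q> - inverse (\<q> ^ a) * inverse \<q>)"
  by (simp add: S_den_def qbrace_nat mult.commute add.commute)

lemma fierz_r_alt:
  "fierz_r a = (inverse (\<q> ^ a) - \<q> ^ a) * inverse qd * inverse (qbrace (int a))"
  by (simp add: fierz_r_def qint_0_nat divide_inverse algebra_simps)

text \<open>The induction step of \<open>phi_E_step\<close> leads to this combination: the first two
  terms come from expanding S(x) by the Clifford relations, the term with \<open>fierz_r a\<close>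
  from the previous splitting after its cap has slid past the crossings of S(x).\<close>

lemma fierz_r_Suc:
  assumes "x = \<q> ^ Suc a"
  shows "S_B x * inverse \<z> + S_C x * \<z> - fierz_r a * (\<q> * S_B x + inverse \<q> * S_C x) =
    fierz_r (Suc a)"
proof -
  define xi where "xi = inverse x"
  define e where "e = x * \<q> - xi * inverse \<q>"
  define b where "b = \<z> * xi + inverse \<z> * x"
  define c where "c = \<z> * (xi * \<q>) + inverse \<z> * (x * inverse \<q>)"
  define k where "k = qd"
  define ki where "ki = inverse qd"
  have x: "x \<noteq> 0" by (simp add: assms)
  have inv: "x * xi = 1" "\<q> * inverse \<q> = 1" "\<z> * inverse \<z> = 1" "k * ki = 1"
    using x by (simp_all add: xi_def k_def ki_def)
  have b: "qbrace (int (Suc a)) = b" by (simp only: qbrace_nat b_def xi_def assms)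
  have c: "qbrace (int a) = c" 
    using qbrace_nat_diff_1[of "Suc a"] by (simp add: c_def xi_def assms)
  have nz: "b \<noteq> 0" "c \<noteq> 0" "S_den x \<noteq> 0"
    using qbrace_nonzero S_den_nonzero by (simp_all only: b[symmetric] c[symmetric] assms) simp_all
  have d: "S_den x = b * e" unfolding assms S_den_eq by (simp only: b e_def xi_def assms)
  have e: "e \<noteq> 0" using nz d by auto
  define bi where "bi = inverse b"
  define ci where "ci = inverse c"
  define ei where "ei = inverse e"
  have inv2: "b * bi = 1" "c * ci = 1" "e * ei = 1" using nz e by (simp_all add: bi_def ci_def ei_def)
  have D: "inverse (S_den x) = bi * ei" by (simp add: d bi_def ei_def)
  have r1: "fierz_r (Suc a) = (xi - x) * ki * bi"
    by (simp only: fierz_r_alt b assms[symmetric] xi_def[symmetric] bi_def ki_def)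
  have "\<q> ^ a = x * inverse \<q>" "inverse (\<q> ^ a) = xi * \<q>" by (simp_all add: xi_def assms)
  then have r0: "fierz_r a = (xi * \<q> - x * inverse \<q>) * ki * ci"
    unfolding fierz_r_alt c ki_def[symmetric] ci_def[symmetric] by metis
  have 1: "fierz_r a * (\<q> * S_B x + inverse \<q> * S_C x) = (x * inverse \<q> - xi * \<q>) * ki * (x - xi) * bi * ei"
    unfolding r0 S_B_def S_C_def D xi_def[symmetric]
    using inv2(2) inv(2) c_def by algebra
  have 2: "S_B x * inverse \<z> + S_C x * \<z> = - (x - xi) * (x + xi) * bi * ei"
    unfolding S_B_def S_C_def D xi_def[symmetric] using inv by algebra
  \<comment> \<open>This trades \<open>x + xi\<close> for \<open>e\<close> and the bracket occurring
    in \<open>1\<close>; the bracket then cancels, and \<open>e\<close> cancels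
    \<open>ei\<close>.\<close>
  have 3: "k * (x + xi) + (x * inverse \<q> - xi * \<q>) = e" unfolding k_def e_def by algebra
  define y where "y = x * inverse \<q> - xi * \<q>"
  have "ki * (e - y) = (k * ki) * (x + xi)"
    unfolding 3[symmetric] y_def by (simp add: algebra_simps)
  then have A: "x + xi = ki * (e - y)" using inv(4) by simp
  have "- (x - xi) * (x + xi) * bi * ei - y * ki * (x - xi) * bi * ei =
      (xi - x) * ki * bi * (e * ei)"
    unfolding A by (simp add: algebra_simps)
  then show ?thesis unfolding 1 2 r1 y_def by (simp only: inv2(3) mult_1_right)
qed

text \<open>The partial trace of S(q^a) over its right strand: a loop for the identity and the curls
  of \<open>kink_right\<close> for the two crossings.\<close>

definition S_kappa :: "nat \<Rightarrow> scalar" where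
  "S_kappa a = S_A (\<q> ^ a) * dimV + S_B (\<q> ^ a) * kink' + S_C (\<q> ^ a) * kink"

lemma fierz_s_eq: "- fierz_r (Suc a) * S_kappa a = fierz_s (Suc a)"
proof -
  define x where "x = \<q> ^ a"
  define xi where "xi = inverse x"
  define e where "e = x * \<q> - xi * inverse \<q>"
  define b where "b = \<z> * (xi * inverse \<q>) + inverse \<z> * (x * \<q>)"
  define c where "c = \<z> * xi + inverse \<z> * x"
  define k where "k = qd"
  define ki where "ki = inverse qd"
  have x: "x \<noteq> 0" by (simp add: x_def)
  have inv: "x * xi = 1" "\<q> * inverse \<q> = 1" "\<z> * inverse \<z> = 1" "k * ki = 1"
    using x by (simp_all add: xi_def k_def ki_def)
  have b: "qbrace (int (Suc a)) = b" by (simp only: qbrace_nat b_def xi_def x_def) (simp add: mult_ac)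
  have c: "qbrace (int a) = c" by (simp only: qbrace_nat c_def xi_def x_def)
  have nz: "b \<noteq> 0" "c \<noteq> 0" "S_den x \<noteq> 0"
    using qbrace_nonzero S_den_nonzero by (simp_all only: b[symmetric] c[symmetric] x_def) simp_all
  have d: "S_den x = c * e" unfolding x_def S_den_eq by (simp only: c e_def xi_def x_def)
  have e: "e \<noteq> 0" using nz d by auto
  define bi where "bi = inverse b"
  define ci where "ci = inverse c"
  define ei where "ei = inverse e"
  have inv2: "b * bi = 1" "c * ci = 1" "e * ei = 1" using nz e by (simp_all add: bi_def ci_def ei_def)
  have D: "inverse (S_den x) = ci * ei" by (simp add: d ci_def ei_def)
  have r1: "fierz_r (Suc a) = (xi * inverse \<q> - x * \<q>) * ki * bi"
    by (simp only: fierz_r_alt b bi_def ki_def e_def x_def xi_def) (simp add: mult_ac)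
  have s: "fierz_s (Suc a) = (\<z> * \<z> * xi - inverse \<z> * inverse \<z> * x) * ki * ci"
    by (simp add: fierz_s_def qint_def c divide_inverse power_int_minus power2_eq_square
        ki_def ci_def xi_def x_def)
  have kk: "kink = inverse \<z> * inverse \<z> * \<q>" "kink' = \<z> * \<z> * inverse \<q>"
    by (simp_all add: power_int_minus power2_eq_square)
  have l: "\<delta> = (\<z> - inverse \<z>) * ki" by (simp add: loop_def ki_def divide_inverse)
  define zi where "zi = inverse \<z>"
  define qi where "qi = inverse \<q>"
  note inv' = inv[folded zi_def qi_def]
  \<comment> \<open>The first factor on the right is {a+1}, the denominator of
    \<open>fierz_r (Suc a)\<close>; the second is the numerator of
    \<open>fierz_s (Suc a)\<close>.\<close>
  have 1: "(\<z> + zi) * (\<z> * qi + zi * \<q>) * (\<z> - zi) +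
      ((xi - x) * (xi * \<z>) * (\<z> * \<z> * qi) + (xi - x) * (x * zi) * (zi * zi * \<q>)) =
      (\<z> * (xi * qi) + zi * (x * \<q>)) * (\<z> * \<z> * xi - zi * zi * x)"
    using inv'(1-3) by algebra
  have "S_kappa a = ci * ei * ((k * ki) * ((\<z> + zi) * (\<z> * qi + zi * \<q>) * (\<z> - zi)) +
      ((xi - x) * (xi * \<z>) * (\<z> * \<z> * qi) + (xi - x) * (x * zi) * (zi * zi * \<q>)))"
    unfolding S_kappa_def x_def[symmetric] S_A_def S_B_def S_C_def D xi_def[symmetric] kk l
      k_def[symmetric]
    unfolding zi_def[symmetric] qi_def[symmetric]
    by (simp add: algebra_simps power2_eq_square)
  then have "S_kappa a = b * (\<z> * \<z> * xi - inverse \<z> * inverse \<z> * x) * ci * ei"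
    unfolding inv(4) mult_1_left 1 by (simp only: b_def zi_def qi_def mult_ac)
  moreover have "xi * inverse \<q> - x * \<q> = - e" by (simp add: e_def)
  ultimately show ?thesis unfolding r1 s using inv2 by algebra
qed

lemma fierz_l_Suc: "inverse \<z> * (- \<q>) ^ b - inverse \<q> * fierz_l b = fierz_l (Suc b)"
proof -
  define x where "x = \<q> ^ b"
  define xi where "xi = inverse x"
  define m :: scalar where "m = (- 1) ^ b"
  define ki where "ki = inverse qd"
  have "(- \<q>) ^ b = m * x" unfolding m_def by (simp only: x_def power_minus[of "\<q>" b])
  moreover have "qint 1 (- int b) = (\<z> * xi - inverse \<z> * x) * ki"
    by (simp add: qint_def power_int_minus divide_inverse x_def xi_def ki_def)
  moreover have "qint 1 (- int (Suc b)) = (\<z> * (xi * inverse \<q>) - inverse \<z> * (x * \<q>)) * ki"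
    by (simp add: qint_def power_int_minus power_int_diff power_int_add divide_inverse x_def xi_def ki_def mult_ac)
  ultimately have e: "(- \<q>) ^ b = m * x" "qint 1 (- int b) = (\<z> * xi - inverse \<z> * x) * ki"
    "qint 1 (- int (Suc b)) = (\<z> * (xi * inverse \<q>) - inverse \<z> * (x * \<q>)) * ki" by simp_all
  define qi where "qi = inverse \<q>"
  define zi where "zi = inverse \<z>"
  have "(\<q> - qi) * ki = 1" "\<q> * qi = 1" by (simp_all add: ki_def qi_def)
  then have "zi * (m * x) - qi * (m * ((\<z> * xi - zi * x) * ki)) =
      - (m * ((\<z> * (xi * qi) - zi * (x * \<q>)) * ki))" by algebra
  then show ?thesis unfolding fierz_l_def power_Suc m_def[symmetric] e qi_def zi_def by simp
qed

context clifford_functional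
begin

text \<open>The Clifford relations replace both crossings by scalars and caps; the scalars sum to 1
  by \<open>S_ABC\<close>.\<close>

lemma phi_S:
  assumes h: "h \<in> m_hom 0 (i + 2 + j)" and x: "S_den x \<noteq> 0" "x \<noteq> 0"
  shows "\<phi> (i + 2 + j) (st i (S_mor x) j \<circ>\<^sub>B h) = \<phi> (i + 2 + j) h +
    \<iota> (S_B x * inverse \<z> + S_C x * \<z>) * \<phi> (i + j) (st i m_cap j \<circ>\<^sub>B h)"
proof -
  have hh: "st i m_cross j \<circ>\<^sub>B h \<in> m_hom 0 (i + 2 + j)" "st i m_cross_inv j \<circ>\<^sub>B h \<in> m_hom 0 (i + 2 + j)"
    by (rule hom_comp[OF hom_st[OF hom_cross] h] hom_comp[OF hom_st[OF hom_cross_inv] h]; simp)+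
  have "\<phi> (i + 2 + j) (st i (S_mor x) j \<circ>\<^sub>B h) = \<iota> (S_A x) * \<phi> (i + 2 + j) h
     + (\<iota> (S_B x) * \<phi> (i + 2 + j) (st i m_cross j \<circ>\<^sub>B h) + \<iota> (S_C x) * \<phi> (i + 2 + j) (st i m_cross_inv j \<circ>\<^sub>B h))"
    by (simp only: S_mor_def st_add st_scale m_comp_add_left m_comp_scale_left st_id m_id_comp[OF h]
        phi_add phi_scale hom_add hom_scale hh h)
  also have "\<dots> = \<iota> (S_A x - S_B x * inverse \<q> - S_C x * \<q>) * \<phi> (i + 2 + j) h +
    \<iota> (S_B x * inverse \<z> + S_C x * \<z>) * \<phi> (i + j) (st i m_cap j \<circ>\<^sub>B h)"
    by (simp only: phi_cross[OF h] phi_cross_inv[OF h])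
      (simp add: embed_add embed_mult algebra_simps)
  finally show ?thesis by (simp add: S_ABC[OF x] embed_one)
qed

lemma kink_neq: "kink \<noteq> - inverse \<q>"
proof
  assume "kink = - inverse \<q>"
  then have "inverse \<z> * inverse \<z> * \<q> = - inverse \<q>"
    by (simp add: power_int_minus power2_eq_square)
  moreover have "\<z> * inverse \<z> = 1" "\<q> * inverse \<q> = 1" by simp_all
  ultimately have "\<z> * \<z> = - (\<q> * \<q>)" by algebra
  then have "\<q> ^ 0 * \<z>\<^sup>2 = - 1 * \<q> ^ 2" by (simp add: power2_eq_square)
  then show False using zvar_power2_neq[of "-1" 0 2] by blast
qed

lemma eigen_neq_zero:
  assumes "f \<in> m_hom 0 p" "kink *\<^sub>B f = (- inverse \<q>) *\<^sub>B f"
  shows "\<phi> p f = 0"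
proof -
  have "\<iota> kink * \<phi> p f = \<iota> (- inverse \<q>) * \<phi> p f"
    using assms phi_scale by metis
  then have "\<iota> (kink + inverse \<q>) * \<phi> p f = 0" by (simp only: embed_add) (simp add: distrib_right)
  moreover have "kink + inverse \<q> \<noteq> 0" using kink_neq by (metis eq_neg_iff_add_eq_0)
  ultimately show ?thesis by (metis mult_eq_0_iff embed_nonzero)
qed

text \<open>A crossing between the cap and \<open>h\<close> contributes \<open>kink\<close> when
  absorbed by the cap and -q^-1 when absorbed by \<open>h\<close>, and these differ.\<close>

lemma phi_cap_eigen:
  assumes h: "h \<in> m_hom 0 (i + 2 + j)" and e: "st i m_cross j \<circ>\<^sub>B h = (- inverse \<q>) *\<^sub>B h"
  shows "\<phi> (i + j) (st i m_cap j \<circ>\<^sub>B h) = 0"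
proof (rule eigen_neq_zero)
  show "st i m_cap j \<circ>\<^sub>B h \<in> m_hom 0 (i + j)" by (rule hom_comp[OF hom_st[OF hom_cap] h]) simp_all
  have "kink *\<^sub>B (st i m_cap j \<circ>\<^sub>B h) = st i m_cap j \<circ>\<^sub>B st i m_cross j \<circ>\<^sub>B h"
    by (simp only: m_comp_assoc[symmetric] st_comp[OF hom_cross hom_cap, symmetric] cap_cross st_scale
        m_comp_scale_left)
  then show "kink *\<^sub>B (st i m_cap j \<circ>\<^sub>B h) = (- inverse \<q>) *\<^sub>B (st i m_cap j \<circ>\<^sub>B h)"
    by (simp only: e m_comp_scale_right)
qed

lemma cap_slide_left:
  "st i m_cap (1 + j) \<circ>\<^sub>B st (i + 1) m_cross j \<circ>\<^sub>B h = st (i + 1) m_cap j \<circ>\<^sub>B st i m_cross_inv (1 + j) \<circ>\<^sub>B h"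
  "st i m_cap (1 + j) \<circ>\<^sub>B st (i + 1) m_cross_inv j \<circ>\<^sub>B h = st (i + 1) m_cap j \<circ>\<^sub>B st i m_cross (1 + j) \<circ>\<^sub>B h"
proof -
  have c: "st 0 m_cap 1 \<in> m_hom 3 1" "st 1 m_cap 0 \<in> m_hom 3 1"
    "st 0 m_cross 1 \<in> m_hom 3 3" "st 1 m_cross 0 \<in> m_hom 3 3"
    "st 0 m_cross_inv 1 \<in> m_hom 3 3" "st 1 m_cross_inv 0 \<in> m_hom 3 3"
    by (rule hom_st[OF hom_cap] hom_st[OF hom_cross] hom_st[OF hom_cross_inv]; simp)+
  show "st i m_cap (1 + j) \<circ>\<^sub>B st (i + 1) m_cross j \<circ>\<^sub>B h = st (i + 1) m_cap j \<circ>\<^sub>B st i m_cross_inv (1 + j) \<circ>\<^sub>B h"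
    using arg_cong[OF st_eq_comp[OF cap_slide c(4,1,5,2), of i j], of "\<lambda>f. f \<circ>\<^sub>B h"]
    by (simp add: m_comp_assoc)
  show "st i m_cap (1 + j) \<circ>\<^sub>B st (i + 1) m_cross_inv j \<circ>\<^sub>B h = st (i + 1) m_cap j \<circ>\<^sub>B st i m_cross (1 + j) \<circ>\<^sub>B h"
    using arg_cong[OF st_eq_comp[OF cap_slide' c(6,1,3,2), of i j], of "\<lambda>f. f \<circ>\<^sub>B h"]
    by (simp add: m_comp_assoc)
qed

text \<open>In the form E S E, the induction hypothesis splits the outer E; the smaller E it leaves
  commutes with S and is absorbed by the inner E. Only one S remains to be expanded, and it produces
  caps on the last two strands: a cap one place further left either has value zero or slides
  there.\<close>

lemma phi_E_step:
  "h \<in> m_hom 0 (i + (k + 2) + j) \<Longrightarrow>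
   \<phi> (i + (k + 2) + j) (st i (E (Suc (Suc k))) j \<circ>\<^sub>B h) =
   \<phi> (i + (k + 2) + j) (st i (E (Suc k)) (1 + j) \<circ>\<^sub>B h) +
   \<iota> (fierz_r (Suc k)) * \<phi> (i + k + j) (st (i + k) m_cap j \<circ>\<^sub>B st i (E (Suc k)) (1 + j) \<circ>\<^sub>B h)"
proof (induction k arbitrary: h j)
  case 0
  then have h: "h \<in> m_hom 0 (i + 2 + j)" by simp
  have h': "h \<in> m_hom 0 (i + 1 + (1 + j))" by (rule hom_cast[OF h]) simp_all
  have E: "E (Suc (Suc 0)) = S_mor \<q>" using E_2 by (simp only: numeral_2_eq_2)
  have i: "st i (E (Suc 0)) (1 + j) \<circ>\<^sub>B h = h" by (simp only: E.simps st_id m_id_comp[OF h'])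
  have "S_den \<q> \<noteq> 0" using S_den_nonzero[of 1] by simp
  from phi_S[OF h this] fierz_r_Suc[of \<q> 0] show ?case
    by (simp only: E i) (simp add: fierz_r_def qint_def)
next
  case (Suc k)
  define x where "x = \<q> ^ Suc (Suc k)"
  define h' where "h' = st i (E (Suc (Suc k))) (1 + j) \<circ>\<^sub>B h"
  define g where "g = st (i + k + 1) (S_mor x) j \<circ>\<^sub>B h'"
  define N where "N = i + (Suc k + 2) + j"
  have x: "S_den x \<noteq> 0" "x \<noteq> 0" unfolding x_def using S_den_nonzero[of "Suc (Suc k)"] by simp_all
  have N2: "i + k + 1 + 2 + j = N" by (simp add: N_def)
  have N: "i + (k + 2) + (1 + j) = N" by (simp add: N_def)
  have h: "h \<in> m_hom 0 N" using Suc.prems by (simp add: N_def)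
  have h'_hom: "h' \<in> m_hom 0 N" unfolding h'_def N_def
    by (rule hom_comp[OF hom_st[OF hom_E] Suc.prems]) simp_all
  have h'1: "h' \<in> m_hom 0 (i + k + 2 + (1 + j))" "h' \<in> m_hom 0 (i + k + 1 + 2 + j)"
    "h' \<in> m_hom 0 (i + (k + 2) + (1 + j))"
    by (rule hom_cast[OF h'_hom]; simp add: N_def)+
  have g: "g \<in> m_hom 0 N" unfolding g_def N_def
    by (rule hom_comp[OF hom_st[OF hom_S] h'1(2)]) simp_all
  have g1: "g \<in> m_hom 0 (i + (k + 2) + (1 + j))" by (rule hom_cast[OF g]; simp add: N_def)
  have hE: "st 0 (E (Suc (Suc k))) 1 \<in> m_hom (k + 3) (k + 3)" "st (Suc k) (S_mor x) 0 \<in> m_hom (k + 3) (k + 3)"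
    by (rule hom_st[OF hom_E] hom_st[OF hom_S]; simp)+
  have E: "st i (E (Suc (Suc (Suc k)))) j \<circ>\<^sub>B h = st i (E (Suc (Suc k))) (1 + j) \<circ>\<^sub>B g"
    unfolding E_step[of "Suc k"] x_def[symmetric]
    by (simp only: st_comp[OF hom_comp[OF hE(2,1)] hE(1)] st_comp[OF hE(1,2)] st_st m_comp_assoc
        g_def h'_def) (simp add: nat_norm del: E.simps)
  have ah': "alternating i (k + 2) (1 + j) h'" unfolding h'_def
    using alternating_E[of h 0 i "Suc (Suc k)" "1 + j"] hom_cast[OF h, of 0 "i + Suc (Suc k) + (1 + j)"]
    by (simp add: N_def)
  have e: "st (i + k) m_cross (1 + j) \<circ>\<^sub>B h' = (- inverse \<q>) *\<^sub>B h'"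
    by (rule alternatingD[OF ah', of k 0]) simp_all
  have ab: "st i (E (Suc k)) (1 + (1 + j)) \<circ>\<^sub>B g = g"
  proof -
    have c: "st i (E (Suc k)) (1 + (1 + j)) \<circ>\<^sub>B st (i + k + 1) (S_mor x) j =
        st (i + k + 1) (S_mor x) j \<circ>\<^sub>B st i (E (Suc k)) (1 + (1 + j))"
      by (rule st_commute[OF hom_E hom_S, where k = 0, symmetric]) simp_all
    have "st i (E (Suc k)) (1 + (1 + j)) \<circ>\<^sub>B h' = h'"
      by (rule E_absorb[OF hom_cast[OF h'_hom] alternating_mono[OF ah']]) (simp_all add: N_def)
    then show ?thesis unfolding g_def by (simp only: m_comp_assoc[symmetric] c) (simp only: m_comp_assoc)
  qed
  have "\<phi> N (st i (E (Suc (Suc (Suc k)))) j \<circ>\<^sub>B h) = \<phi> (i + (k + 2) + (1 + j)) (st i (E (Suc (Suc k))) (1 + j) \<circ>\<^sub>B g)"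
    by (simp only: E N)
  also have "\<dots> = \<phi> N g + \<iota> (fierz_r (Suc k)) * \<phi> (i + k + (1 + j)) (st (i + k) m_cap (1 + j) \<circ>\<^sub>B g)"
    using Suc.IH[OF g1] by (simp only: ab N)
  also have "\<phi> N g = \<phi> N h' + \<iota> (S_B x * inverse \<z> + S_C x * \<z>) * \<phi> (i + k + 1 + j) (st (i + k + 1) m_cap j \<circ>\<^sub>B h')"
    using phi_S[OF h'1(2) x] by (simp only: g_def N2)
  \<comment> \<open>The identity part of S(x) drops out by \<open>phi_cap_eigen\<close>. In the
    other parts the slide inverts the crossing and moves it to the left pair, where it acts on
    \<open>h'\<close> by its eigenvalue.\<close>
  also have "\<phi> (i + k + (1 + j)) (st (i + k) m_cap (1 + j) \<circ>\<^sub>B g) =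
     - \<iota> (\<q> * S_B x + inverse \<q> * S_C x) * \<phi> (i + k + 1 + j) (st (i + k + 1) m_cap j \<circ>\<^sub>B h')"
  proof -
    have hc: "st (i + k) m_cap (1 + j) \<circ>\<^sub>B h' \<in> m_hom 0 (i + k + (1 + j))" 
      "st (i + k + 1) m_cap j \<circ>\<^sub>B h' \<in> m_hom 0 (i + k + (1 + j))"
      by (rule hom_comp[OF hom_st[OF hom_cap] h'1(1)] hom_comp[OF hom_st[OF hom_cap] h'1(2)]; simp)+
    have "st (i + k) m_cap (1 + j) \<circ>\<^sub>B g = S_A x *\<^sub>B (st (i + k) m_cap (1 + j) \<circ>\<^sub>B h') +\<^sub>B
       (S_B x *\<^sub>B (st (i + k) m_cap (1 + j) \<circ>\<^sub>B st (i + k + 1) m_cross j \<circ>\<^sub>B h') +\<^sub>B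
        S_C x *\<^sub>B (st (i + k) m_cap (1 + j) \<circ>\<^sub>B st (i + k + 1) m_cross_inv j \<circ>\<^sub>B h'))"
      unfolding g_def
      by (simp only: S_mor_def st_add st_scale m_comp_add_left m_comp_scale_left st_id m_id_comp[OF h'1(2)]
          m_comp_add_right m_comp_scale_right)
    also have "\<dots> = S_A x *\<^sub>B (st (i + k) m_cap (1 + j) \<circ>\<^sub>B h') +\<^sub>B
       (S_B x *\<^sub>B (- \<q>) *\<^sub>B (st (i + k + 1) m_cap j \<circ>\<^sub>B h') +\<^sub>B
        S_C x *\<^sub>B (- inverse \<q>) *\<^sub>B (st (i + k + 1) m_cap j \<circ>\<^sub>B h'))"
      by (simp only: cap_slide_left e cross_inv_eigen[OF h'1(1) e] m_comp_scale_right)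
    finally have "\<phi> (i + k + (1 + j)) (st (i + k) m_cap (1 + j) \<circ>\<^sub>B g) =
       \<iota> (S_B x) * (\<iota> (- \<q>) * \<phi> (i + k + (1 + j)) (st (i + k + 1) m_cap j \<circ>\<^sub>B h')) +
       \<iota> (S_C x) * (\<iota> (- inverse \<q>) * \<phi> (i + k + (1 + j)) (st (i + k + 1) m_cap j \<circ>\<^sub>B h'))"
      by (simp only: phi_add phi_scale hom_add hom_scale hc phi_cap_eigen[OF h'1(1) e]
          mult_zero_right add_0_left)
    moreover have "i + k + (1 + j) = i + k + 1 + j" by simp
    ultimately show ?thesis by (simp add: embed_add embed_mult algebra_simps)
  qed
  finally have "\<phi> N (st i (E (Suc (Suc (Suc k)))) j \<circ>\<^sub>B h) = \<phi> N h' +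
     \<iota> (S_B x * inverse \<z> + S_C x * \<z> - fierz_r (Suc k) * (\<q> * S_B x + inverse \<q> * S_C x)) *
      \<phi> (i + k + 1 + j) (st (i + k + 1) m_cap j \<circ>\<^sub>B h')"
    by (simp add: embed_add embed_mult algebra_simps)
  then have "\<phi> N (st i (E (Suc (Suc (Suc k)))) j \<circ>\<^sub>B h) = \<phi> N h' + \<iota> (fierz_r (Suc (Suc k))) *
      \<phi> (i + k + 1 + j) (st (i + k + 1) m_cap j \<circ>\<^sub>B h')"
    unfolding fierz_r_Suc[OF x_def] .
  moreover have "i + k + 1 = i + Suc k" by simp
  ultimately show ?case by (simp only: N_def h'_def)
qed

end

section \<open>Partial traces of the antisymmetrisers\<close>

lemma turnback_S:
  "st 1 m_cap 0 \<circ>\<^sub>B st 0 (S_mor x) 1 \<circ>\<^sub>B st 1 m_cup 0 =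
    (S_A x * dimV + S_B x * kink' + S_C x * kink) *\<^sub>B m_id 1"
proof -
  have h: "st 1 m_cup 0 \<in> m_hom 1 3" by (rule hom_st[OF hom_cup]) simp_all
  have d: "st 1 m_cap 0 \<circ>\<^sub>B st 1 m_cup 0 = dimV *\<^sub>B m_id 1"
    by (simp add: st_comp[OF hom_cup hom_cap, symmetric] skein_loop st_scale)
  have i: "st 0 (m_id 2) 1 \<circ>\<^sub>B st 1 m_cup 0 = st 1 m_cup 0"
    using m_id_comp[OF h] by simp
  show ?thesis
    by (simp only: S_mor_def st_add st_scale m_comp_add_left m_comp_add_right m_comp_scale_left
        m_comp_scale_right i d kink_right m_scale_scale m_add_scale add.assoc m_add_assoc)
qed

text \<open>In E S E both outer factors avoid the strand being closed, so only S is traced, and the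
  two factors merge by idempotence.\<close>

lemma turnback_E:
  "st k m_cap 0 \<circ>\<^sub>B st 0 (E (Suc k)) 1 \<circ>\<^sub>B st k m_cup 0 = S_kappa k *\<^sub>B E k"
proof (cases k)
  case 0
  have k: "S_kappa 0 = dimV" by (simp add: S_kappa_def S_1)
  have "st 0 (E (Suc 0)) 1 = m_id 2" 
  proof -
    have "(0::nat) + 1 + 1 = 2" by simp
    then show ?thesis by (simp only: E.simps st_id)
  qed
  then show ?thesis by (simp only: 0 k st_0 m_id_comp[OF hom_cup] skein_loop E.simps)
next
  case (Suc m)
  define x where "x = \<q> ^ Suc m"
  have hE: "st 0 (E (Suc m)) 1 \<in> m_hom (m + 2) (m + 2)" "st m (S_mor x) 0 \<in> m_hom (m + 2) (m + 2)"
    by (rule hom_st[OF hom_E] hom_st[OF hom_S]; simp)+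
  have e: "st 0 (E (Suc k)) 1 = st 0 (E (Suc m)) 2 \<circ>\<^sub>B st m (S_mor x) 1 \<circ>\<^sub>B st 0 (E (Suc m)) 2"
    unfolding Suc E_step[of m] x_def[symmetric]
    by (simp only: st_comp[OF hom_comp[OF hE(2,1)] hE(1)] st_comp[OF hE(1,2)] st_st) (simp add: nat_norm del: E.simps)
  have c1: "st (m + 1) m_cap 0 \<circ>\<^sub>B st 0 (E (Suc m)) 2 = E (Suc m) \<circ>\<^sub>B st (m + 1) m_cap 0"
    using st_commute[OF hom_E hom_cap, where i = 0 and k = 0 and j = 0, OF HOL.refl HOL.refl HOL.refl HOL.refl, of "Suc m"]
    by (simp add: nat_norm del: E.simps)
  have c2: "st 0 (E (Suc m)) 2 \<circ>\<^sub>B st (m + 1) m_cup 0 = st (m + 1) m_cup 0 \<circ>\<^sub>B E (Suc m)"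
    using st_commute[OF hom_E hom_cup, where i = 0 and k = 0 and j = 0, OF HOL.refl HOL.refl HOL.refl HOL.refl, of "Suc m"]
    by (simp add: nat_norm del: E.simps)
  have h3: "st 1 m_cap 0 \<in> m_hom 3 1" "st 0 (S_mor x) 1 \<in> m_hom 3 3" "st 1 m_cup 0 \<in> m_hom 1 3"
    by (rule hom_st[OF hom_cap] hom_st[OF hom_S] hom_st[OF hom_cup]; simp)+
  have t: "st (m + 1) m_cap 0 \<circ>\<^sub>B st m (S_mor x) 1 \<circ>\<^sub>B st (m + 1) m_cup 0 = S_kappa k *\<^sub>B m_id (Suc m)"
    using arg_cong[OF turnback_S[of x], of "\<lambda>f. st m f 0"]
    by (simp add: st_comp[OF hom_comp[OF h3(2,3)] h3(1)] st_comp[OF h3(3,2)] st_scale S_kappa_def Suc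
        x_def[symmetric] power_Suc[symmetric] del: power_Suc, simp add: nat_norm)
  have "st k m_cap 0 \<circ>\<^sub>B st 0 (E (Suc k)) 1 \<circ>\<^sub>B st k m_cup 0 =
      (st (m + 1) m_cap 0 \<circ>\<^sub>B st 0 (E (Suc m)) 2) \<circ>\<^sub>B st m (S_mor x) 1 \<circ>\<^sub>B st 0 (E (Suc m)) 2 \<circ>\<^sub>B st (m + 1) m_cup 0"
    by (simp only: e m_comp_assoc) (simp only: Suc Suc_eq_plus1)
  also have "\<dots> = E (Suc m) \<circ>\<^sub>B (st (m + 1) m_cap 0 \<circ>\<^sub>B st m (S_mor x) 1 \<circ>\<^sub>B st (m + 1) m_cup 0) \<circ>\<^sub>B E (Suc m)"
    by (simp only: c1 c2 m_comp_assoc)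
  also have "\<dots> = S_kappa k *\<^sub>B E k"
    by (simp only: t m_comp_scale_left m_comp_scale_right m_id_comp[OF hom_E] E_idem Suc)
  finally show ?thesis .
qed

lemma cap_E_commute:
  assumes "Y \<in> m_hom 0 (i + k + j)"
  shows "st (i + k) m_cap j \<circ>\<^sub>B st i (E (Suc k)) (1 + j) \<circ>\<^sub>B st (i + k) m_cup j \<circ>\<^sub>B Y =
     S_kappa k *\<^sub>B (st i (E k) j \<circ>\<^sub>B Y)"
proof -
  have h: "st k m_cap 0 \<in> m_hom (k + 2) k" "st 0 (E (Suc k)) 1 \<in> m_hom (k + 2) (k + 2)"
    "st k m_cup 0 \<in> m_hom k (k + 2)"
    by (rule hom_st[OF hom_cap] hom_st[OF hom_E] hom_st[OF hom_cup]; simp)+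
  have "st i (st k m_cap 0 \<circ>\<^sub>B st 0 (E (Suc k)) 1 \<circ>\<^sub>B st k m_cup 0) j = S_kappa k *\<^sub>B st i (E k) j"
    by (simp only: turnback_E st_scale)
  then have "st (i + k) m_cap j \<circ>\<^sub>B st i (E (Suc k)) (1 + j) \<circ>\<^sub>B st (i + k) m_cup j = S_kappa k *\<^sub>B st i (E k) j"
    by (simp only: st_comp[OF hom_comp[OF h(2,3)] h(1)] st_comp[OF h(3,2)] st_st add_0_right add_0_left)
  from arg_cong[OF this, of "\<lambda>f. f \<circ>\<^sub>B Y"] show ?thesis
    by (simp only: m_comp_assoc m_comp_scale_left)
qed

context clifford_functional
begin

text \<open>With E(k+2) in place of E(k+1) the value would be zero, because a crossing inserted
  above the cup gives \<open>kink\<close> from the cup and -q^-1 from E. Splitting E(k+2) by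
  \<open>phi_E_step\<close> then expresses the wanted value through the partial trace of
  E(k+1).\<close>

lemma phi_E_cup:
  assumes h: "h \<in> m_hom 0 (i + k + j)"
  shows "\<phi> (i + (k + 2) + j) (st i (E (Suc k)) (1 + j) \<circ>\<^sub>B st (i + k) m_cup j \<circ>\<^sub>B h) =
    \<iota> (fierz_s (Suc k)) * \<phi> (i + k + j) (st i (E k) j \<circ>\<^sub>B h)"
proof -
  define g where "g = st (i + k) m_cup j \<circ>\<^sub>B h"
  have g: "g \<in> m_hom 0 (i + (k + 2) + j)" unfolding g_def
    by (rule hom_comp[OF hom_st[OF hom_cup] h]) simp_all
  have hEk: "st i (E k) j \<circ>\<^sub>B h \<in> m_hom 0 (i + k + j)"
    by (rule hom_comp[OF hom_st[OF hom_E] h]) simp_all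
  have "\<phi> (i + (k + 2) + j) (st i (E (Suc (Suc k))) j \<circ>\<^sub>B g) = 0"
  proof (rule eigen_neq_zero)
    show "st i (E (Suc (Suc k))) j \<circ>\<^sub>B g \<in> m_hom 0 (i + (k + 2) + j)"
      by (rule hom_comp[OF hom_st[OF hom_E] g]) simp_all
    have hc: "st k m_cross 0 \<in> m_hom (Suc (Suc k)) (Suc (Suc k))" by (rule hom_st[OF hom_cross]) simp_all
    have 1: "st i (E (Suc (Suc k))) j \<circ>\<^sub>B st (i + k) m_cross j = (- inverse \<q>) *\<^sub>B st i (E (Suc (Suc k))) j"
      using st_comp[OF hc hom_E, of i j] E_cross(2)[of k 0 "Suc (Suc k)"] by (simp add: st_scale del: E.simps)
    have 2: "st (i + k) m_cross j \<circ>\<^sub>B g = kink *\<^sub>B g"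
      by (simp only: g_def m_comp_assoc[symmetric] st_comp[OF hom_cup hom_cross, symmetric] cross_cup st_scale
          m_comp_scale_left)
    have "kink *\<^sub>B (st i (E (Suc (Suc k))) j \<circ>\<^sub>B g) = (st i (E (Suc (Suc k))) j \<circ>\<^sub>B st (i + k) m_cross j) \<circ>\<^sub>B g"
      by (simp only: 2 m_comp_assoc m_comp_scale_right)
    then show "kink *\<^sub>B (st i (E (Suc (Suc k))) j \<circ>\<^sub>B g) = (- inverse \<q>) *\<^sub>B (st i (E (Suc (Suc k))) j \<circ>\<^sub>B g)"
      by (simp only: 1 m_comp_scale_left)
  qed
  with phi_E_step[OF g] have "\<phi> (i + (k + 2) + j) (st i (E (Suc k)) (1 + j) \<circ>\<^sub>B g) =
      - \<iota> (fierz_r (Suc k)) * \<phi> (i + k + j) (st (i + k) m_cap j \<circ>\<^sub>B st i (E (Suc k)) (1 + j) \<circ>\<^sub>B g)"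
    by (simp only: eq_neg_iff_add_eq_0 mult_minus_left)
  also have "\<dots> = \<iota> (- fierz_r (Suc k) * S_kappa k) * \<phi> (i + k + j) (st i (E k) j \<circ>\<^sub>B h)"
    by (simp only: g_def cap_E_commute[OF h] phi_scale[OF hEk]) (simp add: embed_mult)
  finally show ?thesis by (simp only: fierz_s_eq g_def)
qed

text \<open>The mirror image of \<open>phi_E_cup\<close>, for the cup left by
  \<open>cap_chords\<close>, which meets \<open>E\<close> at its first strand.\<close>

lemma phi_cup_E:
  assumes h: "h \<in> m_hom 0 (i + k + j)"
  shows "\<phi> (i + (k + 2) + j) (st (i + 1) (E (Suc k)) j \<circ>\<^sub>B st i m_cup (k + j) \<circ>\<^sub>B h) =
    \<iota> (fierz_s (Suc k)) * \<phi> (i + k + j) (st i (E k) j \<circ>\<^sub>B h)"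
proof -
  interpret M: clifford_functional \<iota> "\<lambda>p f. \<phi> p (m_mirror f)"
    by (rule clifford_functional_mirror) unfold_locales
  have h': "m_mirror h \<in> m_hom 0 (j + k + i)" by (rule hom_cast[OF hom_mirror[OF h]]) simp_all
  show ?thesis
    using M.phi_E_cup[OF h'] by (simp only: m_mirror_simps m_mirror_st m_mirror_E add_ac)
qed

end

section \<open>Removal of chords\<close>

lemma chord_Suc: "chord (Suc b) = st (b + 1) m_cross 0 \<circ>\<^sub>B st 0 (chord b) 1"
proof -
  have h: "st 0 m_cup b \<in> m_hom b (b + 2)" "st 1 (braid_one b) 0 \<in> m_hom (b + 2) (b + 2)"
    by (rule hom_st[OF hom_cup] hom_st[OF hom_braid_one]; simp)+
  have h': "st b m_cross 0 \<in> m_hom (b + 2) (b + 2)" "st 0 (braid_one b) 1 \<in> m_hom (b + 2) (b + 2)"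
    by (rule hom_st[OF hom_cross] hom_st[OF hom_braid_one]; simp)+
  have "st 1 (braid_one (Suc b)) 0 = st (b + 1) m_cross 0 \<circ>\<^sub>B st 1 (braid_one b) 1"
    by (simp only: braid_one_Suc st_comp[OF h'(2,1)] st_st) (simp add: nat_norm)
  moreover have "st 0 (chord b) 1 = st 1 (braid_one b) 1 \<circ>\<^sub>B st 0 m_cup (Suc b)"
    by (simp only: chord_def st_comp[OF h] st_st) (simp add: nat_norm)
  ultimately show ?thesis by (simp only: chord_def[of "Suc b"] m_comp_assoc)
qed

text \<open>The cap slides inwards along the right leg. Each crossing it passes turns into an
  inverse crossing of two strands of \<open>Y\<close>, with eigenvalue -q, and the remaining zigzag
  is straightened.\<close>

lemma cap_chord:
  assumes "Y \<in> m_hom n (i + Suc b + j)" "alternating i (Suc b) j Y"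
  shows "st (i + b + 1) m_cap j \<circ>\<^sub>B st i (chord b) (1 + j) \<circ>\<^sub>B Y = ((- \<q>) ^ b) *\<^sub>B Y"
  using assms
proof (induction b arbitrary: j)
  case 0
  have h: "st 0 m_cup 1 \<in> m_hom 1 3" "st 1 m_cap 0 \<in> m_hom 3 1"
    by (rule hom_st[OF hom_cup] hom_st[OF hom_cap]; simp)+
  have Y: "Y \<in> m_hom n (i + 1 + j)" by (rule hom_cast[OF 0(1)]) simp_all
  have "st (i + 1) m_cap j \<circ>\<^sub>B st i m_cup (1 + j) = m_id (i + 1 + j)"
    using arg_cong[OF zigzag_right, of "\<lambda>f. st i f j"] by (simp only: st_comp[OF h] st_st st_id add_0_left add_0_right)
  then have "st (i + 1) m_cap j \<circ>\<^sub>B st i m_cup (1 + j) \<circ>\<^sub>B Y = Y"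
    by (simp only: m_comp_assoc[symmetric] m_id_comp[OF Y])
  then show ?case by (simp add: chord_0)
next
  case (Suc b)
  have h: "st 0 m_cap 1 \<in> m_hom 3 1" "st 1 m_cap 0 \<in> m_hom 3 1"
    "st 1 m_cross_inv 0 \<in> m_hom 3 3" "st 0 m_cross 1 \<in> m_hom 3 3"
    by (rule hom_st[OF hom_cap] hom_st[OF hom_cross] hom_st[OF hom_cross_inv]; simp)+
  have cs: "st (i + b + 1) m_cap (1 + j) \<circ>\<^sub>B st (i + b + 2) m_cross_inv j =
     st (i + b + 2) m_cap j \<circ>\<^sub>B st (i + b + 1) m_cross (1 + j)"
    using st_eq_comp[OF cap_slide' h(3,1,4,2), of "i + b + 1" j] by (simp, simp add: nat_norm)
  have hc: "st (b + 1) m_cross 0 \<in> m_hom (b + 3) (b + 3)" "st 0 (chord b) 1 \<in> m_hom (b + 1) (b + 3)"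
    by (rule hom_st[OF hom_chord] hom_st[OF hom_cross]; simp)+
  have e: "st i (chord (Suc b)) (1 + j) = st (i + b + 1) m_cross (1 + j) \<circ>\<^sub>B st i (chord b) (1 + (1 + j))"
    by (simp only: chord_Suc st_comp[OF hc(2,1)] st_st) (simp add: nat_norm)
  have c: "st (i + b + 2) m_cross_inv j \<circ>\<^sub>B st i (chord b) (1 + (1 + j)) =
     st i (chord b) (1 + (1 + j)) \<circ>\<^sub>B st (i + b) m_cross_inv j"
    by (rule st_commute[OF hom_chord hom_cross_inv, where k = 0]) simp_all
  have Y: "Y \<in> m_hom n (i + b + 2 + j)" "Y \<in> m_hom n (i + Suc b + (1 + j))"
    by (rule hom_cast[OF Suc.prems(1)]; simp)+
  have ev: "st (i + b) m_cross j \<circ>\<^sub>B Y = (- inverse \<q>) *\<^sub>B Y"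
    by (rule alternatingD[OF Suc.prems(2), of b 0]) simp_all
  have a: "alternating i (Suc b) (1 + j) Y"
    by (rule alternating_mono[OF Suc.prems(2)]) simp_all
  have "st (i + Suc b + 1) m_cap j \<circ>\<^sub>B st i (chord (Suc b)) (1 + j) \<circ>\<^sub>B Y =
     (st (i + b + 2) m_cap j \<circ>\<^sub>B st (i + b + 1) m_cross (1 + j)) \<circ>\<^sub>B st i (chord b) (1 + (1 + j)) \<circ>\<^sub>B Y"
    by (simp only: e m_comp_assoc) (simp add: nat_norm)
  also have "\<dots> = st (i + b + 1) m_cap (1 + j) \<circ>\<^sub>B (st (i + b + 2) m_cross_inv j \<circ>\<^sub>B st i (chord b) (1 + (1 + j))) \<circ>\<^sub>B Y"
    by (simp only: cs[symmetric] m_comp_assoc)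
  also have "\<dots> = st (i + b + 1) m_cap (1 + j) \<circ>\<^sub>B st i (chord b) (1 + (1 + j)) \<circ>\<^sub>B st (i + b) m_cross_inv j \<circ>\<^sub>B Y"
    by (simp only: c m_comp_assoc)
  also have "\<dots> = (- \<q>) *\<^sub>B (- \<q>) ^ b *\<^sub>B Y"
    by (simp only: cross_inv_eigen[OF Y(1) ev] m_comp_scale_right Suc.IH[OF Y(2) a])
  finally show ?case by simp
qed

context clifford_functional
begin

text \<open>The Clifford relation at the last crossing of the right leg leaves the capped chord,
  evaluated by \<open>cap_chord\<close>, and a chord around one strand fewer. This is the recursion
  \<open>fierz_l_Suc\<close>, with initial value \<delta> for a chord around nothing.\<close>

lemma phi_chord:
  "\<lbrakk>Y \<in> m_hom 0 (i + b + j); alternating i b j Y\<rbrakk> \<Longrightarrow>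
   \<phi> (i + (b + 2) + j) (st i (chord b) j \<circ>\<^sub>B Y) = \<iota> (fierz_l b) * \<phi> (i + b + j) Y"
proof (induction b arbitrary: j)
  case 0
  have "fierz_l 0 = \<delta>" by (simp add: fierz_l_def qint_def loop_def power_int_minus)
  then show ?case using phi_cup[of Y i j] 0 by (simp add: chord_0)
next
  case (Suc b)
  define g where "g = st i (chord b) (1 + j) \<circ>\<^sub>B Y"
  have Y: "Y \<in> m_hom 0 (i + b + (1 + j))" by (rule hom_cast[OF Suc.prems(1)]; simp)
  have a: "alternating i b (1 + j) Y" by (rule alternating_mono[OF Suc.prems(2)]) simp_all
  have g: "g \<in> m_hom 0 (i + b + 1 + 2 + j)" unfolding g_def
    by (rule hom_comp[OF hom_st[OF hom_chord] Y]) simp_all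
  have hc: "st (b + 1) m_cross 0 \<in> m_hom (b + 3) (b + 3)" "st 0 (chord b) 1 \<in> m_hom (b + 1) (b + 3)"
    by (rule hom_st[OF hom_chord] hom_st[OF hom_cross]; simp)+
  have e: "st i (chord (Suc b)) j \<circ>\<^sub>B Y = st (i + b + 1) m_cross j \<circ>\<^sub>B g"
    unfolding g_def m_comp_assoc[symmetric]
    by (simp only: chord_Suc st_comp[OF hc(2,1)] st_st) (simp add: nat_norm)
  have n: "i + (Suc b + 2) + j = i + b + 1 + 2 + j" "i + b + 1 + j = i + Suc b + j" 
    "i + (b + 2) + (1 + j) = i + b + 1 + 2 + j" "i + b + (1 + j) = i + Suc b + j" by simp_all
  have 1: "\<phi> (i + b + 1 + 2 + j) g = \<iota> (fierz_l b) * \<phi> (i + Suc b + j) Y"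
    using Suc.IH[OF Y a] unfolding g_def n .
  have "\<phi> (i + (Suc b + 2) + j) (st i (chord (Suc b)) j \<circ>\<^sub>B Y) =
     \<iota> (inverse \<z>) * \<phi> (i + b + 1 + j) (st (i + b + 1) m_cap j \<circ>\<^sub>B g) - \<iota> (inverse \<q>) * \<phi> (i + b + 1 + 2 + j) g"
    unfolding e n(1) by (rule phi_cross[OF g])
  also have "\<dots> = \<iota> (inverse \<z> * (- \<q>) ^ b - inverse \<q> * fierz_l b) * \<phi> (i + Suc b + j) Y"
    unfolding g_def[unfolded, symmetric] 1
    by (simp only: g_def cap_chord[OF Suc.prems] n(2) phi_scale[OF Suc.prems(1)])
      (simp add: embed_mult left_diff_distrib mult.assoc)
  finally show ?case by (simp only: fierz_l_Suc)
qed

text \<open>In the term of \<open>phi_E_step\<close> without a cap the innermost chord is free of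
  \<open>E\<close> and is removed by \<open>phi_chord\<close>. In the other term \<open>E\<close> is
  moved to the right legs, after which the cap reaches the two innermost chords and
  \<open>cap_chords\<close> applies.\<close>

lemma phi_chords_Suc_Suc:
  assumes X: "X \<in> m_hom 0 (b + j)" and aX: "alternating 0 b j X"
  defines "F \<equiv> \<lambda>a. \<phi> (a + b + a + j) (st 0 (E a) (b + a + j) \<circ>\<^sub>B chords a b j X)"
  shows "F (Suc (Suc k)) = \<iota> (fierz_l b) * F (Suc k) + \<iota> (fierz_r (Suc k) * fierz_s (Suc k)) * F k"
proof -
  define a where "a = Suc k"
  define J where "J = b + (k + 2) + j"
  define Y0 where "Y0 = chords k b j X"
  define Y where "Y = chords a b j X"
  define Y' where "Y' = chords (Suc a) b j X"
  have hY0: "Y0 \<in> m_hom 0 (k + b + k + j)" and hY: "Y \<in> m_hom 0 (a + b + a + j)"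
    and hY': "Y' \<in> m_hom 0 (Suc a + b + Suc a + j)"
    unfolding Y0_def Y_def Y'_def by (rule hom_chords[OF X])+
  have hY'1: "Y' \<in> m_hom 0 (0 + (k + 2) + J)" by (rule hom_cast[OF hY']) (simp_all add: a_def J_def)
  have Y': "Y' = st a (chord b) (a + j) \<circ>\<^sub>B Y" by (simp add: Y'_def Y_def)
  define g where "g = st 0 (E a) (b + a + j) \<circ>\<^sub>B Y"
  have hg: "g \<in> m_hom 0 (a + b + (a + j))" unfolding g_def
    by (rule hom_comp[OF hom_st[OF hom_E] hY]) simp_all
  have EY': "st 0 (E a) (1 + J) \<circ>\<^sub>B Y' = st a (chord b) (a + j) \<circ>\<^sub>B g"
  proof -
    have "st 0 (E a) (1 + J) \<circ>\<^sub>B st a (chord b) (a + j) = st a (chord b) (a + j) \<circ>\<^sub>B st 0 (E a) (b + a + j)"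
      by (rule st_commute[OF hom_E hom_chord, where k = 0, symmetric]) (simp_all add: J_def a_def)
    then show ?thesis unfolding Y' g_def by (simp only: m_comp_assoc[symmetric])
  qed
  have ag: "alternating a b (a + j) g" unfolding g_def
  proof (rule alternating_comp)
    show "alternating a b (a + j) Y" unfolding Y_def by (rule alternating_chords[OF aX])
    fix m l assume "m + 2 + l = b"
    then show "st (a + m) m_cross (l + (a + j)) \<circ>\<^sub>B st 0 (E a) (b + a + j) =
        st 0 (E a) (b + a + j) \<circ>\<^sub>B st (a + m) m_cross (l + (a + j))"
      by (intro st_commute[OF hom_E hom_cross, where k = m]) simp_all
  qed
  have 1: "\<phi> (k + 2 + J) (st 0 (E a) (1 + J) \<circ>\<^sub>B Y') = \<iota> (fierz_l b) * F a"
  proof -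
    have n: "k + 2 + J = a + (b + 2) + (a + j)" "a + b + (a + j) = a + b + a + j" by (simp_all add: J_def a_def)
    show ?thesis unfolding EY' n(1) phi_chord[OF hg ag] unfolding F_def g_def n(2) Y_def ..
  qed
  have 2: "\<phi> (k + J) (st k m_cap J \<circ>\<^sub>B st 0 (E a) (1 + J) \<circ>\<^sub>B Y') = \<iota> (fierz_s a) * F k"
  proof -
    have g2: "g = st (a + b) (E a) j \<circ>\<^sub>B Y" unfolding g_def Y_def by (rule E_chords[OF X])
    have c1: "st a (chord b) (a + j) \<circ>\<^sub>B st (a + b) (E a) j = st (a + b + 2) (E a) j \<circ>\<^sub>B st a (chord b) (a + j)"
      by (rule st_commute[OF hom_chord hom_E, where k = 0, symmetric]) simp_all
    have c2: "st k m_cap J \<circ>\<^sub>B st (a + b + 2) (E a) j = st (k + b + 1) (E a) j \<circ>\<^sub>B st k m_cap J"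
      by (rule st_commute[OF hom_cap hom_E, where k = "b + 1", symmetric]) (simp_all add: J_def a_def)
    have J: "J = b + 2 + (k + j)" by (simp add: J_def)
    have "st k m_cap J \<circ>\<^sub>B st 0 (E a) (1 + J) \<circ>\<^sub>B Y' = st k m_cap J \<circ>\<^sub>B (st a (chord b) (a + j) \<circ>\<^sub>B st (a + b) (E a) j) \<circ>\<^sub>B Y"
      by (simp only: EY' g2 m_comp_assoc)
    also have "\<dots> = (st k m_cap J \<circ>\<^sub>B st (a + b + 2) (E a) j) \<circ>\<^sub>B Y'"
      by (simp only: c1 m_comp_assoc Y')
    also have "\<dots> = st (k + b + 1) (E a) j \<circ>\<^sub>B st k m_cap J \<circ>\<^sub>B Y'" by (simp only: c2 m_comp_assoc)
    also have "st k m_cap J \<circ>\<^sub>B Y' = st (k + b) m_cup (k + j) \<circ>\<^sub>B Y0"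
      unfolding J Y'_def a_def Y0_def by (rule cap_chords)
    finally have e: "st k m_cap J \<circ>\<^sub>B st 0 (E a) (1 + J) \<circ>\<^sub>B Y' =
      st (k + b + 1) (E a) j \<circ>\<^sub>B st (k + b) m_cup (k + j) \<circ>\<^sub>B Y0" .
    have n: "k + J = (k + b) + (k + 2) + j" by (simp add: J_def)
    show ?thesis
      \<comment> \<open>The contraction leaves \<open>E k\<close> on the right legs;
        \<open>E_chords\<close> brings \<open>F k\<close> into the same form.\<close>
      unfolding e n unfolding a_def phi_cup_E[OF hY0] unfolding F_def Y0_def E_chords[OF X] ..
  qed
  have "F (Suc a) = \<phi> (0 + (k + 2) + J) (st 0 (E (Suc (Suc k))) J \<circ>\<^sub>B Y')"
    unfolding F_def Y'_def a_def J_def by (simp add: add.assoc del: E.simps chords.simps)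
  also have "\<dots> = \<iota> (fierz_l b) * F a + \<iota> (fierz_r a) * (\<iota> (fierz_s a) * F k)"
    unfolding phi_E_step[OF hY'1] using 1 2 by (simp only: add_0_left a_def)
  finally show ?thesis by (simp add: a_def embed_mult mult.assoc)
qed

lemma phi_chords_Suc_0:
  assumes X: "X \<in> m_hom 0 (b + j)" and aX: "alternating 0 b j X"
  defines "F \<equiv> \<lambda>a. \<phi> (a + b + a + j) (st 0 (E a) (b + a + j) \<circ>\<^sub>B chords a b j X)"
  shows "F (Suc 0) = \<iota> (fierz_l b) * F 0" "F 0 = \<phi> (b + j) X"
proof -
  show 0: "F 0 = \<phi> (b + j) X" using m_id_comp[OF X] by (simp add: F_def add.commute)
  have h: "st 0 (chord b) j \<circ>\<^sub>B X \<in> m_hom 0 (0 + 1 + (b + 1 + j))"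
    by (rule hom_comp[OF hom_st[OF hom_chord] X]) simp_all
  have "st 0 (E (Suc 0)) (b + 1 + j) \<circ>\<^sub>B st 0 (chord b) j \<circ>\<^sub>B X = st 0 (chord b) j \<circ>\<^sub>B X"
    by (simp only: E.simps st_id m_id_comp[OF h])
  then have "F (Suc 0) = \<phi> (0 + (b + 2) + j) (st 0 (chord b) j \<circ>\<^sub>B X)"
    by (simp add: F_def One_nat_def del: E.simps)
  also have "\<dots> = \<iota> (fierz_l b) * F 0"
    using phi_chord[of X 0 b j] X aX 0 by simp
  finally show "F (Suc 0) = \<iota> (fierz_l b) * F 0" .
qed

lemma phi_nested_cup:
  "\<phi> (b + b) (st 0 (E b) b \<circ>\<^sub>B nested_cup b) = \<iota> (\<Prod>k<b. fierz_s (Suc k)) * \<phi> 0 (m_id 0)"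
proof (induction b)
  case 0
  show ?case using m_id_comp[OF hom_id[OF HOL.refl], of 0] by (simp add: embed_one)
next
  case (Suc b)
  have h: "nested_cup b \<in> m_hom 0 (0 + b + b)" using hom_nested_cup by simp
  have "\<phi> (Suc b + Suc b) (st 0 (E (Suc b)) (Suc b) \<circ>\<^sub>B nested_cup (Suc b)) =
     \<phi> (0 + (b + 2) + b) (st 0 (E (Suc b)) (1 + b) \<circ>\<^sub>B st (0 + b) m_cup b \<circ>\<^sub>B nested_cup b)"
    unfolding nested_cup_Suc by (simp del: E.simps nested_cup.simps) (simp add: nat_norm del: E.simps)
  also have "\<dots> = \<iota> (fierz_s (Suc b)) * \<phi> (b + b) (st 0 (E b) b \<circ>\<^sub>B nested_cup b)"
    unfolding phi_E_cup[OF h] by simp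
  finally show ?case by (simp only: Suc) (simp add: embed_mult mult_ac)
qed

end

section \<open>The functional of a spinor theory\<close>

context linear_strict_monoidal_category
begin

lemma Tens_Comp_right:
  assumes "W \<in> Obj C" "X \<in> Obj C" "Y \<in> Obj C" "Z \<in> Obj C" "a \<in> Hom C X Y" "b \<in> Hom C Y Z"
  shows "Id C W \<otimes> (b \<cdot> a) = (Id C W \<otimes> b) \<cdot> (Id C W \<otimes> a)"
proof -
  have "Id C W \<cdot> Id C W = Id C W" using assms by (simp add: Comp_Id[where X = W and Y = W] Id_in_Hom)
  then show ?thesis
    using interchange[where X = W and Y = W and Z = W and f = "Id C W" and g = "Id C W", OF _ _ _ assms(2-4) _ _ assms(5,6)]
    by (simp add: assms Id_in_Hom)
qed

lemma Tens_Comp_left: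
  assumes "W \<in> Obj C" "X \<in> Obj C" "Y \<in> Obj C" "Z \<in> Obj C" "a \<in> Hom C X Y" "b \<in> Hom C Y Z"
  shows "(b \<cdot> a) \<otimes> Id C W = (b \<otimes> Id C W) \<cdot> (a \<otimes> Id C W)"
proof -
  have "Id C W \<cdot> Id C W = Id C W" using assms by (simp add: Comp_Id[where X = W and Y = W] Id_in_Hom)
  then show ?thesis
    using interchange[where X' = W and Y' = W and Z' = W and f' = "Id C W" and g' = "Id C W", OF assms(2-4) _ _ _ assms(5,6)]
    by (simp add: assms Id_in_Hom)
qed

lemma Tens_exchange:
  assumes "X \<in> Obj C" "Y \<in> Obj C" "X' \<in> Obj C" "Y' \<in> Obj C" "f \<in> Hom C X Y" "g \<in> Hom C X' Y'"
  shows "(Id C Y \<otimes> g) \<cdot> (f \<otimes> Id C X') = f \<otimes> g" "(f \<otimes> Id C Y') \<cdot> (Id C X \<otimes> g) = f \<otimes> g"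
proof -
  show "(Id C Y \<otimes> g) \<cdot> (f \<otimes> Id C X') = f \<otimes> g"
    using interchange[OF assms(1,2,2) assms(3,3,4) assms(5) Id_in_Hom[OF assms(2)] Id_in_Hom[OF assms(3)] assms(6)]
      Id_Comp[OF assms(1,2,5)] Comp_Id[OF assms(3,4,6)] by simp
  show "(f \<otimes> Id C Y') \<cdot> (Id C X \<otimes> g) = f \<otimes> g"
    using interchange[OF assms(1,1,2) assms(3,4,4) Id_in_Hom[OF assms(1)] assms(5) assms(6) Id_in_Hom[OF assms(4)]]
      Comp_Id[OF assms(1,2,5)] Id_Comp[OF assms(3,4,6)] by simp
qed

end

lemma B_simps [simp]:
  "Obj B = UNIV" "Hom B = m_hom" "Id B = m_id" "Comp B = m_comp" "Add B = m_add"
  "Scale B = m_scale" "Unit B = 0" "OTens B = (+)" "Tens B = m_tens"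
  by (simp_all add: B_def)

context spinor_theory
begin

abbreviation "\<Gamma> \<equiv> spin_gamma C (Fo 1) S \<gamma>"

lemma Fo_Obj [simp]: "Fo p \<in> Obj C" using Fo_in_Obj by simp
lemma Fo_0 [simp]: "Fo 0 = \<one>" using Fo_Unit by simp
lemma Fo_add: "Fo (p + q) = Fo p \<odot> Fo q" using Fo_OTens by simp

declare S_in_Obj [simp] Unit_in_Obj [simp] OTens_in_Obj [simp] Dual_in_Obj [simp]

lemma Fo_Suc: "Fo (Suc p) = Fo 1 \<odot> Fo p" using Fo_add[of 1 p] by (simp only: plus_1_eq_Suc)

lemma opower_Fo: "opower C (Fo 1) p = Fo p"
  by (induction p) (simp_all add: Fo_Suc)

lemma Fm_Hom: "f \<in> m_hom p q \<Longrightarrow> Fm f \<in> Hom C (Fo p) (Fo q)" using Fm_in_Hom by simp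
lemma Fm_id: "Fm (m_id p) = Id C (Fo p)" using Fm_Id by simp
lemma Fm_comp: "f \<in> m_hom p q \<Longrightarrow> g \<in> m_hom q r \<Longrightarrow> Fm (g \<circ>\<^sub>B f) = Fm g \<cdot> Fm f" using Fm_Comp by simp
lemma Fm_tens: "f \<in> m_hom p q \<Longrightarrow> g \<in> m_hom p' q' \<Longrightarrow> Fm (f \<otimes>\<^sub>B g) = Fm f \<otimes> Fm g" using Fm_Tens by simp
lemma Fm_add: "f \<in> m_hom p q \<Longrightarrow> g \<in> m_hom p q \<Longrightarrow> Fm (f +\<^sub>B g) = Fm f \<oplus> Fm g" using Fm_Add by simp
lemma Fm_scale: "f \<in> m_hom p q \<Longrightarrow> Fm (a *\<^sub>B f) = \<iota> a \<star> Fm f" using Fm_Scale by simp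

lemma Fm_st:
  assumes "f \<in> m_hom p q"
  shows "Fm (st i f j) = Id C (Fo i) \<otimes> (Fm f \<otimes> Id C (Fo j))"
proof -
  have "f \<otimes>\<^sub>B m_id j \<in> m_hom (p + j) (q + j)" by (rule hom_tens[OF assms hom_id[OF HOL.refl]]) simp_all
  then show ?thesis unfolding st_def
    by (simp add: Fm_tens[OF hom_id[OF HOL.refl]] Fm_tens[OF assms hom_id[OF HOL.refl]] Fm_id)
qed

lemma Gamma_Hom: "\<Gamma> p \<in> Hom C (Fo p \<odot> S) S"
proof (induction p)
  case 0
  then show ?case using Id_in_Hom[of S] by (simp add: Unit_OTens)
next
  case (Suc p)
  have "Id C (Fo 1) \<otimes> \<Gamma> p \<in> Hom C (Fo 1 \<odot> (Fo p \<odot> S)) (Fo 1 \<odot> S)"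
    by (rule Tens_in_Hom[OF _ _ _ _ Id_in_Hom Suc]) simp_all
  then have "\<gamma> \<cdot> (Id C (Fo 1) \<otimes> \<Gamma> p) \<in> Hom C (Fo 1 \<odot> (Fo p \<odot> S)) S"
    by (rule Comp_in_Hom[rotated 3, OF _ \<gamma>_in_Hom]) simp_all
  moreover have "Fo (Suc p) \<odot> S = Fo 1 \<odot> (Fo p \<odot> S)"
    by (simp add: Fo_Suc OTens_assoc)
  ultimately show ?case by simp
qed

lemma Gamma_add: "\<Gamma> (i + k) = \<Gamma> i \<cdot> (Id C (Fo i) \<otimes> \<Gamma> k)"
proof (induction i)
  case 0
  show ?case
    using Unit_Tens[OF _ _ Gamma_Hom[of k]] Id_Comp[OF _ _ Gamma_Hom[of k]] by simp
next
  case (Suc i)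
  have h1: "Id C (Fo i) \<otimes> \<Gamma> k \<in> Hom C (Fo i \<odot> (Fo k \<odot> S)) (Fo i \<odot> S)"
    by (rule Tens_in_Hom[OF _ _ _ _ Id_in_Hom Gamma_Hom]) simp_all
  have h2: "Id C (Fo 1) \<otimes> \<Gamma> i \<in> Hom C (Fo 1 \<odot> (Fo i \<odot> S)) (Fo 1 \<odot> S)"
    by (rule Tens_in_Hom[OF _ _ _ _ Id_in_Hom Gamma_Hom]) simp_all
  have h3: "Id C (Fo 1) \<otimes> (Id C (Fo i) \<otimes> \<Gamma> k) \<in> Hom C (Fo 1 \<odot> (Fo i \<odot> (Fo k \<odot> S))) (Fo 1 \<odot> (Fo i \<odot> S))"
    by (rule Tens_in_Hom[OF _ _ _ _ Id_in_Hom h1]) simp_all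
  have "\<Gamma> (Suc i + k) = \<gamma> \<cdot> (Id C (Fo 1) \<otimes> (\<Gamma> i \<cdot> (Id C (Fo i) \<otimes> \<Gamma> k)))"
    by (simp add: Suc)
  also have "\<dots> = \<gamma> \<cdot> ((Id C (Fo 1) \<otimes> \<Gamma> i) \<cdot> (Id C (Fo 1) \<otimes> (Id C (Fo i) \<otimes> \<Gamma> k)))"
    by (subst Tens_Comp_right[OF _ _ _ _ h1 Gamma_Hom]) simp_all
  also have "\<dots> = \<Gamma> (Suc i) \<cdot> (Id C (Fo 1) \<otimes> (Id C (Fo i) \<otimes> \<Gamma> k))"
    by (simp, rule Comp_assoc[symmetric, OF _ _ _ _ h3 h2 \<gamma>_in_Hom]) simp_all
  also have "Id C (Fo 1) \<otimes> (Id C (Fo i) \<otimes> \<Gamma> k) = (Id C (Fo 1) \<otimes> Id C (Fo i)) \<otimes> \<Gamma> k"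
    by (rule Tens_assoc[symmetric, OF _ _ _ _ _ _ Id_in_Hom Id_in_Hom Gamma_Hom]) simp_all
  also have "Id C (Fo 1) \<otimes> Id C (Fo i) = Id C (Fo (Suc i))"
    by (simp add: Tens_Id Fo_Suc)
  finally show ?case .
qed

text \<open>\<open>\<Gamma> j\<close> acts on strands disjoint from \<open>y\<close> and can be
  applied first; then \<open>y\<close> stands directly beside the spin strand, as in the axioms of a
  spinor theory.\<close>

lemma Gamma_st:
  assumes y: "y \<in> m_hom s r"
  shows "\<Gamma> (i + r + j) \<cdot> (Fm (st i y j) \<otimes> Id C S) =
    \<Gamma> i \<cdot> (Id C (Fo i) \<otimes> ((\<Gamma> r \<cdot> (Fm y \<otimes> Id C S)) \<cdot> (Id C (Fo s) \<otimes> \<Gamma> j)))"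
proof -
  note Fy = Fm_Hom[OF y]
  have hyj: "Fm y \<otimes> Id C (Fo j) \<in> Hom C (Fo s \<odot> Fo j) (Fo r \<odot> Fo j)"
    by (rule Tens_in_Hom[OF _ _ _ _ Fy Id_in_Hom]) simp_all
  have hyjS: "Fm y \<otimes> Id C (Fo j \<odot> S) \<in> Hom C (Fo s \<odot> (Fo j \<odot> S)) (Fo r \<odot> (Fo j \<odot> S))"
    by (rule Tens_in_Hom[OF _ _ _ _ Fy Id_in_Hom]) simp_all
  have hyS: "Fm y \<otimes> Id C S \<in> Hom C (Fo s \<odot> S) (Fo r \<odot> S)"
    by (rule Tens_in_Hom[OF _ _ _ _ Fy Id_in_Hom]) simp_all
  have hrj: "Id C (Fo r) \<otimes> \<Gamma> j \<in> Hom C (Fo r \<odot> (Fo j \<odot> S)) (Fo r \<odot> S)"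
    "Id C (Fo s) \<otimes> \<Gamma> j \<in> Hom C (Fo s \<odot> (Fo j \<odot> S)) (Fo s \<odot> S)"
    by (rule Tens_in_Hom[OF _ _ _ _ Id_in_Hom Gamma_Hom]; simp)+
  have hG: "\<Gamma> (r + j) \<in> Hom C (Fo r \<odot> (Fo j \<odot> S)) S"
    using Gamma_Hom[of "r + j"] by (simp add: Fo_add OTens_assoc)
  have 1: "Fm (st i y j) \<otimes> Id C S = Id C (Fo i) \<otimes> (Fm y \<otimes> Id C (Fo j \<odot> S))"
  proof -
    have "Fm (st i y j) \<otimes> Id C S = Id C (Fo i) \<otimes> ((Fm y \<otimes> Id C (Fo j)) \<otimes> Id C S)"
      unfolding Fm_st[OF y] by (rule Tens_assoc[OF _ _ _ _ _ _ Id_in_Hom hyj Id_in_Hom]) simp_all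
    also have "(Fm y \<otimes> Id C (Fo j)) \<otimes> Id C S = Fm y \<otimes> (Id C (Fo j) \<otimes> Id C S)"
      by (rule Tens_assoc[OF _ _ _ _ _ _ Fy Id_in_Hom Id_in_Hom]) simp_all
    finally show ?thesis by (simp add: Tens_Id)
  qed
  have h1: "Id C (Fo i) \<otimes> (Fm y \<otimes> Id C (Fo j \<odot> S)) \<in> Hom C (Fo i \<odot> (Fo s \<odot> (Fo j \<odot> S))) (Fo i \<odot> (Fo r \<odot> (Fo j \<odot> S)))"
    "Id C (Fo i) \<otimes> \<Gamma> (r + j) \<in> Hom C (Fo i \<odot> (Fo r \<odot> (Fo j \<odot> S))) (Fo i \<odot> S)"
    by (rule Tens_in_Hom[OF _ _ _ _ Id_in_Hom hyjS] Tens_in_Hom[OF _ _ _ _ Id_in_Hom hG]; simp)+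
  have 2: "\<Gamma> (r + j) \<cdot> (Fm y \<otimes> Id C (Fo j \<odot> S)) = (\<Gamma> r \<cdot> (Fm y \<otimes> Id C S)) \<cdot> (Id C (Fo s) \<otimes> \<Gamma> j)"
  proof -
    have "\<Gamma> (r + j) \<cdot> (Fm y \<otimes> Id C (Fo j \<odot> S)) = \<Gamma> r \<cdot> ((Id C (Fo r) \<otimes> \<Gamma> j) \<cdot> (Fm y \<otimes> Id C (Fo j \<odot> S)))"
      unfolding Gamma_add by (rule Comp_assoc[OF _ _ _ _ hyjS hrj(1) Gamma_Hom]) simp_all
    also have "(Id C (Fo r) \<otimes> \<Gamma> j) \<cdot> (Fm y \<otimes> Id C (Fo j \<odot> S)) = (Fm y \<otimes> Id C S) \<cdot> (Id C (Fo s) \<otimes> \<Gamma> j)"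
      by (simp add: Tens_exchange[OF _ _ _ _ Fy Gamma_Hom])
    also have "\<Gamma> r \<cdot> \<dots> = (\<Gamma> r \<cdot> (Fm y \<otimes> Id C S)) \<cdot> (Id C (Fo s) \<otimes> \<Gamma> j)"
      by (rule Comp_assoc[symmetric, OF _ _ _ _ hrj(2) hyS Gamma_Hom]) simp_all
    finally show ?thesis .
  qed
  have "\<Gamma> (i + r + j) = \<Gamma> i \<cdot> (Id C (Fo i) \<otimes> \<Gamma> (r + j))"
    using Gamma_add[of i "r + j"] by (simp add: add.assoc)
  then have "\<Gamma> (i + r + j) \<cdot> (Fm (st i y j) \<otimes> Id C S) =
      \<Gamma> i \<cdot> ((Id C (Fo i) \<otimes> \<Gamma> (r + j)) \<cdot> (Id C (Fo i) \<otimes> (Fm y \<otimes> Id C (Fo j \<odot> S))))"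
    unfolding 1 using Comp_assoc[OF _ _ _ _ h1 Gamma_Hom[of i]] by simp
  also have "(Id C (Fo i) \<otimes> \<Gamma> (r + j)) \<cdot> (Id C (Fo i) \<otimes> (Fm y \<otimes> Id C (Fo j \<odot> S))) =
      Id C (Fo i) \<otimes> (\<Gamma> (r + j) \<cdot> (Fm y \<otimes> Id C (Fo j \<odot> S)))"
    by (rule Tens_Comp_right[symmetric, OF _ _ _ _ hyjS hG]) simp_all
  finally show ?thesis unfolding 2 .
qed

lemma Gamma_st_scale:
  assumes y: "y \<in> m_hom s r" and y': "y' \<in> m_hom s r'"
    and e: "\<Gamma> r \<cdot> (Fm y \<otimes> Id C S) = c \<star> (\<Gamma> r' \<cdot> (Fm y' \<otimes> Id C S))"
  shows "\<Gamma> (i + r + j) \<cdot> (Fm (st i y j) \<otimes> Id C S) = c \<star> (\<Gamma> (i + r' + j) \<cdot> (Fm (st i y' j) \<otimes> Id C S))"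
proof -
  have h1: "Id C (Fo s) \<otimes> \<Gamma> j \<in> Hom C (Fo s \<odot> (Fo j \<odot> S)) (Fo s \<odot> S)"
    by (rule Tens_in_Hom[OF _ _ _ _ Id_in_Hom Gamma_Hom]; simp)
  have "Fm y' \<otimes> Id C S \<in> Hom C (Fo s \<odot> S) (Fo r' \<odot> S)"
    by (rule Tens_in_Hom[OF _ _ _ _ Fm_Hom[OF y'] Id_in_Hom]) simp_all
  then have h2: "\<Gamma> r' \<cdot> (Fm y' \<otimes> Id C S) \<in> Hom C (Fo s \<odot> S) S"
    by (rule Comp_in_Hom[rotated 3, OF _ Gamma_Hom]) simp_all
  have h3: "(\<Gamma> r' \<cdot> (Fm y' \<otimes> Id C S)) \<cdot> (Id C (Fo s) \<otimes> \<Gamma> j) \<in> Hom C (Fo s \<odot> (Fo j \<odot> S)) S"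
    by (rule Comp_in_Hom[rotated 3, OF h1 h2]) simp_all
  have h4: "Id C (Fo i) \<otimes> ((\<Gamma> r' \<cdot> (Fm y' \<otimes> Id C S)) \<cdot> (Id C (Fo s) \<otimes> \<Gamma> j)) \<in> Hom C (Fo i \<odot> (Fo s \<odot> (Fo j \<odot> S))) (Fo i \<odot> S)"
    by (rule Tens_in_Hom[OF _ _ _ _ Id_in_Hom h3]; simp)
  show ?thesis
    unfolding Gamma_st[OF y] Gamma_st[OF y'] e
    using Comp_Scale_left[OF _ _ _ h1 h2, of c] Tens_Scale_right[OF _ _ _ _ Id_in_Hom h3, of "Fo i" c]
      Comp_Scale_right[OF _ _ _ h4 Gamma_Hom, of c] by simp
qed

lemma Ev'_in_Hom: "Ev' C S \<in> Hom C (S \<odot> Dual C S) \<one>"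
proof -
  have t: "Twist C S \<in> Hom C S S" "Braid C S (Dual C S) \<in> Hom C (S \<odot> Dual C S) (Dual C S \<odot> S)"
    using Twist_iso[of S] Braid_iso[of S "Dual C S"] by (simp_all add: is_iso_def)
  have "Twist C S \<otimes> Id C (Dual C S) \<in> Hom C (S \<odot> Dual C S) (S \<odot> Dual C S)"
    by (rule Tens_in_Hom[OF _ _ _ _ t(1) Id_in_Hom]) simp_all
  then have "Braid C S (Dual C S) \<cdot> (Twist C S \<otimes> Id C (Dual C S)) \<in> Hom C (S \<odot> Dual C S) (Dual C S \<odot> S)"
    by (rule Comp_in_Hom[rotated 3, OF _ t(2)]) simp_all
  then show ?thesis unfolding Ev'_def
    by (rule Comp_in_Hom[rotated 3, OF _ Ev_in_Hom]) simp_all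
qed

definition trace_S :: "'m \<Rightarrow> 'm" where
  "trace_S g = Ev' C S \<cdot> ((g \<otimes> Id C (Dual C S)) \<cdot> Coev C S)"

lemma trace_S_scale:
  assumes "g \<in> Hom C S S"
  shows "trace_S (c \<star> g) = c \<star> trace_S g"
proof -
  have h1: "g \<otimes> Id C (Dual C S) \<in> Hom C (S \<odot> Dual C S) (S \<odot> Dual C S)"
    by (rule Tens_in_Hom[OF _ _ _ _ assms Id_in_Hom]) simp_all
  have h2: "(g \<otimes> Id C (Dual C S)) \<cdot> Coev C S \<in> Hom C \<one> (S \<odot> Dual C S)"
    by (rule Comp_in_Hom[rotated 3, OF Coev_in_Hom h1]) simp_all
  show ?thesis
    unfolding trace_S_def
    using Tens_Scale_left[OF _ _ _ _ assms Id_in_Hom, of "Dual C S" c]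
      Comp_Scale_left[OF _ _ _ Coev_in_Hom h1, of c]
      Comp_Scale_right[OF _ _ _ h2 Ev'_in_Hom, of c] by simp
qed

lemma spin_tau_eq: "spin_tau C (Fo 1) S \<gamma> p =
    Ev' C S \<cdot> ((\<Gamma> p \<otimes> Id C (Dual C S)) \<cdot> (Id C (Fo p) \<otimes> Coev C S))"
  using Unit_Tens[OF _ _ Ev'_in_Hom] by (simp add: spin_tau_def partial_trace_def opower_Fo)

text \<open>Filling the free strands with \<open>h\<close> and closing the spin strand concern
  different tensor factors. Relations between endomorphisms of \<open>S\<close> thus pass to values
  of spin loops by linearity of the trace.\<close>

lemma spin_tau_comp:
  assumes h: "h \<in> m_hom 0 p"
  shows "spin_tau C (Fo 1) S \<gamma> p \<cdot> Fm h = trace_S (\<Gamma> p \<cdot> (Fm h \<otimes> Id C S))"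
    and "spin_tau C (Fo 1) S \<gamma> p \<in> Hom C (Fo p) \<one>"
proof -
  let ?D = "Dual C S"
  have Fh: "Fm h \<in> Hom C \<one> (Fo p)" using Fm_Hom[OF h] by simp
  note co = Coev_in_Hom[OF S_in_Obj]
  have h1: "\<Gamma> p \<otimes> Id C ?D \<in> Hom C (Fo p \<odot> (S \<odot> ?D)) (S \<odot> ?D)"
    using Tens_in_Hom[OF _ _ _ _ Gamma_Hom[of p] Id_in_Hom[of ?D]] by (simp add: OTens_assoc)
  have h2: "Id C (Fo p) \<otimes> Coev C S \<in> Hom C (Fo p) (Fo p \<odot> (S \<odot> ?D))"
    using Tens_in_Hom[OF _ _ _ _ Id_in_Hom[of "Fo p"] co] by (simp add: OTens_Unit)
  have h12: "(\<Gamma> p \<otimes> Id C ?D) \<cdot> (Id C (Fo p) \<otimes> Coev C S) \<in> Hom C (Fo p) (S \<odot> ?D)"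
    by (rule Comp_in_Hom[OF _ _ _ h2 h1]) simp_all
  then show "spin_tau C (Fo 1) S \<gamma> p \<in> Hom C (Fo p) \<one>"
    unfolding spin_tau_eq by (rule Comp_in_Hom[OF _ _ _ _ Ev'_in_Hom, rotated 3]) simp_all
  have e1: "(Id C (Fo p) \<otimes> Coev C S) \<cdot> Fm h = (Fm h \<otimes> Id C (S \<odot> ?D)) \<cdot> Coev C S"
    using Tens_exchange[OF _ _ _ _ Fh co] Tens_Unit[OF _ _ Fh] Unit_Tens[OF _ _ co] by simp
  have h3: "Fm h \<otimes> Id C S \<in> Hom C S (Fo p \<odot> S)"
    using Tens_in_Hom[OF _ _ _ _ Fh Id_in_Hom[of S]] by (simp add: Unit_OTens)
  have h4: "Fm h \<otimes> Id C (S \<odot> ?D) \<in> Hom C (S \<odot> ?D) (Fo p \<odot> (S \<odot> ?D))"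
    using Tens_in_Hom[OF _ _ _ _ Fh Id_in_Hom[of "S \<odot> ?D"]] by (simp add: Unit_OTens)
  have e2: "Fm h \<otimes> Id C (S \<odot> ?D) = (Fm h \<otimes> Id C S) \<otimes> Id C ?D"
    using Tens_assoc[OF _ _ _ _ _ _ Fh Id_in_Hom[of S] Id_in_Hom[of ?D]] by (simp add: Tens_Id)
  have "spin_tau C (Fo 1) S \<gamma> p \<cdot> Fm h = Ev' C S \<cdot> (((\<Gamma> p \<otimes> Id C ?D) \<cdot> (Id C (Fo p) \<otimes> Coev C S)) \<cdot> Fm h)"
    unfolding spin_tau_eq by (rule Comp_assoc[OF _ _ _ _ Fh h12 Ev'_in_Hom]) simp_all
  also have "((\<Gamma> p \<otimes> Id C ?D) \<cdot> (Id C (Fo p) \<otimes> Coev C S)) \<cdot> Fm h =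
     (\<Gamma> p \<otimes> Id C ?D) \<cdot> ((Fm h \<otimes> Id C (S \<odot> ?D)) \<cdot> Coev C S)"
    unfolding e1[symmetric] by (rule Comp_assoc[OF _ _ _ _ Fh h2 h1]) simp_all
  also have "\<dots> = ((\<Gamma> p \<otimes> Id C ?D) \<cdot> (Fm h \<otimes> Id C (S \<odot> ?D))) \<cdot> Coev C S"
    by (rule Comp_assoc[symmetric, OF _ _ _ _ co h4 h1]) simp_all
  also have "(\<Gamma> p \<otimes> Id C ?D) \<cdot> (Fm h \<otimes> Id C (S \<odot> ?D)) = (\<Gamma> p \<cdot> (Fm h \<otimes> Id C S)) \<otimes> Id C ?D"
    unfolding e2 by (rule Tens_Comp_left[symmetric, OF _ _ _ _ h3 Gamma_Hom]) simp_all
  finally show "spin_tau C (Fo 1) S \<gamma> p \<cdot> Fm h = trace_S (\<Gamma> p \<cdot> (Fm h \<otimes> Id C S))"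
    unfolding trace_S_def .
qed

section \<open>Scalar values of spin loops\<close>

definition loopval :: "nat \<Rightarrow> mor \<Rightarrow> 'l" where
  "loopval p f = (THE x. x \<star> Id C \<one> = spin_tau C (Fo 1) S \<gamma> p \<cdot> Fm f)"

lemma Id_Unit_scale_cancel: "x \<star> Id C \<one> = y \<star> Id C \<one> \<Longrightarrow> x = y"
  using End_Unit by (auto simp: bij_betw_def inj_on_def)

lemma loopvalI: "x \<star> Id C \<one> = spin_tau C (Fo 1) S \<gamma> p \<cdot> Fm f \<Longrightarrow> loopval p f = x"
  unfolding loopval_def by (rule the_equality) (auto intro: Id_Unit_scale_cancel)

lemma loopval:
  assumes "f \<in> m_hom 0 p"
  shows "loopval p f \<star> Id C \<one> = spin_tau C (Fo 1) S \<gamma> p \<cdot> Fm f"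
proof -
  have "Fm f \<in> Hom C \<one> (Fo p)" using Fm_Hom[OF assms] by simp
  then have "spin_tau C (Fo 1) S \<gamma> p \<cdot> Fm f \<in> Hom C \<one> \<one>"
    by (rule Comp_in_Hom[OF _ _ _ _ spin_tau_comp(2)[OF assms], rotated 3]) simp_all
  then have "spin_tau C (Fo 1) S \<gamma> p \<cdot> Fm f \<in> range (\<lambda>x. x \<star> Id C \<one>)"
    using End_Unit by (simp only: bij_betw_def)
  then obtain x where "x \<star> Id C \<one> = spin_tau C (Fo 1) S \<gamma> p \<cdot> Fm f" by auto
  then show ?thesis using loopvalI by simp
qed

lemma Gamma_comp_Hom:
  assumes "f \<in> m_hom s p"
  shows "Fm f \<otimes> Id C S \<in> Hom C (Fo s \<odot> S) (Fo p \<odot> S)" "\<Gamma> p \<cdot> (Fm f \<otimes> Id C S) \<in> Hom C (Fo s \<odot> S) S"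
proof -
  show 1: "Fm f \<otimes> Id C S \<in> Hom C (Fo s \<odot> S) (Fo p \<odot> S)"
    by (rule Tens_in_Hom[OF _ _ _ _ Fm_Hom[OF assms] Id_in_Hom]) simp_all
  show "\<Gamma> p \<cdot> (Fm f \<otimes> Id C S) \<in> Hom C (Fo s \<odot> S) S"
    by (rule Comp_in_Hom[OF _ _ _ 1 Gamma_Hom]) simp_all
qed

lemma Gamma_comp:
  assumes "f \<in> m_hom s p" "h \<in> m_hom n s"
  shows "\<Gamma> p \<cdot> (Fm (f \<circ>\<^sub>B h) \<otimes> Id C S) = (\<Gamma> p \<cdot> (Fm f \<otimes> Id C S)) \<cdot> (Fm h \<otimes> Id C S)"
  unfolding Fm_comp[OF assms(2,1)]
  using Tens_Comp_left[OF _ _ _ _ Fm_Hom[OF assms(2)] Fm_Hom[OF assms(1)], of S]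
    Comp_assoc[OF _ _ _ _ Gamma_comp_Hom(1)[OF assms(2)] Gamma_comp_Hom(1)[OF assms(1)] Gamma_Hom] by simp

text \<open>Carries a relation beside the spin strand to any position in a closed diagram. The
  numbers of outputs \<open>r\<close> and \<open>r'\<close> may differ because the axioms trade
  crossings for a cap and a cup for nothing.\<close>

lemma loopval_st:
  assumes y: "y \<in> m_hom s r" and y': "y' \<in> m_hom s r'"
    and e: "\<Gamma> r \<cdot> (Fm y \<otimes> Id C S) = c \<star> (\<Gamma> r' \<cdot> (Fm y' \<otimes> Id C S))"
    and h: "h \<in> m_hom 0 (i + s + j)"
  shows "loopval (i + r + j) (st i y j \<circ>\<^sub>B h) = c * loopval (i + r' + j) (st i y' j \<circ>\<^sub>B h)"
proof (rule loopvalI)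
  have st: "st i y j \<in> m_hom (i + s + j) (i + r + j)" "st i y' j \<in> m_hom (i + s + j) (i + r' + j)"
    by (rule hom_st[OF y] hom_st[OF y']; simp)+
  have sth: "st i y j \<circ>\<^sub>B h \<in> m_hom 0 (i + r + j)" "st i y' j \<circ>\<^sub>B h \<in> m_hom 0 (i + r' + j)"
    by (rule hom_comp[OF st(1) h] hom_comp[OF st(2) h])+
  have "\<Gamma> (i + r' + j) \<cdot> (Fm (st i y' j \<circ>\<^sub>B h) \<otimes> Id C S) \<in> Hom C (Fo 0 \<odot> S) S"
    by (rule Gamma_comp_Hom(2)[OF sth(2)])
  then have hS: "\<Gamma> (i + r' + j) \<cdot> (Fm (st i y' j \<circ>\<^sub>B h) \<otimes> Id C S) \<in> Hom C S S"
    by (simp add: Unit_OTens)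
  have "\<Gamma> (i + r + j) \<cdot> (Fm (st i y j \<circ>\<^sub>B h) \<otimes> Id C S) = c \<star> (\<Gamma> (i + r' + j) \<cdot> (Fm (st i y' j \<circ>\<^sub>B h) \<otimes> Id C S))"
    unfolding Gamma_comp[OF st(1) h] Gamma_comp[OF st(2) h] Gamma_st_scale[OF y y' e]
    by (rule Comp_Scale_left[OF _ _ _ Gamma_comp_Hom(1)[OF h] Gamma_comp_Hom(2)[OF st(2)]]) simp_all
  then have "spin_tau C (Fo 1) S \<gamma> (i + r + j) \<cdot> Fm (st i y j \<circ>\<^sub>B h) =
      c \<star> (spin_tau C (Fo 1) S \<gamma> (i + r' + j) \<cdot> Fm (st i y' j \<circ>\<^sub>B h))"
    by (simp only: spin_tau_comp(1)[OF sth(1)] spin_tau_comp(1)[OF sth(2)] trace_S_scale[OF hS])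
  also have "\<dots> = c \<star> (loopval (i + r' + j) (st i y' j \<circ>\<^sub>B h) \<star> Id C \<one>)"
    by (simp only: loopval[OF sth(2)])
  also have "\<dots> = (c * loopval (i + r' + j) (st i y' j \<circ>\<^sub>B h)) \<star> Id C \<one>"
    by (rule Scale_Scale[OF _ _ Id_in_Hom]) simp_all
  finally show "(c * loopval (i + r' + j) (st i y' j \<circ>\<^sub>B h)) \<star> Id C \<one> =
    spin_tau C (Fo 1) S \<gamma> (i + r + j) \<cdot> Fm (st i y j \<circ>\<^sub>B h)" ..
qed

lemma loopval_add:
  assumes f: "f \<in> m_hom 0 p" and g: "g \<in> m_hom 0 p"
  shows "loopval p (f +\<^sub>B g) = loopval p f + loopval p g"
proof (rule loopvalI)
  note t = spin_tau_comp(2)[OF f]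
  show "(loopval p f + loopval p g) \<star> Id C \<one> = spin_tau C (Fo 1) S \<gamma> p \<cdot> Fm (f +\<^sub>B g)"
    unfolding Fm_add[OF f g]
    using Comp_Add_right[OF _ _ _ Fm_Hom[OF f] Fm_Hom[OF g] t] loopval[OF f] loopval[OF g]
      add_Scale[OF _ _ Id_in_Hom[OF Unit_in_Obj], of "loopval p f" "loopval p g"] by simp
qed

lemma loopval_scale:
  assumes f: "f \<in> m_hom 0 p"
  shows "loopval p (a *\<^sub>B f) = \<iota> a * loopval p f"
proof (rule loopvalI)
  note t = spin_tau_comp(2)[OF f]
  show "(\<iota> a * loopval p f) \<star> Id C \<one> = spin_tau C (Fo 1) S \<gamma> p \<cdot> Fm (a *\<^sub>B f)"
    unfolding Fm_scale[OF f]
    using Comp_Scale_right[OF _ _ _ Fm_Hom[OF f] t, of "\<iota> a"] loopval[OF f]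
      Scale_Scale[OF _ _ Id_in_Hom[OF Unit_in_Obj], of "\<iota> a" "loopval p f"] by simp
qed

lemma loopval_clifford: "clifford_functional \<iota> loopval"
proof
  fix h i j assume h: "h \<in> m_hom 0 (i + 2 + j)"
  have cap: "\<Gamma> 0 \<cdot> (Fm m_cap \<otimes> Id C S) = Fm m_cap \<otimes> Id C S"
    using Gamma_comp_Hom(1)[OF hom_cap] Id_Comp[of "Fo 2 \<odot> S" S "Fm m_cap \<otimes> Id C S"] by (simp add: Unit_OTens)
  have hh: "st i m_cross j \<circ>\<^sub>B h \<in> m_hom 0 (i + 2 + j)" "st i m_cross_inv j \<circ>\<^sub>B h \<in> m_hom 0 (i + 2 + j)"
    by (rule hom_comp[OF hom_st[OF hom_cross] h] hom_comp[OF hom_st[OF hom_cross_inv] h]; simp)+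
  have "inverse \<q> *\<^sub>B m_id 2 +\<^sub>B m_cross \<in> m_hom 2 2" "\<q> *\<^sub>B m_id 2 +\<^sub>B m_cross_inv \<in> m_hom 2 2"
    by (rule homs HOL.refl)+
  note 1 = loopval_st[OF this(1) hom_cap, unfolded cap, OF clifford h]
    and 2 = loopval_st[OF this(2) hom_cap, unfolded cap, OF clifford' h]
  show "loopval (i + 2 + j) (st i m_cross j \<circ>\<^sub>B h) =
      \<iota> (inverse \<z>) * loopval (i + j) (st i m_cap j \<circ>\<^sub>B h) - \<iota> (inverse \<q>) * loopval (i + 2 + j) h"
    using 1 by (simp only: st_add st_scale m_comp_add_left m_comp_scale_left st_id m_id_comp[OF h]
      loopval_add loopval_scale hom_scale hh h add_0_right eq_diff_eq) (simp only: add.commute)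
  show "loopval (i + 2 + j) (st i m_cross_inv j \<circ>\<^sub>B h) =
      \<iota> \<z> * loopval (i + j) (st i m_cap j \<circ>\<^sub>B h) - \<iota> \<q> * loopval (i + 2 + j) h"
    using 2 by (simp only: st_add st_scale m_comp_add_left m_comp_scale_left st_id m_id_comp[OF h]
      loopval_add loopval_scale hom_scale hh h add_0_right eq_diff_eq) (simp only: add.commute)
next
  fix h i j assume h: "h \<in> m_hom 0 (i + j)"
  have h0: "h \<in> m_hom 0 (i + 0 + j)" using h by simp
  have I: "\<Gamma> 0 \<cdot> (Fm (m_id 0) \<otimes> Id C S) = Id C S"
    using Id_Comp[OF _ _ Id_in_Hom[OF S_in_Obj]] by (simp add: Fm_id Tens_Id Unit_OTens)
  from loopval_st[OF hom_cup hom_id[OF HOL.refl], unfolded I, OF gamma_coev h0]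
  show "loopval (i + 2 + j) (st i m_cup j \<circ>\<^sub>B h) = \<iota> \<delta> * loopval (i + j) h"
    using m_id_comp[OF h] by simp
qed (simp_all add: loopval_add loopval_scale)

lemma loopval_id_0: "loopval 0 (m_id 0) = \<Delta>"
proof (rule loopvalI)
  show "\<Delta> \<star> Id C \<one> = spin_tau C (Fo 1) S \<gamma> 0 \<cdot> Fm (m_id 0)"
    using Comp_Id[OF _ _ spin_tau_comp(2)[OF hom_id[OF HOL.refl, of 0]]] tau_0 by (simp add: Fm_id)
qed

lemma fierz_eq:
  assumes "f = (E a \<otimes>\<^sub>B E b \<otimes>\<^sub>B E a \<otimes>\<^sub>B E b) \<circ>\<^sub>B (m_id a \<otimes>\<^sub>B braid a b \<otimes>\<^sub>B m_id b)
           \<circ>\<^sub>B (nested_cup a \<otimes>\<^sub>B nested_cup b)" "f \<in> m_hom 0 (2 * a + 2 * b)"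
  shows "fierz C Fo Fm \<Delta> S \<gamma> a b = loopval (2 * a + 2 * b) f / \<Delta>"
  unfolding fierz_def assms(1)[symmetric]
proof (rule the_equality)
  show "(\<Delta> * (loopval (2 * a + 2 * b) f / \<Delta>)) \<star> Id C \<one> = spin_tau C (Fo 1) S \<gamma> (2 * a + 2 * b) \<cdot> Fm f"
    using loopval[OF assms(2)] \<Delta>_nonzero by simp
  fix x assume "(\<Delta> * x) \<star> Id C \<one> = spin_tau C (Fo 1) S \<gamma> (2 * a + 2 * b) \<cdot> Fm f"
  then have "loopval (2 * a + 2 * b) f = \<Delta> * x" by (rule loopvalI)
  then show "x = loopval (2 * a + 2 * b) f / \<Delta>" using \<Delta>_nonzero by simp
qed

end

section \<open>The closed formula\<close>

text \<open>The identity of \<open>wz_step\<close> with denominators cleared; \<open>Z\<close>, \<open>p\<close>, \<open>r\<close>, \<open>s\<close>, \<open>m\<close> stand for the squares of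
  \<open>\<z>\<close>, \<open>\<q>\<close>, and of the powers of \<open>\<q>\<close> with exponents \<open>a + 1 - m\<close>, \<open>b - m\<close>, \<open>m\<close>.\<close>

lemma wz_polynomial:
  fixes Z p r s m :: "'a::field"
  shows "m * ((Z + r*s) * (r*m - 1) * (Z*Z*p*p - r*s*m) * (Z*Z*p - r*s*m) * (Z*p + r) * (Z*p*p + r))
   - (Z - s*m) * (Z*p + r*s) * (r - 1) * (Z*p + r*m) * (Z + r*s*m) * (Z*Z*p*p - r*s*m) * (Z*p*p + r)
   + Z*s * ((Z*p*p + r*s) * (r - 1) * (r - p) * (Z + r*s*m) * (Z*p + r*s*m) * (Z*Z*p*p - r*m))
   + r*s * ((r - 1) * (s - 1) * (Z + m) * (Z + r*s*m) * (r*r*r*s*m*m - Z*Z*p*p*r*r*s*m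
        + p * (Z*p*r*r*s*m*m - Z*Z*Z*p*p*r + Z*Z*p*p*r*s*m - Z*Z*p*r*r*m) - p*p*(Z*Z*Z*p*p*r*m - Z*Z*Z*p*p)))
   + (m - 1) * (Z + s) * (Z*Z*p*p - r*s*m) * (Z*p*p + r) * (r*r*r*s*m*m - Z*Z*p*p*r*r*s*m
        + (Z*p*r*r*s*m*m - Z*Z*Z*p*p*r + Z*Z*p*p*r*s*m - Z*Z*p*r*r*m) - (Z*Z*Z*p*p*r*m - Z*Z*Z*p*p)) = 0"
  by algebra

text \<open>The bridge from the Laurent expressions of \<open>wz_step\<close> to
  \<open>wz_polynomial\<close>: each hypothesis clears the denominators of one factor, and
  \<open>K\<close> is a common multiplier for all five products.\<close>

lemma wz_field:
  fixes z q R S M k ki :: "'a::field"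
  assumes nz: "z \<noteq> 0" "q \<noteq> 0" "R \<noteq> 0" "S \<noteq> 0" "M \<noteq> 0" and k: "k * ki = 1"
  defines "Z \<equiv> z * z" and "p \<equiv> q * q" and "r \<equiv> R * R" and "s \<equiv> S * S" and "m \<equiv> M * M"
  assumes brs: "brs * (z * R * S) = Z + r*s" and ua1: "ua1 * (k * R * M) = r*m - 1"
    and e1: "e1 * S = M" and P: "P * (k * p * Z * R * S * M) = Z*Z*p*p - r*s*m"
    and P2: "P2 * (k * q * Z * R * S * M) = Z*Z*p - r*s*m"
    and br1: "br1 * (q * z * R) = Z*p + r" and br2: "br2 * (p * z * R) = Z*p*p + r"
    and un: "un * (k * z * S * M) = Z - s*m" and brs1: "brs1 * (q * z * R * S) = Z*p + r*s"
    and ur: "ur * (k * R) = r - 1" and bra: "bra * (q * z * R * M) = Z*p + r*m"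
    and bram: "bram * (z * R * S * M) = Z + r*s*m"
    and brs2: "brs2 * (p * z * R * S) = Z*p*p + r*s" and ur1: "ur1 * (k * q * R) = r - p"
    and bram1: "bram1 * (q * z * R * S * M) = Z*p + r*s*m" and e3: "e3 * M = S"
    and u2a: "u2a * (k * p * Z * R * M) = Z*Z*p*p - r*m"
    and us: "us * (k * S) = s - 1" and bm: "bm * (z * M) = Z + m" and w: "w * (Z * p * p) = r*s"
    and um: "um * (k * M) = m - 1" and bs: "bs * (z * S) = Z + s"
    and N1: "N1 * (p*r*r*s*m*z*z*z) = r*r*r*s*m*m - Z*Z*p*p*r*r*s*m
        + p * (Z*p*r*r*s*m*m - Z*Z*Z*p*p*r + Z*Z*p*p*r*s*m - Z*Z*p*r*r*m) - p*p*(Z*Z*Z*p*p*r*m - Z*Z*Z*p*p)"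
    and N: "N * (p*r*r*s*m*z*z*z) = r*r*r*s*m*m - Z*Z*p*p*r*r*s*m
        + (Z*p*r*r*s*m*m - Z*Z*Z*p*p*r + Z*Z*p*p*r*s*m - Z*Z*p*r*r*m) - (Z*Z*Z*p*p*r*m - Z*Z*Z*p*p)"
  shows "brs*ua1*e1*P*P2*br1*br2 - un*brs1*ur*bra*bram*P*br2 + brs2*ur*ur1*bram*bram1*e3*u2a
    + ur*us*bm*bram*w*N1*ki + um*bs*P*br2*N*ki = 0"
proof -
  define K where "K = p*p*p*z*z*z*Z*Z*r*r*r*s*s*m*m*k*k*k"
  have "k \<noteq> 0" using k by auto
  then have K: "K \<noteq> 0" using nz by (simp add: K_def Z_def p_def r_def s_def m_def)
  have 1: "K * (brs*ua1*e1*P*P2*br1*br2) = m * ((Z + r*s) * (r*m - 1) * (Z*Z*p*p - r*s*m) * (Z*Z*p - r*s*m) * (Z*p + r) * (Z*p*p + r))"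
  proof -
    have "K * (brs*ua1*e1*P*P2*br1*br2) = M * (e1 * S) * ((brs * (z * R * S)) * (ua1 * (k * R * M)) *
      (P * (k * p * Z * R * S * M)) * (P2 * (k * q * Z * R * S * M)) * (br1 * (q * z * R)) * (br2 * (p * z * R)))"
      unfolding K_def Z_def p_def r_def s_def m_def by algebra
    then show ?thesis unfolding brs ua1 e1 P P2 br1 br2 by (simp add: m_def)
  qed
  have 2: "K * (un*brs1*ur*bra*bram*P*br2) = (Z - s*m) * (Z*p + r*s) * (r - 1) * (Z*p + r*m) * (Z + r*s*m) * (Z*Z*p*p - r*s*m) * (Z*p*p + r)"
  proof -
    have "K * (un*brs1*ur*bra*bram*P*br2) = (un * (k * z * S * M)) * (brs1 * (q * z * R * S)) * (ur * (k * R)) *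
      (bra * (q * z * R * M)) * (bram * (z * R * S * M)) * (P * (k * p * Z * R * S * M)) * (br2 * (p * z * R))"
      unfolding K_def Z_def p_def r_def s_def m_def by algebra
    then show ?thesis unfolding un brs1 ur bra bram P br2 .
  qed
  have 3: "K * (brs2*ur*ur1*bram*bram1*e3*u2a) = Z*s * ((Z*p*p + r*s) * (r - 1) * (r - p) * (Z + r*s*m) * (Z*p + r*s*m) * (Z*Z*p*p - r*m))"
  proof -
    have "K * (brs2*ur*ur1*bram*bram1*e3*u2a) = Z * (S * (e3 * M)) * ((brs2 * (p * z * R * S)) * (ur * (k * R)) *
      (ur1 * (k * q * R)) * (bram * (z * R * S * M)) * (bram1 * (q * z * R * S * M)) * (u2a * (k * p * Z * R * M)))"
      unfolding K_def Z_def p_def r_def s_def m_def by algebra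
    then show ?thesis unfolding brs2 ur ur1 bram bram1 e3 u2a s_def[symmetric] .
  qed
  have 4: "K * (ur*us*bm*bram*w*N1*ki) = r*s * ((r - 1) * (s - 1) * (Z + m) * (Z + r*s*m) * (r*r*r*s*m*m - Z*Z*p*p*r*r*s*m
        + p * (Z*p*r*r*s*m*m - Z*Z*Z*p*p*r + Z*Z*p*p*r*s*m - Z*Z*p*r*r*m) - p*p*(Z*Z*Z*p*p*r*m - Z*Z*Z*p*p)))"
  proof -
    have "K * (ur*us*bm*bram*w*N1*ki) = (k * ki) * ((w * (Z * p * p)) * ((ur * (k * R)) * (us * (k * S)) * (bm * (z * M)) *
       (bram * (z * R * S * M)) * (N1 * (p*r*r*s*m*z*z*z))))"
      unfolding K_def Z_def p_def r_def s_def m_def by algebra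
    then show ?thesis unfolding k ur us bm bram w N1 by simp
  qed
  have 5: "K * (um*bs*P*br2*N*ki) = (m - 1) * (Z + s) * (Z*Z*p*p - r*s*m) * (Z*p*p + r) * (r*r*r*s*m*m - Z*Z*p*p*r*r*s*m
        + (Z*p*r*r*s*m*m - Z*Z*Z*p*p*r + Z*Z*p*p*r*s*m - Z*Z*p*r*r*m) - (Z*Z*Z*p*p*r*m - Z*Z*Z*p*p))"
  proof -
    have "K * (um*bs*P*br2*N*ki) = (k * ki) * ((um * (k * M)) * (bs * (z * S)) * (P * (k * p * Z * R * S * M)) *
       (br2 * (p * z * R)) * (N * (p*r*r*s*m*z*z*z)))"
      unfolding K_def Z_def p_def r_def s_def m_def by algebra
    then show ?thesis unfolding k um bs P br2 N by simp
  qed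
  have D: "K * (a - b + c + d + e) = K * a - K * b + K * c + K * d + K * e" for a b c d e
    by (simp add: algebra_simps)
  have "K * (brs*ua1*e1*P*P2*br1*br2 - un*brs1*ur*bra*bram*P*br2 + brs2*ur*ur1*bram*bram1*e3*u2a
    + ur*us*bm*bram*w*N1*ki + um*bs*P*br2*N*ki) = 0"
    unfolding D 1 2 3 4 5 by (rule wz_polynomial)
  then show ?thesis using K by simp
qed

lemma zvar_power: "\<z> ^ n = Fract (monom 1 n) 1"
  by (induction n) (simp_all add: zvar_def One_fract_def monom_Suc monom_0 flip: one_pCons)

lemma zvar_power_neq: assumes "n > 0" shows "\<q> ^ k * \<z> ^ n \<noteq> \<q> ^ l"
proof
  assume "\<q> ^ k * \<z> ^ n = \<q> ^ l"
  then have "[:monom 1 k:] * monom 1 n = [:monom (1::rat) l:]"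
    by (simp add: qvar_power zvar_power eq_fract)
  then have "coeff ([:monom 1 k:] * monom 1 n) n = coeff [:monom (1::rat) l:] n" by simp
  with assms show False by (simp add: coeff_pCons split: nat.splits)
qed

text \<open>Such factors are denominators in \<open>fierz_term_pred\<close> and
  \<open>wz_cert_Suc\<close>.\<close>

lemma qint_2_nonzero [simp]: "qint 2 j \<noteq> 0"
proof
  assume z: "qint 2 j = 0"
  define x where "x = \<q> powi j"
  have x: "x \<noteq> 0" by (simp add: x_def)
  define y where "y = \<z>\<^sup>2 * x"
  have "y = inverse y"
    using z by (simp add: qint_def power_int_minus x_def y_def)
  moreover have "y \<noteq> 0" using x by (simp add: y_def)
  ultimately have "y * y = 1" by (metis right_inverse)
  then have 1: "\<z>^4 * x^2 = 1" by (simp add: y_def power2_eq_square power4_eq_xxxx mult_ac)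
  show False
  proof (cases j rule: int_cases2)
    case (nonneg n)
    then have "x ^ 2 = \<q> ^ (2 * n)" by (simp add: x_def power_mult mult.commute)
    with 1 show False using zvar_power_neq[of 4 "2 * n" 0] by (simp add: mult.commute)
  next
    case (nonpos n)
    then have "x ^ 2 = inverse (\<q> ^ (2 * n))"
      by (simp add: x_def power_int_minus power_mult mult.commute power_inverse)
    with 1 have "\<z> ^ 4 = \<q> ^ (2 * n)" by (simp add: field_simps)
    then show False using zvar_power_neq[of 4 0 "2 * n"] by simp
  qed
qed

section \<open>The summand and its neighbours\<close>

definition brace_prod :: "nat \<Rightarrow> scalar" where
  "brace_prod n = (\<Prod>k<n. qbrace (int k))"
definition loop_prod :: "nat \<Rightarrow> scalar" where
  "loop_prod n = (\<Prod>k<n. qint 2 (- int k))"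

lemma brace_prod_Suc: "brace_prod (Suc n) = brace_prod n * qbrace (int n)"
  by (simp add: brace_prod_def)
lemma loop_prod_Suc: "loop_prod (Suc n) = loop_prod n * qint 2 (- int n)"
  by (simp add: loop_prod_def)
lemma qfact_Suc: "qfact (Suc n) = qfact n * qint 0 (int (Suc n))"
  by (simp add: qfact_def mult.commute)
lemma brace_prod_nonzero [simp]: "brace_prod n \<noteq> 0"
  by (simp add: brace_prod_def)
lemma qfact_nonzero [simp]: "qfact n \<noteq> 0"
  using qint_0_nonzero by (simp add: qfact_def)

lemma prod_inverse_brace:
  "(\<Prod>k = n + 1..n + m. 1 / qbrace (int k)) = brace_prod (n + 1) / brace_prod (n + m + 1)"
proof (induction m)
  case (Suc m)
  have "(\<Prod>k = n + 1..n + Suc m. 1 / qbrace (int k)) =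
      (\<Prod>k = n + 1..n + m. 1 / qbrace (int k)) * (1 / qbrace (int (n + Suc m)))"
    by (simp add: One_nat_def)
  also have "\<dots> = brace_prod (n + 1) / brace_prod (n + m + 1) * (1 / qbrace (int (n + Suc m)))"
    by (simp only: Suc)
  also have "\<dots> = brace_prod (n + 1) / brace_prod (Suc (n + m + 1))"
    by (subst brace_prod_Suc[of "n + m + 1"]) (simp add: add_ac)
  finally show ?case by simp
qed simp

text \<open>The summand of the closed formula prepared for telescoping: exponents of q over the
  integers, the sign with m instead of m^2, and the products of braces merged so that only {a+b-2m}
  survives besides initial products. The value 0 outside the range allows a uniform summation
  bound.\<close>

definition fierz_term :: "nat \<Rightarrow> nat \<Rightarrow> nat \<Rightarrow> scalar" where
  "fierz_term a b m = (if m \<le> a \<and> m \<le> b then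
     (-1) ^ (a * b + m) * \<z> powi (- 2 * int m) * \<q> powi (int a * int b - 2 * ((int a - int m) * (int b - int m)))
     * (qbrace (int (a - m) + int (b - m)) * brace_prod (a - m) * brace_prod (b - m) * brace_prod m
        * inverse (brace_prod (a + b - m + 1) * brace_prod a * brace_prod b))
     * (qfact a * qfact b * inverse (qfact m * qfact (a - m) * qfact (b - m))) * loop_prod (a + b - m) else 0)"

lemma fierz_term_eq:
  assumes "m \<le> a" "m \<le> b"
  shows "fierz_C a b m * (-1) ^ (a * b - m\<^sup>2) * \<z> powi (- 2 * int m)
        * \<q> powi (int (a * b) - 2 * int ((a - m) * (b - m)))
        * fierz_X (a - m) (b - m) m * (\<Prod>k<a + b - m. qint 2 (- int k)) = fierz_term a b m"
proof -
  obtain r s where rs: "a = r + m" "b = s + m" using assms by (metis le_add_diff_inverse2)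
  \<comment> \<open>The truncated difference is exact because m^2 is at most ab, and m^2 + m is
    even.\<close>
  have "even (a * b + m) \<longleftrightarrow> even (a * b - m\<^sup>2)"
  proof -
    have "m\<^sup>2 \<le> a * b" using assms by (simp add: power2_eq_square mult_le_mono)
    then have "a * b + m = (a * b - m\<^sup>2) + (m\<^sup>2 + m)" by simp
    moreover have "even (m\<^sup>2 + m)" by simp
    ultimately show ?thesis by (metis even_add)
  qed
  then have sg: "(-1 :: scalar) ^ (a * b - m\<^sup>2) = (-1) ^ (a * b + m)"
    by (simp add: uminus_power_if)
  have ix: "a + b - 2 * m + 1 = r + s + 1" "a + b - m = r + s + m" "r + s + m + 1 = r + s + 1 + m" using rs by simp_all
  have C: "(\<Prod>k = a + b - 2 * m + 1 .. a + b - m. 1 / qbrace (int k)) =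
      brace_prod (r + s) * qbrace (int r + int s) * inverse (brace_prod (r + s + m + 1))"
    unfolding ix(1,2) prod_inverse_brace using brace_prod_Suc[of "r + s"] by (simp add: divide_inverse nat_norm)
  have X: "fierz_X r s m = brace_prod r * brace_prod s * brace_prod m *
     inverse (brace_prod (r + s) * brace_prod (r + m) * brace_prod (s + m))"
    by (simp add: fierz_X_def brace_prod_def divide_inverse)
  have q: "int (a * b) - 2 * int (r * s) = int a * int b - 2 * ((int a - int m) * (int b - int m))"
    using rs by simp
  have am: "a - m = r" "b - m = s" using rs by simp_all
  have "fierz_C a b m * fierz_X r s m = 
     (qbrace (int r + int s) * brace_prod r * brace_prod s * brace_prod m
        * inverse (brace_prod (r + s + m + 1) * brace_prod a * brace_prod b))
     * (qfact a * qfact b * inverse (qfact m * qfact r * qfact s))"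
    unfolding fierz_C_def C X am rs(1)[symmetric] rs(2)[symmetric] by (simp add: field_simps)
  note e = this
  have r: "c * sg * zz * qq * x * l = sg * zz * qq * (c * x) * l" for c sg zz qq x l :: scalar
    by (simp only: mult_ac)
  show ?thesis
    unfolding sg am r e q unfolding fierz_term_def am ix(2)
    using assms by (simp add: loop_prod_def rs mult_ac)
qed

text \<open>The common factor of the summands for \<open>a + 1\<close>, \<open>a\<close>, \<open>a - 1\<close> and of the certificate. It is also
  meaningful at \<open>m = a + 1\<close>, where the summand for \<open>a\<close> vanishes but the certificate does not.\<close>

definition wz_base :: "nat \<Rightarrow> nat \<Rightarrow> nat \<Rightarrow> scalar" where
  "wz_base a b m =
     (-1) ^ (a * b + m) * \<z> powi (- 2 * int m) * \<q> powi (int a * int b - 2 * ((int a - int m) * (int b - int m)))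
     * (brace_prod (Suc a - m) * brace_prod (b - m) * brace_prod m
        * inverse (brace_prod (a + b - m + 2) * brace_prod (Suc a) * brace_prod b))
     * (qfact a * qfact b * inverse (qfact m * qfact (Suc a - m) * qfact (b - m))) * loop_prod (a + b - m)"

lemma qint_0_0 [simp]: "qint 0 0 = 0" by (simp add: qint_def)

lemma fierz_term_Suc:
  assumes "Suc a = r + m" "b = s + m"
  shows "fierz_term (Suc a) b m = wz_base a b m * ((-1) ^ b * qbrace (int r + int s) * qint 0 (int (Suc a))
    * \<q> powi (int b - 2 * int s) * qint 2 (- (int a + int s)))"
proof -
  have a: "int a = int r + int m - 1" using assms(1) by linarith
  have n: "Suc a - m = r" "b - m = s" "a + b - m = a + s" "Suc a + b - m = Suc (a + s)" "m \<le> Suc a" "m \<le> b"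
    "a + s + 2 = Suc (a + s) + 1"
    using assms by simp_all
  have q: "\<q> powi (int (Suc a) * int b - 2 * ((int (Suc a) - int m) * (int b - int m))) =
      \<q> powi (int a * int b - 2 * ((int a - int m) * (int b - int m))) * \<q> powi (int b - 2 * int s)"
    by (subst power_int_add[symmetric]) (simp_all add: a assms(2) algebra_simps)
  have sg: "(-1 :: scalar) ^ (Suc a * b + m) = (-1) ^ (a * b + m) * (-1) ^ b"
    by (simp add: power_add)
  show ?thesis
    unfolding fierz_term_def wz_base_def n q sg using n
    by (simp add: qfact_Suc[of a] loop_prod_Suc n(7) del: of_nat_Suc)
qed

text \<open>At m = a + 1, that is r = 0, both sides vanish, the right one through [r].\<close>

lemma fierz_term_base:
  assumes "Suc a = r + m" "b = s + m"
  shows "fierz_term a b m = wz_base a b m * (qbrace (int r - 1 + int s) * qint 0 (int r) * qbrace (int a)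
    * qbrace (int a + int s + 1) / qbrace (int r - 1))"
proof (cases r)
  case 0
  then show ?thesis using assms by (simp add: fierz_term_def)
next
  case (Suc r')
  have n: "Suc a - m = Suc r'" "a - m = r'" "b - m = s" "a + b - m = a + s" "m \<le> a" "m \<le> b"
    "a + s + 2 = Suc (a + s + 1)" "int (a + s + 1) = int a + int s + 1" "int (Suc r') - 1 = int r'"
    using assms Suc by simp_all
  show ?thesis
    unfolding fierz_term_def wz_base_def Suc n(1-4,7,9) qfact_Suc[of r'] brace_prod_Suc n(8) using n(5,6)
    using qint_0_nonzero[of "Suc r'"]
    by (simp add: divide_inverse del: of_nat_Suc, simp add: field_simps del: of_nat_Suc)
qed


lemma loop_prod_nonzero [simp]: "loop_prod n \<noteq> 0"
  by (simp add: loop_prod_def)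

text \<open>The factors [r] and [r-1] account for m = a + 1 and m = a, where the summand for a - 1
  is out of range. For a = 0 the truncated index does no harm since \<open>fierz_r 0\<close> is
  zero.\<close>

lemma fierz_term_pred:
  assumes "Suc a = r + m" "b = s + m"
  shows "- (fierz_r a * fierz_s a) * fierz_term (a - 1) b m = wz_base a b m * ((-1) ^ b * qbrace (int r - 2 + int s)
    * qbrace (int a + int s + 1) * qbrace (int a + int s) * \<q> powi (2 * int s - int b) * qint 0 (int r) * qint 0 (int r - 1)
    * qint 2 (1 - int a) / (qbrace (int r - 1) * qbrace (int r - 2) * qint 2 (- (int a + int s - 1))))"
proof (cases "r \<ge> 2")
  case False
  then consider "r = 0" | "r = 1" by linarith
  then show ?thesis
  proof cases
    case 1
    have "fierz_r a * fierz_term (a - 1) b m = 0" using assms 1 by (simp add: fierz_term_def fierz_r_def)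
    then show ?thesis using 1 by auto
  next
    case 2
    then have "fierz_r a * fierz_term (a - 1) b m = 0"
      using assms by (cases "a = 0") (simp_all add: fierz_term_def fierz_r_def)
    then show ?thesis using 2 by auto
  qed
next
  case True
  then obtain r' where r: "r = Suc (Suc r')" by (metis add_2_eq_Suc le_Suc_ex)
  then obtain a' where a: "a = Suc a'" using assms(1) by (cases a) simp_all
  have n: "Suc (Suc a') - m = Suc (Suc r')" "a' - m = r'" "b - m = s" "Suc a' + b - m = Suc (a' + s)"
    "a' + b - m = a' + s" "m \<le> a'" "m \<le> b" "Suc (a' + s) + 2 = Suc (Suc (a' + s + 1))"
    using assms a r by simp_all
  have i: "int (Suc (Suc r')) - 2 = int r'" "int (Suc (Suc r')) - 1 = int (Suc r')" "int (Suc a') - 1 = int a'"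
    "1 - int (Suc a') = - int a'" "int (Suc a') + int s + 1 = int (Suc (a' + s + 1))" "int (Suc a') + int s = int (a' + s + 1)"
    "int (a' + s + 1) - 1 = int (a' + s)" "int (a' + s + 1) + 1 = int (Suc (a' + s + 1))"
    by simp_all
  have a': "int a' = int r' + int m" using assms a r by simp
  have q: "\<q> powi (int a' * int b - 2 * ((int a' - int m) * (int b - int m))) =
      \<q> powi (int (Suc a') * int b - 2 * ((int (Suc a') - int m) * (int b - int m))) * \<q> powi (2 * int s - int b)"
    by (subst power_int_add[symmetric]) (simp_all add: a' assms(2) algebra_simps)
  have sg: "(-1 :: scalar) ^ (a' * b + m) = (-1) ^ (Suc a' * b + m) * (-1) ^ b"
    by (simp add: power_add)
  have c: "- (fierz_r (Suc a') * fierz_s (Suc a')) = qint 0 (int (Suc a')) * qint 2 (- int a') / (qbrace (int (Suc a')) * qbrace (int a'))"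
    by (simp only: fierz_r_def fierz_s_def i) simp
  show ?thesis
    unfolding a r c i fierz_term_def wz_base_def n q sg qfact_Suc brace_prod_Suc loop_prod_Suc diff_Suc_1
    using n(6,7) qint_0_nonzero[of "Suc r'"] qint_0_nonzero[of "Suc (Suc r')"] qint_0_nonzero[of "Suc a'"]
    by (simp add: divide_inverse del: of_nat_Suc of_nat_add, simp add: field_simps del: of_nat_Suc of_nat_add)
qed

text \<open>The certificate of Zeilberger's method for the three-term recursion in \<open>a\<close>; its numerator
  \<open>wz_N\<close> is quadratic in \<open>w\<close>, which is the square of \<open>\<q> ^ m\<close>.\<close>

definition wz_N :: "nat \<Rightarrow> nat \<Rightarrow> scalar \<Rightarrow> scalar" where
  "wz_N a b w = (let x = (\<q> ^ a)\<^sup>2; y = (\<q> ^ b)\<^sup>2 in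
     inverse \<z> ^ 3 * x - \<z> * \<q>\<^sup>2 + w * (inverse \<z> - \<z> ^ 3 * inverse (x * y) + \<z> * (inverse x - inverse y))
     - \<z> ^ 3 * w\<^sup>2 * inverse (x * y) * (1 - inverse (x * \<q>\<^sup>2)))"

definition wz_cert :: "nat \<Rightarrow> nat \<Rightarrow> nat \<Rightarrow> scalar" where
  "wz_cert a b m = (if m \<le> Suc a \<and> m \<le> b then wz_base a b m * ((-1) ^ b * wz_N a b ((\<q> ^ m)\<^sup>2) * inverse qd
     * qint 0 (int m) * qbrace (int b - int m) / qbrace (int a - int m)) else 0)"

text \<open>The factors [r] and [s] reproduce the cut-off of the certificate at
  \<open>Suc m\<close>.\<close>

lemma wz_cert_Suc:
  assumes "Suc a = r + m" "b = s + m"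
  shows "wz_cert a b (Suc m) = - wz_base a b m * ((-1) ^ b * qint 0 (int r) * qint 0 (int s) * qbrace (int m)
     * qbrace (int a + int s + 1) * (\<z> powi (-2) * \<q> powi (2 * (int r + int s - 2))) * wz_N a b ((\<q> ^ Suc m)\<^sup>2) * inverse qd
     / (qbrace (int r - 1) * qbrace (int r - 2) * qint 2 (- (int a + int s - 1))))"
proof (cases "r = 0 \<or> s = 0")
  case True
  then show ?thesis using assms by (auto simp: wz_cert_def)
next
  case False
  then obtain r' s' where r: "r = Suc r'" "s = Suc s'" by (metis not0_implies_Suc)
  have n: "Suc a - Suc m = r'" "b - Suc m = s'" "a + b - Suc m = a + s'" "Suc a - m = Suc r'" "b - m = Suc s'"
    "a + b - m = Suc (a + s')" "Suc m \<le> Suc a" "Suc m \<le> b" "Suc (a + s') + 2 = Suc (a + s' + 2)"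
    using assms r by simp_all
  have i: "int a = int r' + int m" "int b = int (Suc s') + int m" using assms r by simp_all
  have j: "int a - int (Suc m) = int r' - 1" "int b - int (Suc m) = int s'" "int (Suc r') - 1 = int r'"
    "int (Suc r') - 2 = int r' - 1" "int a + int (Suc s') + 1 = int (a + s' + 2)" "int a + int (Suc s') - 1 = int (a + s')"
    using i by simp_all
  have q: "\<q> powi (int a * int b - 2 * ((int r' - 1) * int s')) =
      \<q> powi (int a * int b - 2 * ((int a - int m) * (int b - int m))) * \<q> powi (2 * (int (Suc r') + int (Suc s') - 2))"
    by (subst power_int_add[symmetric]) (simp_all add: i algebra_simps)
  have z: "\<z> powi (- 2 * int (Suc m)) = \<z> powi (- 2 * int m) * \<z> powi (-2)"
    by (subst power_int_add[symmetric]) (simp_all add: algebra_simps)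
  have sg: "(-1 :: scalar) ^ (a * b + Suc m) = - ((-1) ^ (a * b + m))" by simp
  show ?thesis
    unfolding wz_cert_def wz_base_def r n j q z sg qfact_Suc brace_prod_Suc loop_prod_Suc
    using n(7,8) qint_0_nonzero[of "Suc r'"] qint_0_nonzero[of "Suc s'"] qint_0_nonzero[of "Suc m"]
    by (simp add: divide_inverse del: of_nat_Suc of_nat_add power_Suc, simp add: field_simps del: of_nat_Suc of_nat_add power_Suc)
qed


lemma wz_divide:
  fixes P :: "'a::field"
  assumes "P \<noteq> 0" "br1 \<noteq> 0" "br2 \<noteq> 0"
    and "brs*ua1*e1*P*P2*br1*br2 - un*brs1*ur*bra*bram*P*br2 + brs2*ur*ur1*bram*bram1*e3*u2a
    + ur*us*bm*bram*w*N1*ki + um*bs*P*br2*N*ki = 0" and g: "g * g = 1"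
  shows "\<beta> * (g * brs * ua1 * e1 * P2) - (g * un) * (\<beta> * (brs1 * ur * bra * bram / br1)) +
    \<beta> * (g * brs2 * bram * bram1 * e3 * ur * ur1 * u2a / (br1 * br2 * P)) =
    - \<beta> * (g * ur * us * bm * bram * w * N1 * ki / (br1 * br2 * P)) - \<beta> * (g * N * ki * um * bs / br1)"
proof -
  have "\<beta> * (g * brs * ua1 * e1 * P2) - (g * un) * (\<beta> * (brs1 * ur * bra * bram / br1)) +
    \<beta> * (g * brs2 * bram * bram1 * e3 * ur * ur1 * u2a / (br1 * br2 * P)) -
    (- \<beta> * (g * ur * us * bm * bram * w * N1 * ki / (br1 * br2 * P)) - \<beta> * (g * N * ki * um * bs / br1)) =
    \<beta> * g * (brs*ua1*e1*P*P2*br1*br2 - un*brs1*ur*bra*bram*P*br2 + brs2*ur*ur1*bram*bram1*e3*u2a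
    + ur*us*bm*bram*w*N1*ki + um*bs*P*br2*N*ki) / (br1 * br2 * P)"
    using assms(1-3) by (simp add: field_simps)
  then show ?thesis by (simp only: assms(4)) simp
qed

lemma qbrace_powi: "\<q> powi j = x \<Longrightarrow> qbrace j = \<z> * inverse x + inverse \<z> * x"
  by (auto simp: qbrace_def power_int_minus)

lemma qint_powi: "\<q> powi j = x \<Longrightarrow> qint b j * qd = \<z> powi b * x - \<z> powi (- b) * inverse x"
  by (auto simp: qint_def power_int_minus)

text \<open>Here \<open>r\<close>, \<open>s\<close>, \<open>m\<close> are squared powers of q as in
  \<open>wz_polynomial\<close>; \<open>c = 1\<close> gives the certificate at its index m and
  \<open>c = \<q> * \<q>\<close> the one at m + 1.\<close>

lemma wz_N_eq:
  fixes r s m w :: scalar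
  assumes "r \<noteq> 0" "s \<noteq> 0" "m \<noteq> 0" and p: "p = \<q> * \<q>" and Z: "Z = \<z> * \<z>"
    and a: "(\<q> ^ a)\<^sup>2 = r * m * inverse p" and b: "(\<q> ^ b)\<^sup>2 = s * m"
  shows "wz_N a b (c * m) * (p*r*r*s*m*\<z>*\<z>*\<z>) = r*r*r*s*m*m - Z*Z*p*p*r*r*s*m
        + c * (Z*p*r*r*s*m*m - Z*Z*Z*p*p*r + Z*Z*p*p*r*s*m - Z*Z*p*r*r*m) - c*c*(Z*Z*Z*p*p*r*m - Z*Z*Z*p*p)"
proof -
  define ri si mi pi zi where "ri = inverse r" "si = inverse s" "mi = inverse m" "pi = inverse p" "zi = inverse \<z>"
  have p0: "p \<noteq> 0" by (simp add: p)
  have inv: "r * ri = 1" "s * si = 1" "m * mi = 1" "p * pi = 1" "\<z> * zi = 1"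
    using assms(1-3) p0 by (simp_all add: ri_si_mi_pi_zi_def)
  have i: "inverse (r * m * pi * (s * m)) = ri * mi * p * si * mi" "inverse (r * m * pi) = ri * mi * p"
    "inverse (s * m) = si * mi" "inverse (r * m * pi * p) = ri * mi"
    using p0 by (simp_all add: ri_si_mi_pi_zi_def)
  have "wz_N a b (c * m) = zi * zi * zi * (r * m * pi) - \<z> * p + c * m * (zi - \<z> * \<z> * \<z> * (ri * mi * p * si * mi) + \<z> * (ri * mi * p - si * mi))
     - \<z> * \<z> * \<z> * (c * m * (c * m)) * (ri * mi * p * si * mi) * (1 - ri * mi)"
    unfolding wz_N_def Let_def a b ri_si_mi_pi_zi_def(4,5)[symmetric] power2_eq_square[of \<q>] p[symmetric] i
    by (simp add: power2_eq_square power3_eq_cube)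
  then show ?thesis unfolding Z using inv by algebra
qed


lemma qbrace_mult:
  "\<lbrakk>\<q> powi j = x; (\<z> * inverse x + inverse \<z> * x) * y = v\<rbrakk> \<Longrightarrow> qbrace j * y = v"
  by (simp add: qbrace_powi)

lemma qint_mult:
  assumes "\<q> powi j = x" "(\<z> powi b * x - \<z> powi (- b) * inverse x) * y = v"
  shows "qint b j * (qd * y) = v"
  using assms(2) by (simp only: qint_powi[OF assms(1), symmetric] mult.assoc)

text \<open>All five terms are multiples of \<open>wz_base a b m\<close> with coefficients rational
  in z, q, q^r, q^s and q^m, so the claim is an identity of rational functions.\<close>

lemma wz_step:
  assumes rm: "Suc a = r + m" and sm: "b = s + m"
  shows "fierz_term (Suc a) b m - fierz_l b * fierz_term a b m - fierz_r a * fierz_s a * fierz_term (a - 1) b m =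
    wz_cert a b (Suc m) - wz_cert a b m"
proof -
  define R S M where "R = \<q> ^ r" "S = \<q> ^ s" "M = \<q> ^ m"
  define k where "k = qd"
  note RSM = R_S_M_def
  have nz: "\<z> \<noteq> 0" "\<q> \<noteq> 0" "R \<noteq> 0" "S \<noteq> 0" "M \<noteq> 0" by (simp_all add: RSM)
  have k: "k * inverse k = 1" by (simp add: k_def)
  have ia: "int a = int r + int m - 1" "int b = int s + int m" "int (Suc a) = int r + int m" using rm sm by simp_all
  have e: "\<q> powi (int r) = R" "\<q> powi (int s) = S" "\<q> powi (int m) = M" by (simp_all add: RSM)
  have "2 * (int r + int s - 2) = (int r - 1) + (int r - 1) + (int s - 1) + (int s - 1)" by simp
  then have x16: "\<q> powi (2 * (int r + int s - 2)) = R * R * (S * S) * inverse (\<q> * \<q> * (\<q> * \<q>))"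
    by (simp only: power_int_add power_int_diff RSM nz simp_thms power_int_of_nat)
      (simp add: divide_inverse mult_ac)
  have x: "\<q> powi (int r + int s) = R * S" "\<q> powi (int (Suc a)) = R * M" "\<q> powi (int b - 2 * int s) = M * inverse S"
    "\<q> powi (- (int a + int s)) = inverse (R * S * M) * \<q>" "\<q> powi (- (int a + int s - 1)) = inverse (R * S * M) * (\<q> * \<q>)"
    "\<q> powi (int r - 1) = R * inverse \<q>" "\<q> powi (int r - 2) = R * inverse (\<q> * \<q>)" "\<q> powi (- int b) = inverse (S * M)"
    "\<q> powi (int r - 1 + int s) = R * S * inverse \<q>" "\<q> powi (int a) = R * M * inverse \<q>"
    "\<q> powi (int a + int s + 1) = R * S * M" "\<q> powi (int a + int s) = R * S * M * inverse \<q>"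
    "\<q> powi (int r - 2 + int s) = R * S * inverse (\<q> * \<q>)" "\<q> powi (2 * int s - int b) = S * inverse M"
    "\<q> powi (1 - int a) = inverse (R * M) * (\<q> * \<q>)"
    unfolding ia
    by (simp_all add: power_int_add power_int_diff power_int_minus RSM nz divide_inverse power2_eq_square mult_ac del: of_nat_Suc)
  have aa: "(\<q> ^ a)\<^sup>2 = R * R * (M * M) * inverse (\<q> * \<q>)" "(\<q> ^ b)\<^sup>2 = S * S * (M * M)"
  proof -
    have "\<q> ^ a = R * M * inverse \<q>" using x(10) by simp
    then show "(\<q> ^ a)\<^sup>2 = R * R * (M * M) * inverse (\<q> * \<q>)" by (simp add: power2_eq_square mult_ac)
    show "(\<q> ^ b)\<^sup>2 = S * S * (M * M)" by (simp add: sm RSM power_add power2_eq_square mult_ac)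
  qed
  have W: "(\<q> ^ m)\<^sup>2 = 1 * (M * M)" "(\<q> ^ Suc m)\<^sup>2 = \<q> * \<q> * (M * M)"
    by (simp_all add: RSM power2_eq_square mult_ac)
  have nz2: "R * R \<noteq> 0" "S * S \<noteq> 0" "M * M \<noteq> 0" using nz by simp_all
  note N = wz_N_eq[OF nz2 HOL.refl HOL.refl aa, of 1, folded W(1), simplified]
    and N1 = wz_N_eq[OF nz2 HOL.refl HOL.refl aa, of "\<q> * \<q>", folded W(2)]
  \<comment> \<open>The claim without its common factor and sign, multiplied by {r-1}, {r-2} and
    [2n-(a+s-1)].\<close>
  have id: "qbrace (int r + int s) * qint 0 (int (Suc a)) * \<q> powi (int b - 2 * int s) * qint 2 (- (int a + int s - 1))
      * qint 2 (- (int a + int s)) * qbrace (int r - 1) * qbrace (int r - 2)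
    - qint 1 (- int b) * qbrace (int r - 1 + int s) * qint 0 (int r) * qbrace (int a) * qbrace (int a + int s + 1)
      * qint 2 (- (int a + int s - 1)) * qbrace (int r - 2)
    + qbrace (int r - 2 + int s) * qint 0 (int r) * qint 0 (int r - 1) * qbrace (int a + int s + 1) * qbrace (int a + int s)
      * \<q> powi (2 * int s - int b) * qint 2 (1 - int a)
    + qint 0 (int r) * qint 0 (int s) * qbrace (int m) * qbrace (int a + int s + 1)
      * (\<z> powi (-2) * \<q> powi (2 * (int r + int s - 2))) * wz_N a b ((\<q> ^ Suc m)\<^sup>2) * inverse k
    + qint 0 (int m) * qbrace (int s) * qint 2 (- (int a + int s - 1)) * qbrace (int r - 2) * wz_N a b ((\<q> ^ m)\<^sup>2) * inverse k = 0"
    apply (rule wz_field[OF nz k])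
    apply (rule qbrace_mult[OF x(1)], use nz in \<open>simp add: field_simps\<close>)
    apply (simp only: mult.assoc k_def, rule qint_mult[OF x(2)], use nz in \<open>simp add: field_simps\<close>)
    apply (use nz in \<open>simp add: x(3)\<close>)
    apply (simp only: mult.assoc k_def, rule qint_mult[OF x(5)], use nz in \<open>simp add: field_simps power2_eq_square power_int_minus\<close>)
    apply (simp only: mult.assoc k_def, rule qint_mult[OF x(4)], use nz in \<open>simp add: field_simps power2_eq_square power_int_minus\<close>)
    apply (rule qbrace_mult[OF x(6)], use nz in \<open>simp add: field_simps\<close>)
    apply (rule qbrace_mult[OF x(7)], use nz in \<open>simp add: field_simps\<close>)
    apply (simp only: mult.assoc k_def, rule qint_mult[OF x(8)], use nz in \<open>simp add: field_simps power_int_minus\<close>)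
    apply (rule qbrace_mult[OF x(9)], use nz in \<open>simp add: field_simps\<close>)
    apply (simp only: mult.assoc k_def, rule qint_mult[OF e(1)], use nz in \<open>simp add: field_simps\<close>)
    apply (rule qbrace_mult[OF x(10)], use nz in \<open>simp add: field_simps\<close>)
    apply (rule qbrace_mult[OF x(11)], use nz in \<open>simp add: field_simps\<close>)
    apply (rule qbrace_mult[OF x(13)], use nz in \<open>simp add: field_simps\<close>)
    apply (simp only: mult.assoc k_def, rule qint_mult[OF x(6)], use nz in \<open>simp add: field_simps\<close>)
    apply (rule qbrace_mult[OF x(12)], use nz in \<open>simp add: field_simps\<close>)
    apply (use nz in \<open>simp add: x(14)\<close>)
    apply (simp only: mult.assoc k_def, rule qint_mult[OF x(15)], use nz in \<open>simp add: field_simps power2_eq_square power_int_minus\<close>)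
    apply (simp only: mult.assoc k_def, rule qint_mult[OF e(2)], use nz in \<open>simp add: field_simps\<close>)
    apply (rule qbrace_mult[OF e(3)], use nz in \<open>simp add: field_simps\<close>)
    apply (simp only: x16, use nz in \<open>simp add: power_int_minus power2_eq_square field_simps\<close>)
    apply (simp only: mult.assoc k_def, rule qint_mult[OF e(3)], use nz in \<open>simp add: field_simps\<close>)
    apply (rule qbrace_mult[OF e(2)], use nz in \<open>simp add: field_simps\<close>)
    apply (rule N1)
    apply (use N in \<open>simp add: mult_ac\<close>)
    done
  have g: "(- 1) ^ b * (- 1) ^ b = (1 :: scalar)" by (simp flip: power_mult_distrib)
  have cert: "wz_cert a b m = wz_base a b m * ((-1) ^ b * wz_N a b ((\<q> ^ m)\<^sup>2) * inverse k
     * qint 0 (int m) * qbrace (int s) / qbrace (int r - 1))"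
  proof -
    have "m \<le> Suc a \<and> m \<le> b" "int b - int m = int s" "int a - int m = int r - 1" using rm sm ia by simp_all
    then show ?thesis by (simp only: wz_cert_def k_def simp_thms if_True)
  qed
  have f: "x - (g * un) * t - rs * t' = x - (g * un) * t + (- rs) * t'" for x g un t rs t' :: scalar by simp
  show ?thesis
    unfolding fierz_term_Suc[OF assms] fierz_l_def f fierz_term_base[OF assms] fierz_term_pred[OF assms]
      wz_cert_Suc[OF assms] cert k_def[symmetric]
    by (rule wz_divide[OF qint_2_nonzero qbrace_nonzero qbrace_nonzero id g])
qed

lemma fierz_term_outside: "\<not> (m \<le> a \<and> m \<le> b) \<Longrightarrow> fierz_term a b m = 0"
  unfolding fierz_term_def by (rule if_not_P)

text \<open>The bound depends on \<open>b\<close> alone, so the sums for a + 1, a and a - 1 combine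
  termwise.\<close>

definition fierz_sum :: "nat \<Rightarrow> nat \<Rightarrow> scalar" where
  "fierz_sum a b = (\<Sum>m<Suc b. fierz_term a b m)"

lemma fierz_sum_recursion:
  "fierz_sum (Suc a) b = fierz_l b * fierz_sum a b + fierz_r a * fierz_s a * fierz_sum (a - 1) b"
proof -
  have 1: "fierz_term (Suc a) b m - fierz_l b * fierz_term a b m - fierz_r a * fierz_s a * fierz_term (a - 1) b m =
    wz_cert a b (Suc m) - wz_cert a b m" if "m < Suc b" for m
  proof (cases "m \<le> Suc a")
    case True
    then show ?thesis using that by (intro wz_step[of a "Suc a - m" m b "b - m"]) simp_all
  next
    case False
    then have "fierz_term (a - 1) b m = 0" by (intro fierz_term_outside) (use False in arith)
    with False show ?thesis by (simp add: fierz_term_outside wz_cert_def)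
  qed
  have "fierz_sum (Suc a) b - fierz_l b * fierz_sum a b - fierz_r a * fierz_s a * fierz_sum (a - 1) b =
      (\<Sum>m<Suc b. fierz_term (Suc a) b m - fierz_l b * fierz_term a b m - fierz_r a * fierz_s a * fierz_term (a - 1) b m)"
    unfolding fierz_sum_def by (simp only: sum_subtractf sum_distrib_left)
  also have "\<dots> = (\<Sum>m<Suc b. wz_cert a b (Suc m) - wz_cert a b m)"
    by (rule sum.cong[OF HOL.refl]) (simp only: 1 lessThan_iff)
  \<comment> \<open>Both ends of the telescope vanish: at m = 0 through [0], at m = b + 1 by the
    cut-off in \<open>wz_cert\<close>.\<close>
  also have "\<dots> = 0" unfolding sum_lessThan_telescope by (simp add: wz_cert_def)
  finally show ?thesis by (simp add: algebra_simps)
qed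

lemma fierz_sum_0: "fierz_sum 0 b = (\<Prod>k<b. fierz_s (Suc k))"
proof -
  have "fierz_sum 0 b = fierz_term 0 b 0"
    unfolding fierz_sum_def using sum.lessThan_Suc_shift[of "fierz_term 0 b" b] by (simp add: fierz_term_outside)
  also have "\<dots> = loop_prod b / brace_prod b"
    using brace_prod_Suc[of b] by (simp add: fierz_term_def brace_prod_def[of 0] qfact_def[of 0] nat_norm field_simps)
  also have "\<dots> = (\<Prod>k<b. fierz_s (Suc k))"
    by (simp add: loop_prod_def brace_prod_def fierz_s_def prod_dividef)
  finally show ?thesis .
qed

section \<open>Evaluation of the Fierz coefficients\<close>

text \<open>Nested cups are chords around no strands, so \<open>E_chords\<close> also moves
  \<open>E b\<close> from one side of a nested cup to the other.\<close>

lemma nested_cup_eq_chords: "nested_cup b = chords b 0 0 (m_id 0)"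
proof (induction b)
  case (Suc b)
  then show ?case unfolding nested_cup_Suc by (simp add: chord_0 del: nested_cup.simps)
qed simp

lemma chords_comp_right:
  assumes X: "X \<in> m_hom n (b + j)" and g: "g \<in> m_hom j j"
  shows "st (a + b + a) g 0 \<circ>\<^sub>B chords a b j X = chords a b j (st b g 0 \<circ>\<^sub>B X)"
proof (induction a)
  case (Suc a)
  have c: "st (Suc a + b + Suc a) g 0 \<circ>\<^sub>B st a (chord b) (a + j) = st a (chord b) (a + j) \<circ>\<^sub>B st (a + b + a) g 0"
    by (rule st_commute[OF hom_chord g, where k = a]) simp_all
  show ?case by (simp only: chords.simps Suc[symmetric] m_comp_assoc[symmetric] c)
qed simp

text \<open>The last \<open>E b\<close> moves below the chords and there onto the left legs of the
  nested cups. The other \<open>E b\<close> is then absorbed, as chords preserve alternation, and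
  the two copies of \<open>E a\<close> merge by \<open>E_chords\<close> and idempotence.\<close>

lemma fierz_diagram:
  fixes a b :: nat
  defines "Z \<equiv> st 0 (E b) b \<circ>\<^sub>B nested_cup b"
  shows "(E a \<otimes>\<^sub>B E b \<otimes>\<^sub>B E a \<otimes>\<^sub>B E b) \<circ>\<^sub>B (m_id a \<otimes>\<^sub>B braid a b \<otimes>\<^sub>B m_id b) \<circ>\<^sub>B (nested_cup a \<otimes>\<^sub>B nested_cup b)
      = st 0 (E a) (b + a + b) \<circ>\<^sub>B chords a b b Z"
    and "Z \<in> m_hom 0 (b + b)" "alternating 0 b b Z"
proof -
  have N: "nested_cup b \<in> m_hom 0 (0 + b + b)" using hom_nested_cup by simp
  show Z: "Z \<in> m_hom 0 (b + b)" unfolding Z_def by (rule hom_comp[OF hom_st[OF hom_E] N]) simp_all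
  show aZ: "alternating 0 b b Z" unfolding Z_def by (rule alternating_E[OF N])
  have ZR: "st b (E b) 0 \<circ>\<^sub>B nested_cup b = Z"
    using E_chords[of "m_id 0" 0 0 0 b] hom_id[of 0 0] by (simp add: Z_def nested_cup_eq_chords)
  define Y where "Y = chords a b b Z"
  have hY: "Y \<in> m_hom 0 (a + b + a + b)" unfolding Y_def by (rule hom_chords[OF Z])
  have 1: "(m_id a \<otimes>\<^sub>B braid a b \<otimes>\<^sub>B m_id b) \<circ>\<^sub>B (nested_cup a \<otimes>\<^sub>B nested_cup b) = chords a b b (nested_cup b)"
    using braid_nested_cup[OF hom_nested_cup, of a b] tens_eq_st(1)[OF hom_nested_cup[of a] hom_nested_cup[of b]]
    by (simp add: st_def[of a "braid a b"])
  have h3: "E a \<otimes>\<^sub>B E b \<in> m_hom (a + b) (a + b)" by (rule hom_tens[OF hom_E hom_E]) simp_all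
  have h2: "E b \<otimes>\<^sub>B E a \<otimes>\<^sub>B E b \<in> m_hom (b + (a + b)) (b + (a + b))" by (rule hom_tens[OF hom_E h3]) simp_all
  have h1: "st 0 (E b) (a + b) \<in> m_hom (b + (a + b)) (b + (a + b))" "st b (E a \<otimes>\<^sub>B E b) 0 \<in> m_hom (b + (a + b)) (b + (a + b))"
    "st 0 (E a) b \<in> m_hom (a + b) (a + b)" "st a (E b) 0 \<in> m_hom (a + b) (a + b)"
    by (rule hom_st[OF hom_E] hom_st[OF h3]; simp)+
  have 2: "E a \<otimes>\<^sub>B E b \<otimes>\<^sub>B E a \<otimes>\<^sub>B E b =
     st 0 (E a) (b + a + b) \<circ>\<^sub>B st a (E b) (a + b) \<circ>\<^sub>B st (a + b) (E a) b \<circ>\<^sub>B st (a + b + a) (E b) 0"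
  proof -
    have "st a (E b \<otimes>\<^sub>B E a \<otimes>\<^sub>B E b) 0 = st a (E b) (a + b) \<circ>\<^sub>B st (a + b) (E a \<otimes>\<^sub>B E b) 0"
      by (simp only: tens_eq_st(1)[OF hom_E h3] st_comp[OF h1(2,1)] st_st add_0_right)
    also have "st (a + b) (E a \<otimes>\<^sub>B E b) 0 = st (a + b) (E a) b \<circ>\<^sub>B st (a + b + a) (E b) 0"
      by (simp only: tens_eq_st(1)[OF hom_E hom_E] st_comp[OF h1(4,3)] st_st add_0_right add_0_left)
    finally show ?thesis by (simp only: tens_eq_st(1)[OF hom_E h2] add.assoc)
  qed
  have T: "st (a + b + a) (E b) 0 \<circ>\<^sub>B chords a b b (nested_cup b) = Y"
    using chords_comp_right[OF hom_nested_cup hom_E, of a b] by (simp add: ZR Y_def)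
  have M: "st a (E b) (a + b) \<circ>\<^sub>B Y = Y"
    by (rule E_absorb[OF hom_cast[OF hY]]) (use alternating_chords[OF aZ, of a] in \<open>simp_all add: Y_def\<close>)
  have R: "st (a + b) (E a) b \<circ>\<^sub>B Y = st 0 (E a) (b + a + b) \<circ>\<^sub>B Y"
    unfolding Y_def by (rule E_chords[OF Z, symmetric])
  have c: "st a (E b) (a + b) \<circ>\<^sub>B st 0 (E a) (b + a + b) = st 0 (E a) (b + a + b) \<circ>\<^sub>B st a (E b) (a + b)"
    by (rule st_commute[OF hom_E hom_E, where k = 0]) simp_all
  have LL: "st 0 (E a) (b + a + b) \<circ>\<^sub>B st 0 (E a) (b + a + b) = st 0 (E a) (b + a + b)"
    by (simp only: st_comp[OF hom_E hom_E, symmetric] E_idem)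
  have "st 0 (E a) (b + a + b) \<circ>\<^sub>B st a (E b) (a + b) \<circ>\<^sub>B st 0 (E a) (b + a + b) \<circ>\<^sub>B Y =
      (st 0 (E a) (b + a + b) \<circ>\<^sub>B st 0 (E a) (b + a + b)) \<circ>\<^sub>B st a (E b) (a + b) \<circ>\<^sub>B Y"
    by (simp only: m_comp_assoc[symmetric] c)
  also have "\<dots> = st 0 (E a) (b + a + b) \<circ>\<^sub>B Y" by (simp only: LL M)
  finally show "(E a \<otimes>\<^sub>B E b \<otimes>\<^sub>B E a \<otimes>\<^sub>B E b) \<circ>\<^sub>B (m_id a \<otimes>\<^sub>B braid a b \<otimes>\<^sub>B m_id b) \<circ>\<^sub>B (nested_cup a \<otimes>\<^sub>B nested_cup b)
      = st 0 (E a) (b + a + b) \<circ>\<^sub>B chords a b b Z"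
    unfolding 1 2 m_comp_assoc T R by (simp only: Y_def)
qed

text \<open>Both sides obey the same two-step recursion in \<open>a\<close>. The case a = 1 has no
  pair of chords to cap off, in accordance with \<open>fierz_r 0\<close> being zero in the recursion
  of the sum.\<close>

lemma (in clifford_functional) phi_fierz_diagram:
  defines "Z \<equiv> \<lambda>b. st 0 (E b) b \<circ>\<^sub>B nested_cup b"
  shows "\<phi> (a + b + a + b) (st 0 (E a) (b + a + b) \<circ>\<^sub>B chords a b b (Z b)) =
    \<iota> (fierz_sum a b) * \<phi> 0 (m_id 0)"
proof (induction a rule: less_induct)
  case (less a)
  note Z = fierz_diagram(2,3)[of b, folded Z_def]
  note r0 = phi_chords_Suc_0[OF Z]
  have 0: "\<phi> (0 + b + 0 + b) (st 0 (E 0) (b + 0 + b) \<circ>\<^sub>B chords 0 b b (Z b)) = \<iota> (fierz_sum 0 b) * \<phi> 0 (m_id 0)"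
    unfolding r0(2) fierz_sum_0 Z_def by (rule phi_nested_cup)
  consider "a = 0" | "a = Suc 0" | k where "a = Suc (Suc k)" by (metis not0_implies_Suc)
  then show ?case
  proof cases
    case 1
    then show ?thesis using 0 by simp
  next
    case 2
    have "fierz_r 0 = 0" by (simp add: fierz_r_def)
    then have f: "fierz_sum (Suc 0) b = fierz_l b * fierz_sum 0 b" using fierz_sum_recursion[of 0 b] by simp
    show ?thesis using r0(1) 0 f by (simp only: 2 embed_mult mult.assoc Z_def)
  next
    case 3
    have f: "fierz_sum (Suc (Suc k)) b = fierz_l b * fierz_sum (Suc k) b + fierz_r (Suc k) * fierz_s (Suc k) * fierz_sum k b"
      using fierz_sum_recursion[of "Suc k" b] by simp
    have "k < a" "Suc k < a" using 3 by simp_all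
    then have "\<phi> (a + b + a + b) (st 0 (E a) (b + a + b) \<circ>\<^sub>B chords a b b (Z b)) =
        \<iota> (fierz_l b) * (\<iota> (fierz_sum (Suc k) b) * \<phi> 0 (m_id 0)) +
        \<iota> (fierz_r (Suc k) * fierz_s (Suc k)) * (\<iota> (fierz_sum k b) * \<phi> 0 (m_id 0))"
      using phi_chords_Suc_Suc[OF Z, of k] less[of k] less[of "Suc k"] by (simp only: 3 Z_def)
    also have "\<dots> = \<iota> (fierz_sum a b) * \<phi> 0 (m_id 0)"
      by (simp only: 3 f embed_mult embed_add) (simp add: algebra_simps)
    finally show ?thesis .
  qed
qed

lemma fierz_sum_eq:
  "(\<Sum>m = 0..min a b. fierz_C a b m * (-1) ^ (a * b - m\<^sup>2) * \<z> powi (- 2 * int m)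
        * \<q> powi (int (a * b) - 2 * int ((a - m) * (b - m)))
        * fierz_X (a - m) (b - m) m * (\<Prod>k<a + b - m. qint 2 (- int k))) = fierz_sum a b"
proof -
  have "(\<Sum>m = 0..min a b. fierz_C a b m * (-1) ^ (a * b - m\<^sup>2) * \<z> powi (- 2 * int m)
        * \<q> powi (int (a * b) - 2 * int ((a - m) * (b - m)))
        * fierz_X (a - m) (b - m) m * (\<Prod>k<a + b - m. qint 2 (- int k))) = (\<Sum>m = 0..min a b. fierz_term a b m)"
    by (rule sum.cong[OF HOL.refl], rule fierz_term_eq) simp_all
  also have "\<dots> = fierz_sum a b"
    unfolding fierz_sum_def by (rule sum.mono_neutral_left) (auto simp: fierz_term_outside)
  finally show ?thesis .
qed

theorem mainTheorem1:
  fixes C :: "('o, 'm, 'l :: field) ribbon_data"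
    and \<iota> :: "scalar \<Rightarrow> 'l"
    and Fo :: "nat \<Rightarrow> 'o"
    and Fm :: "mor \<Rightarrow> 'm"
    and \<Delta> :: 'l and S :: 'o and \<gamma> :: 'm
    and a b :: nat
  assumes "spinor_theory C \<iota> Fo Fm \<Delta> S \<gamma>"
  shows "fierz C Fo Fm \<Delta> S \<gamma> a b =
    \<iota> (\<Sum>m = 0..min a b.
        fierz_C a b m * (-1) ^ (a * b - m\<^sup>2) * \<z> powi (- 2 * int m)
        * \<q> powi (int (a * b) - 2 * int ((a - m) * (b - m)))
        * fierz_X (a - m) (b - m) m * (\<Prod>k<a + b - m. qint 2 (- int k)))"
proof -
  interpret spinor_theory C \<iota> Fo Fm \<Delta> S \<gamma> by (fact assms)
  interpret L: clifford_functional \<iota> loopval by (rule loopval_clifford)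
  define f where "f = st 0 (E a) (b + a + b) \<circ>\<^sub>B chords a b b (st 0 (E b) b \<circ>\<^sub>B nested_cup b)"
  have n: "a + b + a + b = 2 * a + 2 * b" by simp
  have "f \<in> m_hom 0 (a + b + a + b)" unfolding f_def
    by (rule hom_comp[OF hom_st[OF hom_E] hom_chords[OF fierz_diagram(2)]]) simp_all
  then have "fierz C Fo Fm \<Delta> S \<gamma> a b = loopval (2 * a + 2 * b) f / \<Delta>"
    by (intro fierz_eq) (simp_all only: n f_def fierz_diagram(1))
  also have "loopval (2 * a + 2 * b) f = \<iota> (fierz_sum a b) * \<Delta>"
    using L.phi_fierz_diagram[of a b] by (simp only: n f_def loopval_id_0)
  finally show ?thesis unfolding fierz_sum_eq using \<Delta>_nonzero by simp
qed

end
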